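(* Let $\mathcal{K}=\langle a,y\mid ay=a,\ y^3=y^2\rangle$ be the directed $2$-complex with one vertex, two edges $a,y$ and two positive $2$-cells, one with top path $ay$ and bottom path $a$, and one with top path $y^3$ and bottom path $y^2$. Then $\mathcal{K}$ is a universal directed $2$-complex. The group $H=\mathcal{D}(\mathcal{K},a)$ is universal, i.e. it contains isomorphic copies of all countable diagram groups. It can be given by the group presentation $$\langle x_0,x_1,x_2,\ldots\mid x_j^{x_i}=x_{j+1},\ 0\le i<j-1\rangle.$$ The group $H$ also has the following finite presentation with three generators and six defining relations: $$\langle x_0,x_1,x_2\mid x_2^{x_0^i}=x_2^{x_0^{i-1}x_1}\ (i=2,3,4),\quad x_2^{x_0^j}=x_2^{x_0^{j-1}x_2}\ (j=3,4,5)\rangle.$$ Here $u^v$ (for group elements $u,v$) means $v^{-1}uv$.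
   Context: Directed $2$-complexes. A directed $2$-complex $\mathcal{K}$ is a directed graph together with a set $\mathbf{F}$ of $2$-cells and maps $\lceil\cdot\rceil,\lfloor\cdot\rfloor\colon\mathbf{F}\to\mathbf{P}$ (top, bottom), ${}^{-1}\colon\mathbf{F}\to\mathbf{F}$ (inverse), where $\mathbf{P}$ is the set of all directed paths of the graph including empty paths (called $1$-paths; initial and terminal vertices are $\iota(p),\tau(p)$). It is required that for each $f$ the paths $\lceil f\rceil,\lfloor f\rfloor$ are non-empty with common initial vertex $\iota(f)$ and common terminal vertex $\tau(f)$, and that ${}^{-1}$ is an involution without fixed points with $\lceil f^{-1}\rceil=\lfloor f\rfloor$, $\lfloor f^{-1}\rfloor=\lceil f\rceil$. An orientation is a choice of a set $\mathbf{F}^+$ of positive $2$-cells with $\mathbf{F}=\mathbf{F}^+\sqcup(\mathbf{F}^+)^{-1}$. The notation $\langle \mathbf{E}\mid \ldots\rangle$ (for directed $2$-complexes) denotes the directed $2$-complex with one vertex, edge set $\mathbf{E}$, and one positive $2$-cell with top path $u$ and bottom path $v$ for each listed relation $u=v$ (plus the inverse cells). Diagram groups. An atomic $2$-path is a triple $\delta=(p,f,q)$ with $p,q$ $1$-paths, $f\in\mathbf{F}$, $\tau(p)=\iota(f)$, $\tau(f)=\iota(q)$; $\lceil\delta\rceil=p\lceil f\rceil q$, $\lfloor\delta\rfloor=p\lfloor f\rfloor q$, $\delta^{-1}=(p,f^{-1},q)$. A $2$-path is a finite sequence $\delta_1\circ\cdots\circ\delta_n$ of atomic $2$-paths with $\lfloor\delta_i\rfloor=\lceil\delta_{i+1}\rceil$;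 its top and bottom are $\lceil\delta_1\rceil$, $\lfloor\delta_n\rfloor$; each $1$-path $p$ is also a trivial $2$-path from $p$ to $p$. Homotopy of $2$-paths is the smallest equivalence relation invariant under concatenation such that $\delta\circ\delta^{-1}$ is equivalent to the trivial $2$-path and $(p,f_1,q\lceil f_2\rceil r)\circ(p\lfloor f_1\rfloor q,f_2,r)$ is equivalent to $(p\lceil f_1\rceil q,f_2,r)\circ(p,f_1,q\lfloor f_2\rfloor r)$. The diagram groupoid $\mathcal{D}(\mathcal{K})$ has the $1$-paths as objects and homotopy classes of $2$-paths as morphisms (product induced by concatenation). The diagram group $\mathcal{D}(\mathcal{K},p)$ is the local group of $\mathcal{D}(\mathcal{K})$ at $p$, i.e. the group of classes of $2$-paths from $p$ to $p$. A diagram group is any group of this form. Morphisms. A morphism $\phi\colon\mathcal{K}\to\mathcal{K}'$ maps vertices to vertices, edges to non-empty $1$-paths, $2$-cells to $2$-paths, and preserves $\iota,\tau$, top, bottom and inverses (with $\phi(e_1\cdots e_k)=\phi(e_1)\cdots\phi(e_k)$). It induces homomorphisms $\phi_p\colon\mathcal{D}(\mathcal{K},p)\to\mathcal{D}(\mathcal{K}',\phi(p))$, where $(p,f,q)$ is sent to $\phi(f)$ with every atomic factor multiplied by $\phi(p)$ on the left and $\phi(q)$ on the right. The morphism is $p$-nonsingular if $\phi_p$ is injective, and nonsingular if it is $p$-nonsingular for every non-empty $1$-path $p$ of $\mathcal{K}$. A directed $2$-complex is universal if every finite or countable directed $2$-complex admits a nonsingular morphism into it. *)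

theory Defs
  imports
    "Graph_Theory.Arc_Walk"
    "HOL-Algebra.Group"
    "HOL-Library.Countable_Set"
begin

section \<open>Paths in a directed graph\<close>

text \<open>
  Graphs are allowed to be infinite and to have loops and multiple arcs.  A path is a pair
  of its initial vertex and its list of arcs, so that there is one empty path at each vertex.
\<close>

type_synonym ('v, 'e) path = "'v \<times> 'e list"

definition paths :: "('v, 'e) pre_digraph \<Rightarrow> ('v, 'e) path set" where
  "paths G = {(u, es) |u es. \<exists>v. pre_digraph.awalk G u es v}"

definition start_of :: "('v, 'e) path \<Rightarrow> 'v" where
  "start_of p = fst p"

definition end_of :: "('v, 'e) pre_digraph \<Rightarrow> ('v, 'e) path \<Rightarrow> 'v" where
  "end_of G p = pre_digraph.awlast G (fst p) (snd p)"

definition nonempty :: "('v, 'e) path \<Rightarrow> bool" where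
  "nonempty p \<longleftrightarrow> snd p \<noteq> []"

text \<open>Concatenation; only meaningful if the first path ends where the second one starts.\<close>

definition path_comp :: "('v, 'e) path \<Rightarrow> ('v, 'e) path \<Rightarrow> ('v, 'e) path" (infixr "\<Zcomp>" 70) where
  "p \<Zcomp> q = (fst p, snd p @ snd q)"


section \<open>Directed 2-complexes\<close>

record ('v, 'e, 'f) d2complex =
  skel :: "('v, 'e) pre_digraph"
  cells :: "'f set"
  ctop :: "'f \<Rightarrow> ('v, 'e) path"
  cbot :: "'f \<Rightarrow> ('v, 'e) path"
  cinv :: "'f \<Rightarrow> 'f"

locale directed_2complex =
  fixes K :: "('v, 'e, 'f) d2complex"
  assumes wf_skel: "wf_digraph (skel K)"
    and ctop_path: "f \<in> cells K \<Longrightarrow> ctop K f \<in> paths (skel K)"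
    and cbot_path: "f \<in> cells K \<Longrightarrow> cbot K f \<in> paths (skel K)"
    and ctop_nonempty: "f \<in> cells K \<Longrightarrow> nonempty (ctop K f)"
    and cbot_nonempty: "f \<in> cells K \<Longrightarrow> nonempty (cbot K f)"
    and init_eq: "f \<in> cells K \<Longrightarrow> start_of (ctop K f) = start_of (cbot K f)"
    and term_eq: "f \<in> cells K \<Longrightarrow> end_of (skel K) (ctop K f) = end_of (skel K) (cbot K f)"
    and cinv_cell: "f \<in> cells K \<Longrightarrow> cinv K f \<in> cells K"
    and cinv_cinv: "f \<in> cells K \<Longrightarrow> cinv K (cinv K f) = f"
    and cinv_neq: "f \<in> cells K \<Longrightarrow> cinv K f \<noteq> f"
    and ctop_cinv: "f \<in> cells K \<Longrightarrow> ctop K (cinv K f) = cbot K f"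
    and cbot_cinv: "f \<in> cells K \<Longrightarrow> cbot K (cinv K f) = ctop K f"

definition countable_d2complex :: "('v, 'e, 'f) d2complex \<Rightarrow> bool" where
  "countable_d2complex K \<longleftrightarrow>
     countable (verts (skel K)) \<and> countable (arcs (skel K)) \<and> countable (cells K)"

text \<open>
  The complex \<open>\<langle>E | u = v, \<dots>\<rangle>\<close> for a set \<open>R\<close> of relations \<open>(u, v)\<close> between non-empty words
  over \<open>E\<close>: the cell \<open>((u, v), True)\<close> is the positive 2-cell of \<open>u = v\<close>, the cell
  \<open>((u, v), False)\<close> its inverse.
\<close>

definition rel_complex ::
    "'e set \<Rightarrow> ('e list \<times> 'e list) set \<Rightarrow> (unit, 'e, ('e list \<times> 'e list) \<times> bool) d2complex" where
  "rel_complex E R =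
     \<lparr> skel = \<lparr> verts = {()}, arcs = E, tail = (\<lambda>_. ()), head = (\<lambda>_. ()) \<rparr>,
       cells = R \<times> UNIV,
       ctop = (\<lambda>((u, v), pos). ((), if pos then u else v)),
       cbot = (\<lambda>((u, v), pos). ((), if pos then v else u)),
       cinv = (\<lambda>(r, pos). (r, \<not> pos)) \<rparr>"


section \<open>2-paths and homotopy\<close>

type_synonym ('v, 'e, 'f) atomic = "('v, 'e) path \<times> 'f \<times> ('v, 'e) path"

definition atomics :: "('v, 'e, 'f) d2complex \<Rightarrow> ('v, 'e, 'f) atomic set" where
  "atomics K = {(p, f, q) |p f q.
     p \<in> paths (skel K) \<and> f \<in> cells K \<and> q \<in> paths (skel K) \<and>
     end_of (skel K) p = start_of (ctop K f) \<and> end_of (skel K) (ctop K f) = start_of q}"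

definition atop :: "('v, 'e, 'f) d2complex \<Rightarrow> ('v, 'e, 'f) atomic \<Rightarrow> ('v, 'e) path" where
  "atop K = (\<lambda>(p, f, q). p \<Zcomp> ctop K f \<Zcomp> q)"

definition abot :: "('v, 'e, 'f) d2complex \<Rightarrow> ('v, 'e, 'f) atomic \<Rightarrow> ('v, 'e) path" where
  "abot K = (\<lambda>(p, f, q). p \<Zcomp> cbot K f \<Zcomp> q)"

definition ainv :: "('v, 'e, 'f) d2complex \<Rightarrow> ('v, 'e, 'f) atomic \<Rightarrow> ('v, 'e, 'f) atomic" where
  "ainv K = (\<lambda>(p, f, q). (p, cinv K f, q))"

text \<open>
  A sequence of atomic 2-paths in which the bottom of each entry is the top of the next one
  is a path in the following graph, whose vertices are the 1-paths of \<open>K\<close>.  The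
  empty path at the vertex \<open>p\<close> is the trivial 2-path from \<open>p\<close> to \<open>p\<close>, and
  \<^const>\<open>start_of\<close> and \<^const>\<open>end_of\<close> are the top and the bottom of a 2-path.
\<close>

definition two_graph :: "('v, 'e, 'f) d2complex \<Rightarrow> (('v, 'e) path, ('v, 'e, 'f) atomic) pre_digraph" where
  "two_graph K =
     \<lparr> verts = paths (skel K), arcs = atomics K, tail = atop K, head = abot K \<rparr>"

type_synonym ('v, 'e, 'f) two_path = "(('v, 'e) path, ('v, 'e, 'f) atomic) path"

definition two_paths :: "('v, 'e, 'f) d2complex \<Rightarrow> ('v, 'e, 'f) two_path set" where
  "two_paths K = paths (two_graph K)"

definition top_of :: "('v, 'e, 'f) two_path \<Rightarrow> ('v, 'e) path" where
  "top_of \<Gamma> = start_of \<Gamma>"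

definition bot_of :: "('v, 'e, 'f) d2complex \<Rightarrow> ('v, 'e, 'f) two_path \<Rightarrow> ('v, 'e) path" where
  "bot_of K \<Gamma> = end_of (two_graph K) \<Gamma>"

definition two_inv :: "('v, 'e, 'f) d2complex \<Rightarrow> ('v, 'e, 'f) two_path \<Rightarrow> ('v, 'e, 'f) two_path" where
  "two_inv K \<Gamma> = (bot_of K \<Gamma>, rev (map (ainv K) (snd \<Gamma>)))"

inductive homotopic :: "('v, 'e, 'f) d2complex \<Rightarrow> ('v, 'e, 'f) two_path \<Rightarrow> ('v, 'e, 'f) two_path \<Rightarrow> bool"
  for K where
  refl: "\<Gamma> \<in> two_paths K \<Longrightarrow> homotopic K \<Gamma> \<Gamma>"
| sym: "homotopic K \<Gamma> \<Delta> \<Longrightarrow> homotopic K \<Delta> \<Gamma>"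
| trans: "homotopic K \<Gamma> \<Delta> \<Longrightarrow> homotopic K \<Delta> \<Theta> \<Longrightarrow> homotopic K \<Gamma> \<Theta>"
| comp: "homotopic K \<Gamma> \<Gamma>' \<Longrightarrow> homotopic K \<Delta> \<Delta>' \<Longrightarrow> bot_of K \<Gamma> = top_of \<Delta> \<Longrightarrow>
    homotopic K (\<Gamma> \<Zcomp> \<Delta>) (\<Gamma>' \<Zcomp> \<Delta>')"
| cancel: "\<delta> \<in> atomics K \<Longrightarrow> homotopic K (atop K \<delta>, [\<delta>, ainv K \<delta>]) (atop K \<delta>, [])"
| indep: "p \<in> paths (skel K) \<Longrightarrow> f \<in> cells K \<Longrightarrow> q \<in> paths (skel K) \<Longrightarrow> g \<in> cells K \<Longrightarrow>
    r \<in> paths (skel K) \<Longrightarrow>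
    end_of (skel K) p = start_of (ctop K f) \<Longrightarrow> end_of (skel K) (ctop K f) = start_of q \<Longrightarrow>
    end_of (skel K) q = start_of (ctop K g) \<Longrightarrow> end_of (skel K) (ctop K g) = start_of r \<Longrightarrow>
    homotopic K
      (p \<Zcomp> ctop K f \<Zcomp> q \<Zcomp> ctop K g \<Zcomp> r,
        [(p, f, q \<Zcomp> ctop K g \<Zcomp> r), (p \<Zcomp> cbot K f \<Zcomp> q, g, r)])
      (p \<Zcomp> ctop K f \<Zcomp> q \<Zcomp> ctop K g \<Zcomp> r,
        [(p \<Zcomp> ctop K f \<Zcomp> q, g, r), (p, f, q \<Zcomp> cbot K g \<Zcomp> r)])"

definition hclass :: "('v, 'e, 'f) d2complex \<Rightarrow> ('v, 'e, 'f) two_path \<Rightarrow> ('v, 'e, 'f) two_path set" where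
  "hclass K \<Gamma> = {\<Delta>. homotopic K \<Gamma> \<Delta>}"


section \<open>Diagram groups\<close>

definition diagram_group ::
    "('v, 'e, 'f) d2complex \<Rightarrow> ('v, 'e) path \<Rightarrow> ('v, 'e, 'f) two_path set monoid" where
  "diagram_group K p =
     \<lparr> carrier = {hclass K \<Gamma> |\<Gamma>. \<Gamma> \<in> two_paths K \<and> top_of \<Gamma> = p \<and> bot_of K \<Gamma> = p},
       mult = (\<lambda>A B. \<Union>\<Gamma>\<in>A. \<Union>\<Delta>\<in>B. hclass K (\<Gamma> \<Zcomp> \<Delta>)),
       one = hclass K (p, []) \<rparr>"


section \<open>Morphisms\<close>

record ('v, 'e, 'f, 'v1, 'e1, 'f1) d2map =
  vmap :: "'v \<Rightarrow> 'v1"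
  emap :: "'e \<Rightarrow> ('v1, 'e1) path"
  cmap :: "'f \<Rightarrow> ('v1, 'e1, 'f1) two_path"

definition pmap :: "('v, 'e, 'f, 'v1, 'e1, 'f1) d2map \<Rightarrow> ('v, 'e) path \<Rightarrow> ('v1, 'e1) path" where
  "pmap \<phi> p = (vmap \<phi> (fst p), concat (map (\<lambda>e. snd (emap \<phi> e)) (snd p)))"

locale d2morphism = source: directed_2complex K + target: directed_2complex K'
  for K :: "('v, 'e, 'f) d2complex" and K' :: "('v1, 'e1, 'f1) d2complex" +
  fixes \<phi> :: "('v, 'e, 'f, 'v1, 'e1, 'f1) d2map"
  assumes vmap_vert: "v \<in> verts (skel K) \<Longrightarrow> vmap \<phi> v \<in> verts (skel K')"
    and emap_path: "e \<in> arcs (skel K) \<Longrightarrow> emap \<phi> e \<in> paths (skel K')"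
    and emap_nonempty: "e \<in> arcs (skel K) \<Longrightarrow> nonempty (emap \<phi> e)"
    and init_emap: "e \<in> arcs (skel K) \<Longrightarrow> start_of (emap \<phi> e) = vmap \<phi> (tail (skel K) e)"
    and term_emap: "e \<in> arcs (skel K) \<Longrightarrow> end_of (skel K') (emap \<phi> e) = vmap \<phi> (head (skel K) e)"
    and cmap_two_path: "f \<in> cells K \<Longrightarrow> cmap \<phi> f \<in> two_paths K'"
    and top_cmap: "f \<in> cells K \<Longrightarrow> top_of (cmap \<phi> f) = pmap \<phi> (ctop K f)"
    and bot_cmap: "f \<in> cells K \<Longrightarrow> bot_of K' (cmap \<phi> f) = pmap \<phi> (cbot K f)"
    and cmap_cinv: "f \<in> cells K \<Longrightarrow> cmap \<phi> (cinv K f) = two_inv K' (cmap \<phi> f)"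

definition whisker :: "('v, 'e) path \<Rightarrow> ('v, 'e, 'f) two_path \<Rightarrow> ('v, 'e) path \<Rightarrow> ('v, 'e, 'f) two_path" where
  "whisker P \<Gamma> Q = (P \<Zcomp> fst \<Gamma> \<Zcomp> Q, map (\<lambda>(p, f, q). (P \<Zcomp> p, f, q \<Zcomp> Q)) (snd \<Gamma>))"

definition amap :: "('v, 'e, 'f, 'v1, 'e1, 'f1) d2map \<Rightarrow> ('v, 'e, 'f) atomic \<Rightarrow> ('v1, 'e1, 'f1) two_path" where
  "amap \<phi> = (\<lambda>(p, f, q). whisker (pmap \<phi> p) (cmap \<phi> f) (pmap \<phi> q))"

definition two_map :: "('v, 'e, 'f, 'v1, 'e1, 'f1) d2map \<Rightarrow> ('v, 'e, 'f) two_path \<Rightarrow> ('v1, 'e1, 'f1) two_path" where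
  "two_map \<phi> \<Gamma> = (pmap \<phi> (fst \<Gamma>), concat (map (\<lambda>\<delta>. snd (amap \<phi> \<delta>)) (snd \<Gamma>)))"

text \<open>
  The homomorphism \<open>\<phi>\<^sub>p\<close> induced by \<open>\<phi>\<close> on the diagram group at \<open>p\<close>; since it
  is evaluated on all representatives of a homotopy class, it needs no index \<open>p\<close>.
\<close>

definition induced ::
    "('v1, 'e1, 'f1) d2complex \<Rightarrow> ('v, 'e, 'f, 'v1, 'e1, 'f1) d2map \<Rightarrow>
     ('v, 'e, 'f) two_path set \<Rightarrow> ('v1, 'e1, 'f1) two_path set" where
  "induced K' \<phi> A = (\<Union>\<Gamma>\<in>A. hclass K' (two_map \<phi> \<Gamma>))"

definition p_nonsingular ::
    "('v, 'e, 'f) d2complex \<Rightarrow> ('v1, 'e1, 'f1) d2complex \<Rightarrow> ('v, 'e, 'f, 'v1, 'e1, 'f1) d2map \<Rightarrow>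
     ('v, 'e) path \<Rightarrow> bool" where
  "p_nonsingular K K' \<phi> p \<longleftrightarrow> inj_on (induced K' \<phi>) (carrier (diagram_group K p))"

definition nonsingular ::
    "('v, 'e, 'f) d2complex \<Rightarrow> ('v1, 'e1, 'f1) d2complex \<Rightarrow> ('v, 'e, 'f, 'v1, 'e1, 'f1) d2map \<Rightarrow> bool" where
  "nonsingular K K' \<phi> \<longleftrightarrow> (\<forall>p \<in> paths (skel K). nonempty p \<longrightarrow> p_nonsingular K K' \<phi> p)"


section \<open>Universality\<close>

text \<open>
  A definition cannot quantify over types.  The types of the vertices, edges and 2-cells of
  the complexes to be mapped into \<open>K\<close> (or whose diagram groups are to be embedded) are
  therefore a parameter; stating universality for type variables gives it for all types.
\<close>

definition universal_d2complex ::
    "('v \<times> 'e \<times> 'f) itself \<Rightarrow> ('v1, 'e1, 'f1) d2complex \<Rightarrow> bool" where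
  "universal_d2complex _ K \<longleftrightarrow> directed_2complex K \<and>
     (\<forall>L :: ('v, 'e, 'f) d2complex. directed_2complex L \<and> countable_d2complex L \<longrightarrow>
        (\<exists>\<phi>. d2morphism L K \<phi> \<and> nonsingular L K \<phi>))"

text \<open>Note that a diagram group over an uncountable complex may be countable.\<close>

definition universal_diagram_group ::
    "('v \<times> 'e \<times> 'f) itself \<Rightarrow> 'g monoid \<Rightarrow> bool" where
  "universal_diagram_group _ H \<longleftrightarrow>
     (\<forall>(L :: ('v, 'e, 'f) d2complex) p.
        directed_2complex L \<and> p \<in> paths (skel L) \<and> countable (carrier (diagram_group L p)) \<longrightarrow>
        (\<exists>S. subgroup S H \<and> diagram_group L p \<cong> H\<lparr>carrier := S\<rparr>))"


section \<open>Group presentations\<close>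

text \<open>
  In a group word, \<open>(x, True)\<close> stands for the generator \<open>x\<close> and \<open>(x, False)\<close> for its inverse.
\<close>

type_synonym 'x gword = "('x \<times> bool) list"

definition gwords :: "'x set \<Rightarrow> 'x gword set" where
  "gwords X = lists (X \<times> UNIV)"

definition gen :: "'x \<Rightarrow> 'x gword" where
  "gen x = [(x, True)]"

definition winv :: "'x gword \<Rightarrow> 'x gword" where
  "winv w = rev (map (\<lambda>(x, s). (x, \<not> s)) w)"

definition wpow :: "'x gword \<Rightarrow> nat \<Rightarrow> 'x gword" where
  "wpow w n = concat (replicate n w)"

definition wconj :: "'x gword \<Rightarrow> 'x gword \<Rightarrow> 'x gword" where
  "wconj u v = winv v @ u @ v"

text \<open>
  HOL-Algebra has no non-abelian free groups.  Taking words over generators and inverse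
  letters modulo the smallest congruence containing free cancellation and the relations is the
  same as dividing the free group by the normal closure of the elements \<open>u v\<^sup>-\<^sup>1\<close>.
\<close>

inductive word_eq :: "'x set \<Rightarrow> ('x gword \<times> 'x gword) set \<Rightarrow> 'x gword \<Rightarrow> 'x gword \<Rightarrow> bool"
  for X R where
  refl: "u \<in> gwords X \<Longrightarrow> word_eq X R u u"
| sym: "word_eq X R u v \<Longrightarrow> word_eq X R v u"
| trans: "word_eq X R u v \<Longrightarrow> word_eq X R v w \<Longrightarrow> word_eq X R u w"
| app: "word_eq X R u u' \<Longrightarrow> word_eq X R v v' \<Longrightarrow> word_eq X R (u @ v) (u' @ v')"
| inverse: "x \<in> X \<Longrightarrow> word_eq X R [(x, s), (x, \<not> s)] []"
| rel: "(u, v) \<in> R \<Longrightarrow> u \<in> gwords X \<Longrightarrow> v \<in> gwords X \<Longrightarrow> word_eq X R u v"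

definition wclass :: "'x set \<Rightarrow> ('x gword \<times> 'x gword) set \<Rightarrow> 'x gword \<Rightarrow> 'x gword set" where
  "wclass X R u = {v. word_eq X R u v}"

definition presented_group :: "'x set \<Rightarrow> ('x gword \<times> 'x gword) set \<Rightarrow> 'x gword set monoid" where
  "presented_group X R =
     \<lparr> carrier = wclass X R ` gwords X,
       mult = (\<lambda>A B. \<Union>u\<in>A. \<Union>v\<in>B. wclass X R (u @ v)),
       one = wclass X R [] \<rparr>"


section \<open>The complex \<open>\<langle>a, y | ay = a, y\<^sup>3 = y\<^sup>2\<rangle>\<close> and its diagram group\<close>

datatype edge = Edge_a | Edge_y

definition K_ay :: "(unit, edge, (edge list \<times> edge list) \<times> bool) d2complex" where
  "K_ay = rel_complex {Edge_a, Edge_y}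
     {([Edge_a, Edge_y], [Edge_a]), ([Edge_y, Edge_y, Edge_y], [Edge_y, Edge_y])}"

definition H_ay :: "(unit, edge, (edge list \<times> edge list) \<times> bool) two_path set monoid" where
  "H_ay = diagram_group K_ay ((), [Edge_a])"

end

theory Submission
  imports Defs
begin

text \<open>
  \<^bold>\<open>Why every countable complex maps faithfully.\<close>  Choose bijections \<open>X \<times> X \<times> X \<rightarrow> X \<times> X\<close> and
  \<open>X \<times> X \<rightarrow> X\<close>.  Applying the first to a segment of a tuple whenever a cell of \<open>y\<^sup>3 = y\<^sup>2\<close> is
  applied to a path, and the second for \<open>ay = a\<close>, makes homotopy classes of 2-paths over the complex
  act on tuples: interchange holds because disjoint segments are rewritten independently.  The
  bijections are completely arbitrary, and one choice of them simulates all countable complexes.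

  What has to be simulated is the term algebra of a complex, where a cell with inputs \<open>ts\<close> produces the
  formal outputs \<open>Op l 0 ts\<close>, \<open>Op l 1 ts\<close>, \<open>\<dots>\<close>, except that the outputs of the inverse cell are
  turned back into the inputs of the latter.  A 2-path is reduced if this exception never occurs.
  Every 2-path is homotopic to a reduced one (\<open>reduced_exists\<close>), because the outputs of an
  application of a cell identify that application, which can then be commuted to the end and
  cancelled (\<open>undo_last_cell\<close>).  A nonempty reduced 2-path changes the tuple of generators.  So the
  term algebra detects nontrivial elements of diagram groups.

  The morphism into \<open>\<langle>a, y | ay = a, y\<^sup>3 = y\<^sup>2\<rangle>\<close> sends each edge to \<open>y\<^sup>2\<close>, a term being encoded by
  a pair of symbols, and each cell to a 2-path that acts as a program: it packs the inputs into a
  single symbol, sets a counter to the number of the cell, lets the bijection transform the package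
  according to the counter, resets the counter and unpacks the result.  The few rules that the
  bijection has to obey form a partial bijection with infinite complements, hence extend to a
  bijection (\<open>token_rule_extends\<close>).  Faithfulness of the action gives nonsingularity
  (\<open>universal_map_faithful\<close>).

  \<^bold>\<open>Why the group at a is universal.\<close>  Adding the edge \<open>a\<close> on the left of images of 2-paths keeps the
  action faithful, and all paths \<open>a y\<^sup>n\<close> are connected to \<open>a\<close>.  If the complex is uncountable but
  the diagram group is countable, only the countably many cells in chosen representatives have to
  be distinguished by their numbers (\<open>diagram_group_embeds\<close>).

  \<^bold>\<open>Why the presentations hold.\<close>  From \<open>a\<close> only the paths \<open>a y\<^sup>n\<close> can be reached.  With the cells
  of \<open>ay = a\<close> as a maximal tree, a cell of \<open>y\<^sup>3 = y\<^sup>2\<close> becomes a loop that depends only on the number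
  \<open>j\<close> of letters to its right; this loop, oriented so that it lengthens the path, is the generator
  \<open>x\<^sub>j\<close>.  The interchanges of two such cells are the relations of the infinite presentation
  (\<open>H_ay_iso_shift\<close>).  The generators from \<open>x\<^sub>3\<close> on are conjugates of \<open>x\<^sub>2\<close> by powers of \<open>x\<^sub>0\<close>, and
  an induction as for R. Thompson's group \<open>F\<close> derives all relations from the six given ones
  (\<open>shift_relations_from_six\<close>).
\<close>

section \<open>The groupoid of homotopy classes of 2-paths\<close>

(* Paths are pairs; splitting quantified paths into vertex and arc list would undo the
   path-level reasoning below. *)
declare split_paired_Ex [simp del] split_paired_All [simp del]

text \<open>
Homotopy is handled on lists of atomic 2-paths: this predicate makes both ends of a 2-path
explicit, so that the side conditions of concatenation become plain equations between ends.
\<close>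

fun chain :: "('v, 'e, 'f) d2complex \<Rightarrow> ('v, 'e) path \<Rightarrow> ('v, 'e, 'f) atomic list \<Rightarrow>
    ('v, 'e) path \<Rightarrow> bool" where
  "chain K P [] Q \<longleftrightarrow> P \<in> paths (skel K) \<and> Q = P"
| "chain K P (d # ds) Q \<longleftrightarrow> d \<in> atomics K \<and> atop K d = P \<and> chain K (abot K d) ds Q"

lemma path_comp_assoc [simp]: "(p \<Zcomp> q) \<Zcomp> r = p \<Zcomp> q \<Zcomp> r"
  by (simp add: path_comp_def)

lemma start_of_path_comp [simp]: "start_of (p \<Zcomp> q) = start_of p"
  by (simp add: path_comp_def start_of_def)

lemma fst_path_comp [simp]: "fst (p \<Zcomp> q) = fst p"
  by (simp add: path_comp_def)

lemma snd_path_comp [simp]: "snd (p \<Zcomp> q) = snd p @ snd q"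
  by (simp add: path_comp_def)

lemma atop_simp [simp]: "atop K (p, f, q) = p \<Zcomp> ctop K f \<Zcomp> q"
  and abot_simp [simp]: "abot K (p, f, q) = p \<Zcomp> cbot K f \<Zcomp> q"
  and ainv_simp [simp]: "ainv K (p, f, q) = (p, cinv K f, q)"
  by (simp_all add: atop_def abot_def ainv_def)

context directed_2complex
begin

lemma end_of_path_comp: "end_of (skel K) p = start_of q \<Longrightarrow> end_of (skel K) (p \<Zcomp> q) = end_of (skel K) q"
  unfolding end_of_def start_of_def path_comp_def
  using wf_digraph.awlast_append[OF wf_skel] by simp

lemma path_comp_in_paths:
  assumes "p \<in> paths (skel K)" "q \<in> paths (skel K)" "end_of (skel K) p = start_of q"
  shows "p \<Zcomp> q \<in> paths (skel K)"
  using assms wf_digraph.awalk_appendI[OF wf_skel] wf_digraph.awlast_of_awalk[OF wf_skel]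
  unfolding paths_def end_of_def start_of_def path_comp_def
  by (auto simp: NO_MATCH_def) metis

lemma atomicsI:
  assumes "p \<in> paths (skel K)" "f \<in> cells K" "q \<in> paths (skel K)"
    "end_of (skel K) p = start_of (ctop K f)" "end_of (skel K) (ctop K f) = start_of q"
  shows "(p, f, q) \<in> atomics K"
  using assms unfolding atomics_def by blast

lemma atomicsD:
  assumes "(p, f, q) \<in> atomics K"
  shows "p \<in> paths (skel K)" "f \<in> cells K" "q \<in> paths (skel K)"
    "end_of (skel K) p = start_of (ctop K f)" "end_of (skel K) (ctop K f) = start_of q"
    "end_of (skel K) p = start_of (cbot K f)" "end_of (skel K) (cbot K f) = start_of q"
  using assms init_eq term_eq unfolding atomics_def by auto

lemma atop_in_paths: "d \<in> atomics K \<Longrightarrow> atop K d \<in> paths (skel K)"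
  by (cases d rule: prod_cases3)
    (simp add: atomicsD ctop_path end_of_path_comp path_comp_in_paths)

lemma ainv_atomic:
  assumes "d \<in> atomics K"
  shows "ainv K d \<in> atomics K"
proof (cases d rule: prod_cases3)
  case (fields p f q)
  then have d: "(p, f, q) \<in> atomics K" using assms by simp
  then show ?thesis
    unfolding fields ainv_simp
    using atomicsD[OF d] cinv_cell ctop_cinv by (intro atomicsI) auto
qed

lemma atop_ainv [simp]: "d \<in> atomics K \<Longrightarrow> atop K (ainv K d) = abot K d"
  by (cases d rule: prod_cases3) (simp add: atomicsD ctop_cinv init_eq)

lemma abot_ainv [simp]: "d \<in> atomics K \<Longrightarrow> abot K (ainv K d) = atop K d"
  by (cases d rule: prod_cases3) (simp add: atomicsD cbot_cinv init_eq)

lemma ainv_ainv [simp]: "d \<in> atomics K \<Longrightarrow> ainv K (ainv K d) = d"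
  by (cases d rule: prod_cases3) (simp add: atomicsD cinv_cinv)

lemma abot_in_paths: "d \<in> atomics K \<Longrightarrow> abot K d \<in> paths (skel K)"
  by (metis ainv_atomic atop_ainv atop_in_paths)

lemma wf_two_graph: "wf_digraph (two_graph K)"
  by unfold_locales (auto simp: two_graph_def atop_in_paths abot_in_paths)

lemma chain_iff_awalk: "chain K P ds Q \<longleftrightarrow> pre_digraph.awalk (two_graph K) P ds Q"
proof (induction ds arbitrary: P)
  case Nil
  show ?case
    using wf_digraph.awalk_Nil_iff[OF wf_two_graph, of P Q] by (auto simp: two_graph_def)
next
  case (Cons d ds)
  then show ?case
    by (auto simp: pre_digraph.awalk_def pre_digraph.cas.simps two_graph_def
        atop_in_paths abot_in_paths)
qed

lemma two_path_iff: "\<Gamma> \<in> two_paths K \<longleftrightarrow> (\<exists>Q. chain K (fst \<Gamma>) (snd \<Gamma>) Q)"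
  by (cases \<Gamma>) (simp add: two_paths_def paths_def chain_iff_awalk)

lemma bot_of_chain: "chain K P ds Q \<Longrightarrow> bot_of K (P, ds) = Q"
  by (simp add: chain_iff_awalk bot_of_def end_of_def
      wf_digraph.awlast_of_awalk[OF wf_two_graph] NO_MATCH_def)

lemma two_pathE:
  assumes "\<Gamma> \<in> two_paths K"
  obtains P ds where "\<Gamma> = (P, ds)" "chain K P ds (bot_of K \<Gamma>)"
  using assms two_path_iff[of \<Gamma>] bot_of_chain by (metis prod.collapse)

lemma chain_in_two_paths: "chain K P ds Q \<Longrightarrow> (P, ds) \<in> two_paths K"
  by (auto simp: two_path_iff)

lemma chain_paths: "chain K P ds Q \<Longrightarrow> P \<in> paths (skel K) \<and> Q \<in> paths (skel K)"
  by (induction ds arbitrary: P) (simp, metis atop_in_paths chain.simps(2))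

lemma chain_append: "chain K P (ds @ es) Q \<longleftrightarrow> (\<exists>R. chain K P ds R \<and> chain K R es Q)"
  by (induction ds arbitrary: P) (auto dest: chain_paths)

lemma chain_appendI: "chain K P ds R \<Longrightarrow> chain K R es Q \<Longrightarrow> chain K P (ds @ es) Q"
  by (auto simp: chain_append)

lemma chain_unique: "chain K P ds Q \<Longrightarrow> chain K P ds R \<Longrightarrow> Q = R"
  by (induction ds arbitrary: P) (simp, metis chain.simps(2))

lemma chain_single: "d \<in> atomics K \<Longrightarrow> chain K (atop K d) [d] (abot K d)"
  by (auto simp: abot_in_paths)

definition invs where "invs ds = rev (map (ainv K) ds)"

lemma invs_append [simp]: "invs (ds @ es) = invs es @ invs ds"
  and invs_Nil [simp]: "invs [] = []"
  and invs_Cons: "invs (d # ds) = invs ds @ [ainv K d]"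
  by (simp_all add: invs_def)

lemma chain_invs: "chain K P ds Q \<Longrightarrow> chain K Q (invs ds) P"
  by (induction ds arbitrary: P)
    (auto simp: invs_Cons chain_append ainv_atomic atop_in_paths)

lemma invs_invs: "chain K P ds Q \<Longrightarrow> invs (invs ds) = ds"
proof (induction ds arbitrary: P)
  case (Cons d ds)
  then have "invs (invs ds) = ds" "d \<in> atomics K" by (metis chain.simps(2))+
  then show ?case by (simp add: invs_Cons)
qed simp

lemma atomics_chain: "chain K P ds Q \<Longrightarrow> set ds \<subseteq> atomics K"
  by (induction ds arbitrary: P) (simp, metis chain.simps(2) insert_subset list.simps(15))

lemma homotopic_ends:
  "homotopic K \<Gamma> \<Delta> \<Longrightarrow> fst \<Gamma> = fst \<Delta> \<and> (\<exists>Q. chain K (fst \<Gamma>) (snd \<Gamma>) Q \<and> chain K (fst \<Delta>) (snd \<Delta>) Q)"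
proof (induction rule: homotopic.induct)
  case (refl \<Gamma>)
  then show ?case by (auto simp: two_path_iff)
next
  case (sym \<Gamma> \<Delta>)
  then show ?case by auto
next
  case (trans \<Gamma> \<Delta> \<Theta>)
  then show ?case by (metis chain_unique)
next
  case (comp \<Gamma> \<Gamma>' \<Delta> \<Delta>')
  then obtain Q R where *: "chain K (fst \<Gamma>) (snd \<Gamma>) Q" "chain K (fst \<Gamma>') (snd \<Gamma>') Q"
    "chain K (fst \<Delta>) (snd \<Delta>) R" "chain K (fst \<Delta>') (snd \<Delta>') R" by blast
  moreover have "Q = fst \<Delta>"
    using comp.hyps(3) bot_of_chain[of "fst \<Gamma>" "snd \<Gamma>" Q] * by (simp add: top_of_def start_of_def)
  ultimately show ?case using comp.IH by (auto simp: chain_append)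
next
  case (cancel \<delta>)
  then show ?case by (auto simp: ainv_atomic atop_in_paths)
next
  case (indep p f q g r)
  have "(p, f, q \<Zcomp> ctop K g \<Zcomp> r) \<in> atomics K" "(p \<Zcomp> cbot K f \<Zcomp> q, g, r) \<in> atomics K"
     "(p \<Zcomp> ctop K f \<Zcomp> q, g, r) \<in> atomics K" "(p, f, q \<Zcomp> cbot K g \<Zcomp> r) \<in> atomics K"
    using indep
    by (auto intro!: atomicsI path_comp_in_paths
        simp: end_of_path_comp ctop_path cbot_path init_eq[symmetric] term_eq[symmetric])
  then show ?case using abot_in_paths[of "(p, f, q \<Zcomp> cbot K g \<Zcomp> r)"] by auto
qed

definition hty :: "('v,'e) path \<Rightarrow> ('v,'e,'f) atomic list \<Rightarrow> ('v,'e,'f) atomic list \<Rightarrow> bool" where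
  "hty P ds es \<longleftrightarrow> homotopic K (P, ds) (P, es)"

lemma hty_refl: "chain K P ds Q \<Longrightarrow> hty P ds ds"
  unfolding hty_def by (auto intro: homotopic.refl chain_in_two_paths)

lemma hty_sym: "hty P ds es \<Longrightarrow> hty P es ds"
  unfolding hty_def by (rule homotopic.sym)

lemma hty_trans [trans]: "hty P ds es \<Longrightarrow> hty P es fs \<Longrightarrow> hty P ds fs"
  unfolding hty_def by (rule homotopic.trans)

lemma hty_chain: "hty P ds es \<Longrightarrow> chain K P ds Q \<longleftrightarrow> chain K P es Q"
  unfolding hty_def using homotopic_ends chain_unique by (metis fst_conv snd_conv)

lemma hty_append:
  assumes "hty P ds ds'" "hty Q es es'" "chain K P ds Q"
  shows "hty P (ds @ es) (ds' @ es')"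
  using homotopic.comp[of K "(P, ds)" "(P, ds')" "(Q, es)" "(Q, es')"] assms
  by (simp add: hty_def bot_of_chain top_of_def start_of_def path_comp_def)

lemma hty_left: "hty P ds ds' \<Longrightarrow> chain K P (ds @ es) Q \<Longrightarrow> hty P (ds @ es) (ds' @ es)"
  using hty_append hty_refl chain_append by metis

lemma hty_right: "hty Q es es' \<Longrightarrow> chain K P ds Q \<Longrightarrow> hty P (ds @ es) (ds @ es')"
  using hty_append hty_refl by metis

lemma hty_mid:
  assumes "hty Q es es'" "chain K P ds Q" "chain K P (ds @ es @ fs) R"
  shows "hty P (ds @ es @ fs) (ds @ es' @ fs)"
  using assms hty_left hty_right chain_append chain_unique by metis

lemma hty_cancel: "d \<in> atomics K \<Longrightarrow> hty (atop K d) [d, ainv K d] []"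
  unfolding hty_def by (rule homotopic.cancel)

lemma hty_invs: "chain K P ds Q \<Longrightarrow> hty P (ds @ invs ds) []"
proof (induction ds arbitrary: P)
  case Nil
  then show ?case by (auto intro: hty_refl)
next
  case (Cons d ds)
  then have d: "d \<in> atomics K" "P = atop K d" and c: "chain K (abot K d) ds Q" by auto
  have "hty P ([d] @ (ds @ invs ds) @ [ainv K d]) ([d] @ [] @ [ainv K d])"
    by (rule hty_mid[OF Cons.IH[OF c]])
      (use d c in \<open>auto simp: abot_in_paths chain_append ainv_atomic atop_in_paths intro!: exI chain_invs\<close>)
  also have "hty P ([d] @ [] @ [ainv K d]) []" using hty_cancel[of d] d by simp
  finally show ?case by (simp add: invs_Cons)
qed

lemma hty_invs': "chain K P ds Q \<Longrightarrow> hty Q (invs ds @ ds) []"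
  using hty_invs[OF chain_invs] invs_invs by metis

lemma hty_cancel_left:
  assumes "hty P (ds @ es) (ds @ fs)" "chain K P ds Q" "chain K Q es R" "chain K Q fs R"
  shows "hty Q es fs"
proof -
  have a: "chain K Q (invs ds) P" using assms(2) by (rule chain_invs)
  have b: "hty Q (invs ds @ ds @ gs) gs" if "chain K Q gs R" for gs
    using hty_left[OF hty_invs'[OF assms(2)], of gs R] that a assms(2) by (auto simp: chain_append)
  show ?thesis
    using hty_trans[OF hty_sym[OF b[OF assms(3)]] hty_trans[OF hty_right[OF assms(1) a] b[OF assms(4)]]] .
qed

lemma hty_cancel_right:
  assumes "hty P (es @ ds) (fs @ ds)" "chain K P es Q" "chain K P fs Q" "chain K Q ds R"
  shows "hty P es fs"
proof -
  have a: "chain K R (invs ds) Q" using assms(4) by (rule chain_invs)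
  have b: "hty P (gs @ ds @ invs ds) gs" if "chain K P gs Q" for gs
    using hty_right[OF hty_invs[OF assms(4)] that] by simp
  have c: "hty P ((es @ ds) @ invs ds) ((fs @ ds) @ invs ds)"
    using hty_left[OF assms(1), of "invs ds" Q] a assms by (auto simp: chain_append)
  then show ?thesis using b[OF assms(2)] b[OF assms(3)] by (metis append.assoc hty_sym hty_trans)
qed

text \<open>
The hypotheses of an interchange, reduced to the two atomic 2-paths with their original tops.
\<close>

lemma hty_indep:
  assumes "(p, f, q \<Zcomp> ctop K g \<Zcomp> r) \<in> atomics K" "(p \<Zcomp> ctop K f \<Zcomp> q, g, r) \<in> atomics K"
     "q \<in> paths (skel K)" "end_of (skel K) q = start_of (ctop K g)"
  shows "hty (p \<Zcomp> ctop K f \<Zcomp> q \<Zcomp> ctop K g \<Zcomp> r)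
    [(p, f, q \<Zcomp> ctop K g \<Zcomp> r), (p \<Zcomp> cbot K f \<Zcomp> q, g, r)]
    [(p \<Zcomp> ctop K f \<Zcomp> q, g, r), (p, f, q \<Zcomp> cbot K g \<Zcomp> r)]"
  unfolding hty_def using assms by (intro homotopic.indep) (simp_all add: atomicsD)

lemma hclass_eq_iff: "\<Gamma> \<in> two_paths K \<Longrightarrow> hclass K \<Gamma> = hclass K \<Delta> \<longleftrightarrow> homotopic K \<Gamma> \<Delta>"
  unfolding hclass_def by (auto intro: homotopic.intros)

lemma hclass_chain_eq_iff: "chain K P ds Q \<Longrightarrow> hclass K (P, ds) = hclass K (P, es) \<longleftrightarrow> hty P ds es"
  by (simp add: hclass_eq_iff chain_in_two_paths hty_def)

lemma carrier_diagram_group: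
  "carrier (diagram_group K p) = {hclass K (p, ds) |ds. chain K p ds p}"
proof -
  have "\<Gamma> \<in> two_paths K \<and> top_of \<Gamma> = p \<and> bot_of K \<Gamma> = p \<longleftrightarrow> (\<exists>ds. \<Gamma> = (p, ds) \<and> chain K p ds p)" for \<Gamma>
    using bot_of_chain[of p _ p] chain_in_two_paths[of p _ p]
    by (auto simp: top_of_def start_of_def elim!: two_pathE)
  then show ?thesis by (auto simp: diagram_group_def)
qed

lemma one_diagram_group: "\<one>\<^bsub>diagram_group K p\<^esub> = hclass K (p, [])"
  by (simp add: diagram_group_def)

lemma mult_diagram_group:
  assumes "chain K p ds p" "chain K p es p"
  shows "hclass K (p, ds) \<otimes>\<^bsub>diagram_group K p\<^esub> hclass K (p, es) = hclass K (p, ds @ es)"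
proof -
  have "hclass K (\<Gamma> \<Zcomp> \<Delta>) = hclass K (p, ds @ es)"
    if "homotopic K (p, ds) \<Gamma>" "homotopic K (p, es) \<Delta>" for \<Gamma> \<Delta>
  proof -
    have "homotopic K ((p, ds) \<Zcomp> (p, es)) (\<Gamma> \<Zcomp> \<Delta>)"
      using that assms by (intro homotopic.comp) (auto simp: bot_of_chain top_of_def start_of_def)
    then show ?thesis
      using hclass_eq_iff[of "(p, ds @ es)" "\<Gamma> \<Zcomp> \<Delta>"] chain_in_two_paths[of p "ds @ es" p] assms
      by (auto simp: path_comp_def chain_append)
  qed
  moreover have "(p, ds) \<in> hclass K (p, ds)" "(p, es) \<in> hclass K (p, es)"
    using assms by (auto simp: hclass_def intro!: homotopic.refl chain_in_two_paths)
  ultimately show ?thesis by (auto simp: diagram_group_def hclass_def)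
qed

lemma group_diagram_group:
  assumes "p \<in> paths (skel K)"
  shows "group (diagram_group K p)"
proof (rule groupI)
  have id: "chain K p [] p" using assms by simp
  then show "\<one>\<^bsub>diagram_group K p\<^esub> \<in> carrier (diagram_group K p)"
    unfolding carrier_diagram_group one_diagram_group by blast
  fix x y z
  assume x: "x \<in> carrier (diagram_group K p)"
  then obtain ds where ds: "x = hclass K (p, ds)" "chain K p ds p"
    by (auto simp: carrier_diagram_group)
  show "\<one>\<^bsub>diagram_group K p\<^esub> \<otimes>\<^bsub>diagram_group K p\<^esub> x = x"
    using mult_diagram_group[OF id ds(2)] ds by (simp add: one_diagram_group)
  show "\<exists>y\<in>carrier (diagram_group K p). y \<otimes>\<^bsub>diagram_group K p\<^esub> x = \<one>\<^bsub>diagram_group K p\<^esub>"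
  proof (rule bexI[of _ "hclass K (p, invs ds)"])
    show "hclass K (p, invs ds) \<in> carrier (diagram_group K p)"
      using chain_invs[OF ds(2)] by (auto simp: carrier_diagram_group)
    show "hclass K (p, invs ds) \<otimes>\<^bsub>diagram_group K p\<^esub> x = \<one>\<^bsub>diagram_group K p\<^esub>"
      using mult_diagram_group[OF chain_invs[OF ds(2)] ds(2)] hty_invs'[OF ds(2)]
        hclass_chain_eq_iff[of p "invs ds @ ds" p] chain_invs[OF ds(2)] ds
      by (auto simp: one_diagram_group chain_append)
  qed
  assume y: "y \<in> carrier (diagram_group K p)"
  then obtain es where es: "y = hclass K (p, es)" "chain K p es p"
    by (auto simp: carrier_diagram_group)
  show "x \<otimes>\<^bsub>diagram_group K p\<^esub> y \<in> carrier (diagram_group K p)"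
    using ds es mult_diagram_group[OF ds(2) es(2)] chain_appendI[OF ds(2) es(2)]
    unfolding carrier_diagram_group by blast
  assume "z \<in> carrier (diagram_group K p)"
  then obtain fs where fs: "z = hclass K (p, fs)" "chain K p fs p"
    by (auto simp: carrier_diagram_group)
  show "x \<otimes>\<^bsub>diagram_group K p\<^esub> y \<otimes>\<^bsub>diagram_group K p\<^esub> z =
        x \<otimes>\<^bsub>diagram_group K p\<^esub> (y \<otimes>\<^bsub>diagram_group K p\<^esub> z)"
    unfolding ds(1) es(1) fs(1)
    by (simp add: mult_diagram_group[OF chain_appendI[OF ds(2) es(2)] fs(2)]
        mult_diagram_group[OF ds(2) chain_appendI[OF es(2) fs(2)]]
        mult_diagram_group[OF ds(2) es(2)] mult_diagram_group[OF es(2) fs(2)])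
qed

end

section \<open>Group presentations\<close>

lemma gwords_append [simp]: "u @ v \<in> gwords X \<longleftrightarrow> u \<in> gwords X \<and> v \<in> gwords X"
  and gwords_Nil [simp]: "[] \<in> gwords X"
  and gwords_Cons [simp]: "(x, s) # u \<in> gwords X \<longleftrightarrow> x \<in> X \<and> u \<in> gwords X"
  by (auto simp: gwords_def)

lemma winv_simps [simp]:
  "winv [] = []" "winv ((x, s) # u) = winv u @ [(x, \<not> s)]" "winv (u @ v) = winv v @ winv u"
  by (simp_all add: winv_def)

lemma winv_gwords [simp]: "winv u \<in> gwords X \<longleftrightarrow> u \<in> gwords X"
  by (induction u) auto

lemma gen_gwords [simp]: "gen x \<in> gwords X \<longleftrightarrow> x \<in> X"
  by (simp add: gen_def)

lemma wpow_simps [simp]: "wpow u 0 = []" "wpow u (Suc n) = u @ wpow u n"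
  by (simp_all add: wpow_def)

lemma wpow_gwords [simp]: "u \<in> gwords X \<Longrightarrow> wpow u n \<in> gwords X"
  by (induction n) auto

lemma wconj_gwords [simp]: "u \<in> gwords X \<Longrightarrow> v \<in> gwords X \<Longrightarrow> wconj u v \<in> gwords X"
  by (simp add: wconj_def)

lemma word_eq_gwords: "word_eq X R u v \<Longrightarrow> u \<in> gwords X \<and> v \<in> gwords X"
  by (induction rule: word_eq.induct) auto

text \<open>
The rule for cancellation concerns single letters; it extends to words from the inside out.
\<close>

lemma word_eq_winv: "u \<in> gwords X \<Longrightarrow> word_eq X R (u @ winv u) []"
proof (induction u)
  case Nil
  then show ?case by (auto intro: word_eq.refl)
next
  case (Cons a u)
  obtain x s where a: "a = (x, s)" by (cases a)
  have x: "x \<in> X" "u \<in> gwords X" using Cons.prems by (auto simp: a)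
  have "word_eq X R ([(x, s)] @ ((u @ winv u) @ [(x, \<not> s)])) ([(x, s)] @ ([] @ [(x, \<not> s)]))"
    using x Cons.IH by (intro word_eq.app) (auto intro: word_eq.refl)
  also have "word_eq X R ([(x, s)] @ ([] @ [(x, \<not> s)])) []"
    using x by (auto intro: word_eq.inverse)
  finally (word_eq.trans) show ?case by (simp add: a)
qed

lemma winv_winv [simp]: "winv (winv u) = u"
  by (induction u) auto

lemma word_eq_winv': "u \<in> gwords X \<Longrightarrow> word_eq X R (winv u @ u) []"
  using word_eq_winv[of "winv u"] by simp

lemma wclass_eq_iff: "u \<in> gwords X \<Longrightarrow> wclass X R u = wclass X R v \<longleftrightarrow> word_eq X R u v"
  unfolding wclass_def by (auto intro: word_eq.intros)

lemma mult_presented_group: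
  assumes "u \<in> gwords X" "v \<in> gwords X"
  shows "wclass X R u \<otimes>\<^bsub>presented_group X R\<^esub> wclass X R v = wclass X R (u @ v)"
proof -
  have "wclass X R (u' @ v') = wclass X R (u @ v)" if "word_eq X R u u'" "word_eq X R v v'" for u' v'
    using wclass_eq_iff[of "u @ v" X R "u' @ v'"] that assms by (auto intro: word_eq.app)
  then have "wclass X R (u' @ v') = wclass X R (u @ v)" if "u' \<in> wclass X R u" "v' \<in> wclass X R v" for u' v'
    using that by (simp add: wclass_def)
  moreover have "u \<in> wclass X R u" "v \<in> wclass X R v"
    using assms by (auto simp: wclass_def intro: word_eq.refl)
  ultimately have "(\<Union>u'\<in>wclass X R u. \<Union>v'\<in>wclass X R v. wclass X R (u' @ v')) = wclass X R (u @ v)"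
    by blast
  then show ?thesis by (simp add: presented_group_def)
qed

lemma one_presented_group: "\<one>\<^bsub>presented_group X R\<^esub> = wclass X R []"
  and carrier_presented_group: "carrier (presented_group X R) = wclass X R ` gwords X"
  by (simp_all add: presented_group_def)

lemma group_presented_group: "group (presented_group X R)"
proof (rule groupI)
  fix x
  assume "x \<in> carrier (presented_group X R)"
  then obtain u where u: "x = wclass X R u" "u \<in> gwords X" by (auto simp: carrier_presented_group)
  show "\<exists>y\<in>carrier (presented_group X R). y \<otimes>\<^bsub>presented_group X R\<^esub> x = \<one>\<^bsub>presented_group X R\<^esub>"
    using u by (intro bexI[of _ "wclass X R (winv u)"])
      (auto simp: mult_presented_group one_presented_group carrier_presented_group wclass_eq_iff
        intro: word_eq_winv')
qed (auto simp: mult_presented_group one_presented_group carrier_presented_group)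

primrec (in monoid) eval_word :: "('x \<Rightarrow> 'a) \<Rightarrow> 'x gword \<Rightarrow> 'a" where
  "eval_word h [] = \<one>"
| "eval_word h (l # w) = (if snd l then h (fst l) else inv (h (fst l))) \<otimes> eval_word h w"

context group
begin

lemma eval_word_closed [simp]: "h ` X \<subseteq> carrier G \<Longrightarrow> w \<in> gwords X \<Longrightarrow> eval_word h w \<in> carrier G"
  by (induction w) (auto simp: image_subset_iff)

lemma eval_word_append:
  "h ` X \<subseteq> carrier G \<Longrightarrow> u \<in> gwords X \<Longrightarrow> v \<in> gwords X \<Longrightarrow>
    eval_word h (u @ v) = eval_word h u \<otimes> eval_word h v"
proof (induction u)
  case (Cons l u)
  then have "h (fst l) \<in> carrier G" "eval_word h u \<in> carrier G" "eval_word h v \<in> carrier G"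
    by (cases l; auto)+
  then show ?case using Cons by (cases l) (simp add: m_assoc)
qed simp

lemma eval_word_gen [simp]: "h x \<in> carrier G \<Longrightarrow> eval_word h (gen x) = h x"
  by (simp add: gen_def)

lemma eval_word_winv:
  "h ` X \<subseteq> carrier G \<Longrightarrow> u \<in> gwords X \<Longrightarrow> eval_word h (winv u) = inv (eval_word h u)"
proof (induction u)
  case (Cons l u)
  then have "h (fst l) \<in> carrier G" "eval_word h u \<in> carrier G" "fst l \<in> X" "u \<in> gwords X"
    by (cases l; auto)+
  then show ?case using Cons
    by (cases l) (auto simp: eval_word_append[of h X] inv_mult_group)
qed simp

lemma eval_word_wpow:
  "h ` X \<subseteq> carrier G \<Longrightarrow> u \<in> gwords X \<Longrightarrow> eval_word h (wpow u n) = eval_word h u [^] n"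
  using eval_word_closed[of h X u]
  by (induction n) (simp, metis eval_word_append[of h X] nat_pow_Suc2 wpow_gwords wpow_simps(2))

lemma eval_word_wconj:
  "h ` X \<subseteq> carrier G \<Longrightarrow> u \<in> gwords X \<Longrightarrow> v \<in> gwords X \<Longrightarrow>
    eval_word h (wconj u v) = inv (eval_word h v) \<otimes> eval_word h u \<otimes> eval_word h v"
  by (simp add: wconj_def eval_word_append[of h X] eval_word_winv[of h X] m_assoc)

lemma eval_word_word_eq:
  assumes h: "h ` X \<subseteq> carrier G" and R: "\<And>u v. (u, v) \<in> R \<Longrightarrow> eval_word h u = eval_word h v"
  shows "word_eq X R u v \<Longrightarrow> eval_word h u = eval_word h v"
proof (induction rule: word_eq.induct)
  case (app u u' v v')
  then show ?case using word_eq_gwords[of X R] by (simp add: eval_word_append[OF h])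
next
  case (inverse x s)
  then have "h x \<in> carrier G" using h by auto
  then show ?case by (cases s) auto
qed (auto intro: R)

text \<open>
The universal property of a presentation.
\<close>

lemma hom_of_presented_group:
  assumes h: "h ` X \<subseteq> carrier G" and R: "\<And>u v. (u, v) \<in> R \<Longrightarrow> eval_word h u = eval_word h v"
  obtains \<psi> where "\<psi> \<in> hom (presented_group X R) G"
    "\<And>w. w \<in> gwords X \<Longrightarrow> \<psi> (wclass X R w) = eval_word h w"
proof
  let ?\<psi> = "\<lambda>A. eval_word h (SOME w. w \<in> A)"
  show *: "?\<psi> (wclass X R w) = eval_word h w" if "w \<in> gwords X" for w
  proof -
    have "w \<in> wclass X R w" using that by (auto simp: wclass_def intro: word_eq.refl)
    then have "(SOME w'. w' \<in> wclass X R w) \<in> wclass X R w" by (rule someI)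
    then show ?thesis using eval_word_word_eq[OF h R] by (auto simp: wclass_def)
  qed
  show "?\<psi> \<in> hom (presented_group X R) G"
    by (rule homI)
      (auto simp: carrier_presented_group mult_presented_group * eval_word_append[OF h]
        eval_word_closed[OF h])
qed

end

lemma eval_word_presented_group:
  assumes "w \<in> gwords X"
  shows "monoid.eval_word (presented_group X R) (\<lambda>x. wclass X R (gen x)) w = wclass X R w"
proof -
  interpret P: group "presented_group X R" by (rule group_presented_group)
  show ?thesis
    using assms
  proof (induction w)
    case Nil
    then show ?case by (simp add: one_presented_group)
  next
    case (Cons l w)
    obtain x s where l: "l = (x, s)" by (cases l)
    have x: "x \<in> X" "w \<in> gwords X" using Cons.prems l by auto
    have i: "inv\<^bsub>presented_group X R\<^esub> wclass X R (gen x) = wclass X R [(x, False)]"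
      using x by (intro P.inv_equality)
        (auto simp: mult_presented_group one_presented_group carrier_presented_group gen_def
          wclass_eq_iff intro!: word_eq.inverse[of x X R False, simplified])
    have "(if s then wclass X R (gen x) else inv\<^bsub>presented_group X R\<^esub> wclass X R (gen x))
        = wclass X R [(x, s)]"
      using i by (simp add: gen_def)
    then show ?case
      using x Cons.IH mult_presented_group[of "[(x, s)]" X w R] by (cases s) (simp_all add: l)
  qed
qed

context group
begin

text \<open>
How a presentation of a group \<open>G\<close> is recognised: the relations hold in \<open>G\<close>, the
candidates for the generators generate, and a homomorphism back to the presented group undoes
the evaluation on generators.  The last condition replaces any analysis of which words are
trivial in \<open>G\<close>.
\<close>

lemma iso_presented_group:
  assumes h: "h ` X \<subseteq> carrier G"
    and R: "\<And>u v. (u, v) \<in> R \<Longrightarrow> eval_word h u = eval_word h v"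
    and surj: "carrier G \<subseteq> eval_word h ` gwords X"
    and v: "v \<in> hom G (presented_group X R)"
    and vh: "\<And>x. x \<in> X \<Longrightarrow> v (h x) = wclass X R (gen x)"
  shows "G \<cong> presented_group X R"
proof -
  obtain \<psi> where \<psi>: "\<psi> \<in> hom (presented_group X R) G"
    and \<psi>w: "\<And>w. w \<in> gwords X \<Longrightarrow> \<psi> (wclass X R w) = eval_word h w"
    using hom_of_presented_group[OF h R] by metis
  interpret P: group "presented_group X R" by (rule group_presented_group)
  interpret v: group_hom G "presented_group X R" v by unfold_locales (rule v)
  have v_eval: "v (eval_word h w) = wclass X R w" if "w \<in> gwords X" for w
  proof -
    have "v (eval_word h w) = P.eval_word (\<lambda>x. wclass X R (gen x)) w"
      using that
    proof (induction w)
      case (Cons l w)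
      obtain x s where l: "l = (x, s)" by (cases l)
      have "x \<in> X" "w \<in> gwords X" "h x \<in> carrier G" using Cons.prems h l by auto
      then show ?case using Cons.IH eval_word_closed[OF h] by (auto simp: l vh)
    qed simp
    then show ?thesis using eval_word_presented_group[OF that] by simp
  qed
  have "bij_betw \<psi> (carrier (presented_group X R)) (carrier G)"
  proof (rule bij_betw_byWitness[where f' = v])
    show "\<forall>a\<in>carrier (presented_group X R). v (\<psi> a) = a"
      by (auto simp: carrier_presented_group \<psi>w v_eval)
    show "\<forall>a'\<in>carrier G. \<psi> (v a') = a'"
    proof
      fix a assume "a \<in> carrier G"
      then obtain w where "w \<in> gwords X" "a = eval_word h w" using surj by blast
      then show "\<psi> (v a) = a" by (simp add: v_eval \<psi>w)
    qed
    show "\<psi> ` carrier (presented_group X R) \<subseteq> carrier G" using \<psi> by (auto simp: hom_def)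
    show "v ` carrier G \<subseteq> carrier (presented_group X R)" using v by (auto simp: hom_def)
  qed
  then have "\<psi> \<in> iso (presented_group X R) G" using \<psi> by (simp add: iso_def)
  then show ?thesis using P.iso_sym is_isoI by blast
qed

end

section \<open>From infinitely many relations to six\<close>

definition shift_relations :: "(nat gword \<times> nat gword) set" where
  "shift_relations = {(wconj (gen j) (gen i), gen (j + 1)) |i j. i + 1 < j}"

definition six_relations :: "(nat gword \<times> nat gword) set" where
  "six_relations =
     {(wconj (gen 2) (wpow (gen 0) i), wconj (gen 2) (wpow (gen 0) (i - 1) @ gen 1)) |i. i \<in> {2, 3, 4}}
     \<union> {(wconj (gen 2) (wpow (gen 0) j), wconj (gen 2) (wpow (gen 0) (j - 1) @ gen 2)) |j. j \<in> {3, 4, 5}}"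

context group
begin

definition conj_by :: "'a \<Rightarrow> 'a \<Rightarrow> 'a" where
  "conj_by x y = inv y \<otimes> x \<otimes> y"

lemma conj_by_closed [simp]: "x \<in> carrier G \<Longrightarrow> y \<in> carrier G \<Longrightarrow> conj_by x y \<in> carrier G"
  by (simp add: conj_by_def)

lemma conj_by_mult:
  assumes "x \<in> carrier G" "y \<in> carrier G" "z \<in> carrier G"
  shows "conj_by x (y \<otimes> z) = conj_by (conj_by x y) z"
  using assms by (simp add: conj_by_def inv_mult_group m_assoc)

lemma conj_by_conj_by:
  assumes "x \<in> carrier G" "y \<in> carrier G" "z \<in> carrier G"
  shows "conj_by (conj_by x y) z = conj_by (conj_by x z) (conj_by y z)"
proof -
  have "z \<otimes> conj_by y z = y \<otimes> z"
    using assms inv_solve_left[of "conj_by y z" z "y \<otimes> z"] by (simp add: conj_by_def m_assoc)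
  then show ?thesis using assms by (metis conj_by_closed conj_by_mult)
qed

text \<open>
The argument known from R. Thompson's group \<open>F\<close>.  Conjugation by \<open>s 0\<close> moves a relation
\<open>conj_by (s n) (s i) = s (n + 1)\<close> with \<open>i \<ge> 2\<close> to the one with both indices increased, so
only \<open>i = 1\<close> and \<open>i = 2\<close> need attention.  For these, \<open>s n\<close> with large \<open>n\<close> is a conjugate
\<open>conj_by (s (m + 2)) (s m)\<close> with \<open>n = m + 3\<close>, and conjugation by \<open>s i\<close> acts on both parts
by induction.  The induction starts after three consecutive values of \<open>n\<close>, which is why three
relations are needed for each of the two indices.
\<close>

lemma shift_relations_from_six:
  fixes s :: "nat \<Rightarrow> 'a"
  assumes s: "\<And>n. s n \<in> carrier G"
    and zero: "\<And>n. 2 \<le> n \<Longrightarrow> conj_by (s n) (s 0) = s (Suc n)"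
    and one: "\<And>n. n \<in> {3, 4, 5} \<Longrightarrow> conj_by (s n) (s 1) = s (Suc n)"
    and two: "\<And>n. n \<in> {4, 5, 6} \<Longrightarrow> conj_by (s n) (s 2) = s (Suc n)"
    and ij: "Suc i < j"
  shows "conj_by (s j) (s i) = s (Suc j)"
proof -
  have shift: "conj_by (s (n + k)) (s (i + k)) = s (Suc (n + k))"
    if "conj_by (s n) (s i) = s (Suc n)" "2 \<le> i" "2 \<le> n" for i n k
  proof (induction k)
    case 0
    then show ?case using that by simp
  next
    case (Suc k)
    have "s (Suc (Suc (n + k))) = conj_by (conj_by (s (n + k)) (s (i + k))) (s 0)"
      using Suc zero that by simp
    also have "\<dots> = conj_by (s (Suc (n + k))) (s (Suc (i + k)))"
      using conj_by_conj_by[OF s s s] zero that by simp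
    finally show ?case by simp
  qed
  have two_apart: "conj_by (s (m + 2)) (s m) = s (m + 3)" if "2 \<le> m" for m
  proof -
    from le_Suc_ex[OF that] obtain k where "m = 2 + k" by blast
    then have "m + 2 = 4 + k" "m = 2 + k" "m + 3 = Suc (4 + k)" by auto
    moreover have "conj_by (s (4 + k)) (s (2 + k)) = s (Suc (4 + k))" using shift[of 4 2 k] two[of 4] by simp
    ultimately show ?thesis by metis
  qed
  have all: "conj_by (s n) (s c) = s (Suc n)"
    if base: "\<And>n. n \<in> {c + 2, c + 3, c + 4} \<Longrightarrow> conj_by (s n) (s c) = s (Suc n)"
      and c: "c = 1 \<or> c = 2" and n: "c + 2 \<le> n" for c n
    using n
  proof (induction n rule: less_induct)
    case (less n)
    show ?case
    proof (cases "n \<le> c + 4")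
      case True
      with less.prems have "n \<in> {c + 2, c + 3, c + 4}" by auto
      then show ?thesis by (rule base)
    next
      case False
      \<comment> \<open>Write \<open>s n\<close> as \<open>conj_by (s (m + 2)) (s m)\<close>; three base cases ensure \<open>c + 2 \<le> m\<close>.\<close>
      define m where "m = n - 3"
      have m: "n = Suc (m + 2)" "c + 2 \<le> m" "2 \<le> m" using False c by (auto simp: m_def)
      have "conj_by (s n) (s c) = conj_by (conj_by (s (m + 2)) (s m)) (s c)"
        using two_apart[OF m(3)] m(1) by (simp add: numeral_3_eq_3)
      also have "\<dots> = conj_by (conj_by (s (m + 2)) (s c)) (conj_by (s m) (s c))"
        by (rule conj_by_conj_by[OF s s s])
      also have "\<dots> = conj_by (s (Suc m + 2)) (s (Suc m))"
        using less.IH[of "m + 2"] less.IH[of m] m by simp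
      also have "\<dots> = s (Suc n)" using two_apart[of "Suc m"] m by (simp add: numeral_3_eq_3)
      finally show ?thesis .
    qed
  qed
  consider "i = 0" | "i = 1" | "2 \<le> i" by linarith
  then show ?thesis
  proof cases
    case 1
    then show ?thesis using zero ij by simp
  next
    case 2
    have "conj_by (s n) (s 1) = s (Suc n)" if "n \<in> {1 + 2, 1 + 3, 1 + 4}" for n
    proof (rule one)
      show "n \<in> {3, 4, 5}" using that by auto
    qed
    from all[OF this, of j] show ?thesis using ij 2 by simp
  next
    case 3
    have "conj_by (s (j - i + 2)) (s 2) = s (Suc (j - i + 2))"
      by (rule all) (use two ij in auto)
    from shift[OF this, of "i - 2"]
    have "conj_by (s (j - i + 2 + (i - 2))) (s (2 + (i - 2))) = s (Suc (j - i + 2 + (i - 2)))" by simp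
    moreover have "j - i + 2 + (i - 2) = j" "2 + (i - 2) = i" using 3 ij by auto
    ultimately show ?thesis by metis
  qed
qed

text \<open>
In the six relators the generator with index \<open>k + 2\<close> occurs only as this conjugate.
\<close>

lemma conj_by_power:
  assumes s: "\<And>n. s n \<in> carrier G"
    and zero: "\<And>n. 2 \<le> n \<Longrightarrow> conj_by (s n) (s 0) = s (Suc n)"
  shows "conj_by (s 2) (s 0 [^] k) = s (k + 2)"
proof (induction k)
  case 0
  then show ?case using s by (simp add: conj_by_def numeral_2_eq_2)
next
  case (Suc k)
  then show ?case using zero[of "k + 2"] by (simp add: conj_by_mult s)
qed

end

lemma presented_group_shift_iso_six:
  "presented_group UNIV shift_relations \<cong> presented_group {0, 1, 2} six_relations"
proof -
  let ?P = "presented_group UNIV shift_relations"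
  define X where "X = {0, 1, 2 :: nat}"
  have X [simp]: "0 \<in> X" "1 \<in> X" "Suc 0 \<in> X" "2 \<in> X" and XE: "x \<in> X \<Longrightarrow> x = 0 \<or> x = 1 \<or> x = 2" for x
    by (auto simp: X_def)
  let ?Q = "presented_group X six_relations"
  interpret P: group ?P by (rule group_presented_group)
  interpret Q: group ?Q by (rule group_presented_group)
  have U [simp]: "w \<in> gwords UNIV" for w :: "nat gword" by (simp add: gwords_def)

  define s where "s n = wclass UNIV shift_relations (gen n)" for n
  have s [simp]: "s n \<in> carrier ?P" for n by (simp add: s_def carrier_presented_group)
  have ev_s: "P.eval_word s w = wclass UNIV shift_relations w" for w
    using eval_word_presented_group[of w UNIV shift_relations] by (simp add: s_def[abs_def])
  have s_rel: "P.conj_by (s j) (s i) = s (Suc j)" if "Suc i < j" for i j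
  proof -
    have "word_eq UNIV shift_relations (wconj (gen j) (gen i)) (gen (Suc j))"
      using that by (intro word_eq.rel) (auto simp: shift_relations_def)
    then have "P.eval_word s (wconj (gen j) (gen i)) = P.eval_word s (gen (Suc j))"
      by (simp add: ev_s wclass_eq_iff)
    then show ?thesis
      by (simp add: P.eval_word_wconj[of s UNIV] image_subset_iff P.conj_by_def)
  qed
  have s_pow: "P.conj_by (s 2) (s 0 [^]\<^bsub>?P\<^esub> k) = s (k + 2)" for k
    by (rule P.conj_by_power) (auto simp: s_rel)
  have sX: "s ` X \<subseteq> carrier ?P" using s by blast

  define t where "t n = wclass X six_relations (gen n)" for n
  have t_X [simp]: "t 0 \<in> carrier ?Q" "t 1 \<in> carrier ?Q" "t 2 \<in> carrier ?Q"
    by (simp_all add: t_def carrier_presented_group)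
  have tX: "t ` X \<subseteq> carrier ?Q" using t_X XE by blast
  have ev_t: "Q.eval_word t w = wclass X six_relations w" if "w \<in> gwords X" for w
    using eval_word_presented_group[OF that, of six_relations] by (simp add: t_def[abs_def])
  define t' where "t' n = (if n < 2 then t n else Q.conj_by (t 2) (t 0 [^]\<^bsub>?Q\<^esub> (n - 2)))" for n
  have t'_t: "t' 0 = t 0" "t' 1 = t 1" "t' 2 = t 2"
    by (simp_all add: t'_def Q.conj_by_def)
  have t' [simp]: "t' n \<in> carrier ?Q" for n
    using t_X by (cases "n < 2") (auto simp: t'_def less_2_cases_iff)
  \<comment> \<open>The missing generators \<open>x\<^sub>3, x\<^sub>4, \<dots>\<close> are defined as conjugates of \<open>x\<^sub>2\<close>, so the relations
    with \<open>x\<^sub>0\<close> hold by construction and the six relators are what is needed for the others.\<close>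
  have t'_zero: "Q.conj_by (t' n) (t' 0) = t' (Suc n)" if "2 \<le> n" for n
  proof -
    have "Suc n - 2 = Suc (n - 2)" using that by simp
    then show ?thesis using that by (simp add: t'_t(1)) (simp add: t'_def Q.conj_by_mult del: diff_Suc_Suc diff_Suc_numeral)
  qed
  have t'_six: "Q.conj_by (t' (Suc i)) (t c) = t' (Suc (Suc i))"
    if "(wconj (gen 2) (wpow (gen 0) i), wconj (gen 2) (wpow (gen 0) (i - 1) @ gen c)) \<in> six_relations"
      "c \<in> X" "1 \<le> i" for i c
  proof -
    have c: "t c \<in> carrier ?Q" using that t_X XE[of c] by auto
    let ?l = "wconj (gen 2) (wpow (gen 0) i)" and ?r = "wconj (gen 2) (wpow (gen 0) (i - 1) @ gen c)"
    have w: "?l \<in> gwords X" "?r \<in> gwords X" using that by auto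
    then have "word_eq X six_relations ?l ?r" using that by (intro word_eq.rel) auto
    then have "Q.eval_word t ?l = Q.eval_word t ?r" using w by (simp add: ev_t wclass_eq_iff)
    then have "Q.conj_by (t 2) (t 0 [^]\<^bsub>?Q\<^esub> i) = Q.conj_by (t 2) (t 0 [^]\<^bsub>?Q\<^esub> (i - 1) \<otimes>\<^bsub>?Q\<^esub> t c)"
      using that c
      by (simp add: Q.eval_word_wconj[OF tX] Q.eval_word_append[OF tX] Q.eval_word_wpow[OF tX] Q.conj_by_def)
    then show ?thesis using that c by (simp add: Q.conj_by_mult) (simp add: t'_def)
  qed
  have t'_one: "Q.conj_by (t' n) (t' 1) = t' (Suc n)" if "n \<in> {3, 4, 5}" for n
  proof -
    have "(wconj (gen 2) (wpow (gen 0) (n - 1)), wconj (gen 2) (wpow (gen 0) (n - 1 - 1) @ gen 1)) \<in> six_relations"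
      unfolding six_relations_def using that by fastforce
    from t'_six[OF this] show ?thesis using that by (auto simp: t'_t(2)[simplified])
  qed
  have t'_two: "Q.conj_by (t' n) (t' 2) = t' (Suc n)" if "n \<in> {4, 5, 6}" for n
  proof -
    have "(wconj (gen 2) (wpow (gen 0) (n - 1)), wconj (gen 2) (wpow (gen 0) (n - 1 - 1) @ gen 2)) \<in> six_relations"
      unfolding six_relations_def using that by fastforce
    from t'_six[OF this] show ?thesis using that by (auto simp: t'_t(3))
  qed
  have t'_rel: "Q.conj_by (t' j) (t' i) = t' (Suc j)" if "Suc i < j" for i j
    by (rule Q.shift_relations_from_six[OF _ t'_zero t'_one t'_two that]) auto
  have t'_eval: "Q.eval_word t' u = Q.eval_word t' v" if "(u, v) \<in> shift_relations" for u v
    using that t'_rel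
    by (auto simp: shift_relations_def Q.eval_word_wconj[of t' UNIV] image_subset_iff
        Q.conj_by_def[symmetric])
  have "t' ` UNIV \<subseteq> carrier ?Q" by auto
  then obtain v where v: "v \<in> hom ?P ?Q"
    and vw: "\<And>w. v (wclass UNIV shift_relations w) = Q.eval_word t' w"
    using Q.hom_of_presented_group[OF _ t'_eval] U by metis

  have "?P \<cong> ?Q"
  proof (rule P.iso_presented_group[OF sX _ _ v])
    fix u v assume "(u, v) \<in> six_relations"
    then obtain k c where k: "u = wconj (gen 2) (wpow (gen 0) k)"
      "v = wconj (gen 2) (wpow (gen 0) (k - 1) @ gen c)" "c = 1 \<or> c = 2" "c < k"
      unfolding six_relations_def by fastforce
    \<comment> \<open>The exponents \<open>k\<close> are positive; the shift by one absorbs the subtraction in the relators.\<close>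
    define i where "i = k - 1"
    have i: "u = wconj (gen 2) (wpow (gen 0) (Suc i))"
      "v = wconj (gen 2) (wpow (gen 0) i @ gen c)" "c \<in> X" "c < Suc i"
      using k by (auto simp: i_def)
    have "P.conj_by (s 2) (s 0 [^]\<^bsub>?P\<^esub> Suc i) = P.conj_by (P.conj_by (s 2) (s 0 [^]\<^bsub>?P\<^esub> i)) (s c)"
      unfolding s_pow using i s_rel[of c "i + 2"] by simp
    also have "\<dots> = P.conj_by (s 2) (s 0 [^]\<^bsub>?P\<^esub> i \<otimes>\<^bsub>?P\<^esub> s c)"
      by (simp add: P.conj_by_mult)
    finally show "P.eval_word s u = P.eval_word s v"
      using i by (simp add: P.eval_word_wconj[OF sX] P.eval_word_append[OF sX]
          P.eval_word_wpow[OF sX] P.conj_by_def del: wpow_simps P.nat_pow_Suc)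
  next
    have letter: "\<exists>u\<in>gwords X. P.eval_word s u = wclass UNIV shift_relations [(n, e)]" for n e
    proof -
      have "\<exists>u\<in>gwords X. P.eval_word s u = s n"
      proof (cases "n < 2")
        case True
        then show ?thesis by (intro bexI[of _ "gen n"]) (auto simp: less_2_cases_iff)
      next
        case False
        then have "n - 2 + 2 = n" by simp
        then show ?thesis
          using s_pow[of "n - 2"]
          by (intro bexI[of _ "wconj (gen 2) (wpow (gen 0) (n - 2))"])
            (simp_all add: P.eval_word_wconj[OF sX] P.eval_word_wpow[OF sX] P.conj_by_def del: add_2_eq_Suc')
      qed
      then obtain u where u: "u \<in> gwords X" "P.eval_word s u = s n" by blast
      have "P.eval_word s (winv u) = wclass UNIV shift_relations [(n, False)]"
        using u P.eval_word_winv[OF sX u(1)] ev_s[of "[(n, False)]"] by simp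
      moreover have "P.eval_word s u = wclass UNIV shift_relations [(n, True)]"
        using u by (simp add: s_def gen_def)
      ultimately show ?thesis using u by (cases e) (auto intro: bexI[of _ u] bexI[of _ "winv u"])
    qed
    have "\<exists>u\<in>gwords X. P.eval_word s u = wclass UNIV shift_relations w" for w
    proof (induction w)
      case Nil
      then show ?case by (intro bexI[of _ "[]"]) (simp_all add: one_presented_group)
    next
      case (Cons l w)
      then obtain u where u: "u \<in> gwords X" "P.eval_word s u = wclass UNIV shift_relations w" by blast
      obtain u' where u': "u' \<in> gwords X" "P.eval_word s u' = wclass UNIV shift_relations [l]"
        using letter[of "fst l" "snd l"] by auto
      show ?case
        using u u' mult_presented_group[of "[l]" UNIV w shift_relations]
        by (intro bexI[of _ "u' @ u"]) (simp_all add: P.eval_word_append[OF sX])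
    qed
    then show "carrier ?P \<subseteq> P.eval_word s ` gwords X"
      by (force simp: carrier_presented_group)
  next
    fix x assume "x \<in> X"
    then show "v (s x) = wclass X six_relations (gen x)"
      using t'_t XE[of x] by (auto simp: s_def vw Q.eval_word_gen) (simp_all add: t_def)
  qed
  then show ?thesis by (simp add: X_def)
qed

section \<open>The presentation of the diagram group at a\<close>

abbreviation a_cell :: "bool \<Rightarrow> (edge list \<times> edge list) \<times> bool" where
  "a_cell b \<equiv> (([Edge_a, Edge_y], [Edge_a]), b)"

abbreviation y_cell :: "bool \<Rightarrow> (edge list \<times> edge list) \<times> bool" where
  "y_cell b \<equiv> (([Edge_y, Edge_y, Edge_y], [Edge_y, Edge_y]), b)"

abbreviation Y :: "nat \<Rightarrow> edge list" where
  "Y n \<equiv> replicate n Edge_y"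

lemma paths_K_ay [simp]: "p \<in> paths (skel K_ay)"
proof -
  have "pre_digraph.cas (skel K_ay) u es ()" for u es
    by (induction es arbitrary: u) (auto simp: pre_digraph.cas.simps)
  moreover have "set es \<subseteq> {Edge_a, Edge_y}" for es :: "edge list"
    using edge.exhaust by auto
  ultimately show ?thesis
    by (cases p) (auto simp: paths_def pre_digraph.awalk_def K_ay_def rel_complex_def)
qed

lemma cells_K_ay: "cells K_ay = {a_cell True, a_cell False, y_cell True, y_cell False}"
  by (auto simp: K_ay_def rel_complex_def)

lemma ctop_K_ay [simp]: "ctop K_ay ((u, v), b) = ((), if b then u else v)"
  and cbot_K_ay [simp]: "cbot K_ay ((u, v), b) = ((), if b then v else u)"
  and cinv_K_ay [simp]: "cinv K_ay (r, b) = (r, \<not> b)"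
  by (simp_all add: K_ay_def rel_complex_def)

interpretation K_ay: directed_2complex K_ay
proof
  show "tail (skel K_ay) e \<in> verts (skel K_ay)" "head (skel K_ay) e \<in> verts (skel K_ay)" for e
    by (simp_all add: K_ay_def rel_complex_def)
qed (auto simp: cells_K_ay nonempty_def)

lemma atomics_K_ay [simp]: "(p, f, q) \<in> atomics K_ay \<longleftrightarrow> f \<in> cells K_ay"
  by (auto dest: K_ay.atomicsD intro!: K_ay.atomicsI)

lemma path_comp_unit [simp]: "((), u) \<Zcomp> ((), v) = ((), u @ v)"
  by (simp add: path_comp_def)

text \<open>
A cell of the relation \<open>ay = a\<close> contributes nothing, and a cell of \<open>y\<^sup>3 = y\<^sup>2\<close> contributes the
generator whose index is the number of letters \<open>y\<close> to the right of the cell, inverted if the cell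
shortens the path.  A cell that is separated from the right end by a letter \<open>a\<close> is sent to 1;
with this convention the value is invariant under homotopy for 2-paths between arbitrary paths,
not only between paths of the form \<open>a y\<^sup>n\<close>.
\<close>

definition letter :: "(unit, edge, (edge list \<times> edge list) \<times> bool) atomic \<Rightarrow> nat gword" where
  "letter = (\<lambda>(p, f, q). if f \<in> range y_cell \<and> Edge_a \<notin> set (snd q)
     then [(length (snd q), \<not> snd f)] else [])"

definition word_value :: "(unit, edge, (edge list \<times> edge list) \<times> bool) atomic list \<Rightarrow> nat gword" where
  "word_value ds = concat (map letter ds)"

lemma letter_simps [simp]:
  "letter (p, a_cell b, q) = []"
  "letter (p, y_cell b, q) = (if Edge_a \<in> set (snd q) then [] else [(length (snd q), \<not> b)])"
  by (auto simp: letter_def)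

lemma word_value_simps [simp]:
  "word_value [] = []" "word_value (d # ds) = letter d @ word_value ds"
  "word_value (ds @ es) = word_value ds @ word_value es"
  by (simp_all add: word_value_def)

lemma word_eq_shift_iff:
  "word_eq UNIV shift_relations u v \<longleftrightarrow>
    monoid.eval_word (presented_group UNIV shift_relations) (\<lambda>x. wclass UNIV shift_relations (gen x)) u =
    monoid.eval_word (presented_group UNIV shift_relations) (\<lambda>x. wclass UNIV shift_relations (gen x)) v"
  by (simp add: eval_word_presented_group gwords_def wclass_eq_iff)

lemma (in group) shift_commute:
  assumes "a \<in> carrier G" "b \<in> carrier G" "c \<in> carrier G" and eq: "inv b \<otimes> a \<otimes> b = c"
  shows "a \<otimes> b = b \<otimes> c" "inv a \<otimes> b = b \<otimes> inv c"
    "c \<otimes> inv b = inv b \<otimes> a" "inv c \<otimes> inv b = inv b \<otimes> inv a"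
proof -
  show 1: "a \<otimes> b = b \<otimes> c" using assms(1-3) by (simp add: eq[symmetric] m_assoc[symmetric])
  show 2: "c \<otimes> inv b = inv b \<otimes> a" using assms(1-3) by (simp add: eq[symmetric] m_assoc)
  show "inv a \<otimes> b = b \<otimes> inv c"
    using 2 assms by (metis inv_closed inv_inv inv_mult_group)
  show "inv c \<otimes> inv b = inv b \<otimes> inv a"
    using 1 assms by (metis inv_mult_group)
qed

lemma shift_word_eq:
  assumes "j + 2 \<le> n"
  shows "word_eq UNIV shift_relations [(n, s), (j, True)] [(j, True), (Suc n, s)]"
    "word_eq UNIV shift_relations [(Suc n, s), (j, False)] [(j, False), (n, s)]"
proof -
  let ?P = "presented_group UNIV shift_relations"
  let ?g = "\<lambda>n :: nat. wclass UNIV shift_relations (gen n)"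
  interpret P: group ?P by (rule group_presented_group)
  have g: "?g n \<in> carrier ?P" for n by (simp add: carrier_presented_group)
  have "(wconj (gen n) (gen j), gen (Suc n)) \<in> shift_relations"
    unfolding shift_relations_def mem_Collect_eq
    by (rule exI[of _ j], rule exI[of _ n]) (use assms in simp)
  then have "word_eq UNIV shift_relations (wconj (gen n) (gen j)) (gen (Suc n))"
    by (intro word_eq.rel) auto
  then have "inv\<^bsub>?P\<^esub> ?g j \<otimes>\<^bsub>?P\<^esub> ?g n \<otimes>\<^bsub>?P\<^esub> ?g j = ?g (Suc n)"
    by (simp add: word_eq_shift_iff P.eval_word_wconj[of _ UNIV] image_subset_iff g)
  note * = P.shift_commute[OF g g g this]
  show "word_eq UNIV shift_relations [(n, s), (j, True)] [(j, True), (Suc n, s)]"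
    unfolding word_eq_shift_iff by (cases s) (simp_all add: g *(1,2))
  show "word_eq UNIV shift_relations [(Suc n, s), (j, False)] [(j, False), (n, s)]"
    unfolding word_eq_shift_iff by (cases s) (simp_all add: g *(3,4))
qed

lemma word_eq_UNIV_refl: "word_eq UNIV R w w"
  by (auto simp: gwords_def intro: word_eq.refl)

text \<open>
The only interchange with an effect is that of two \<open>y\<close>-cells: the right one changes the number of
letters to the right of the left one by one, which is the relation \<open>x\<^sub>n\<^sup>x\<^sup>j = x\<^sub>n\<^sub>+\<^sub>1\<close>.
\<close>

lemma word_value_homotopic:
  "homotopic K_ay \<Gamma> \<Delta> \<Longrightarrow>
    word_eq UNIV shift_relations (word_value (snd \<Gamma>)) (word_value (snd \<Delta>))"
proof (induction rule: homotopic.induct)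
  case (cancel \<delta>)
  obtain p f b q where d: "\<delta> = (p, (f, b), q)" by (cases \<delta>) auto
  then have "(f, b) \<in> cells K_ay" using cancel by (simp only: atomics_K_ay)
  moreover have "word_eq UNIV shift_relations [(x, True), (x, False)] []"
    "word_eq UNIV shift_relations [(x, False), (x, True)] []" for x
    using word_eq.inverse[of x UNIV _ True] word_eq.inverse[of x UNIV _ False] by simp_all
  ultimately show ?case unfolding d
    by (cases b) (auto simp: cells_K_ay word_eq_UNIV_refl)
next
  case (indep p f q g r)
  have "f \<in> range a_cell \<or> f \<in> range y_cell" "g \<in> range a_cell \<or> g \<in> range y_cell"
    using indep by (auto simp: cells_K_ay)
  then show ?case
    using shift_word_eq[of "length (snd r)" "length (snd q) + length (snd r) + 2"]
    by (auto simp: word_eq_UNIV_refl algebra_simps)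
qed (auto intro: word_eq.intros simp: gwords_def)


abbreviation aY :: "nat \<Rightarrow> (unit, edge) path" where
  "aY n \<equiv> ((), Edge_a # Y n)"

abbreviation a_step :: "bool \<Rightarrow> nat \<Rightarrow> (unit, edge, (edge list \<times> edge list) \<times> bool) atomic" where
  "a_step b n \<equiv> (((), []), a_cell b, ((), Y n))"

abbreviation y_step :: "nat \<Rightarrow> bool \<Rightarrow> nat \<Rightarrow> (unit, edge, (edge list \<times> edge list) \<times> bool) atomic" where
  "y_step i b j \<equiv> (((), Edge_a # Y i), y_cell b, ((), Y j))"

text \<open>
The 2-path from \<open>a\<close> to \<open>a y\<^sup>n\<close> through \<open>a y\<close>, \<open>a y\<^sup>2\<close>, \<open>\<dots>\<close>.  These 2-paths serve as a
maximal tree: they turn every 2-path from \<open>a y\<^sup>m\<close> to \<open>a y\<^sup>n\<close> into a loop at \<open>a\<close>.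
\<close>

definition grow :: "nat \<Rightarrow> (unit, edge, (edge list \<times> edge list) \<times> bool) atomic list" where
  "grow n = map (a_step False) [0..<n]"

lemma chain_grow: "chain K_ay (aY 0) (grow n) (aY n)"
  by (induction n)
    (auto simp: grow_def K_ay.chain_append cells_K_ay replicate_append_same simp flip: replicate_Suc)

definition loop where
  "loop m ds n = hclass K_ay (aY 0, grow m @ ds @ K_ay.invs (grow n))"

lemma H_ay_eq: "H_ay = diagram_group K_ay (aY 0)"
  by (simp add: H_ay_def)

interpretation H: group H_ay
  unfolding H_ay_eq by (rule K_ay.group_diagram_group) simp

lemma chain_loop: "chain K_ay (aY m) ds (aY n) \<Longrightarrow>
    chain K_ay (aY 0) (grow m @ ds @ K_ay.invs (grow n)) (aY 0)"
  by (rule K_ay.chain_appendI[OF chain_grow K_ay.chain_appendI[OF _ K_ay.chain_invs[OF chain_grow]]])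

lemma loop_closed [simp]: "chain K_ay (aY m) ds (aY n) \<Longrightarrow> loop m ds n \<in> carrier H_ay"
  unfolding H_ay_eq K_ay.carrier_diagram_group loop_def using chain_loop by blast

lemma loop_cong:
  assumes "K_ay.hty (aY m) ds es" "chain K_ay (aY m) ds (aY n)"
  shows "loop m ds n = loop m es n"
  unfolding loop_def K_ay.hclass_chain_eq_iff[OF chain_loop[OF assms(2)]]
  by (rule K_ay.hty_mid[OF assms(1) chain_grow chain_loop[OF assms(2)]])

lemma loop_append:
  assumes "chain K_ay (aY m) ds (aY n)" "chain K_ay (aY n) es (aY k)"
  shows "loop m (ds @ es) k = loop m ds n \<otimes>\<^bsub>H_ay\<^esub> loop n es k"
proof -
  have "K_ay.hty (aY n) (K_ay.invs (grow n) @ grow n) []"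
    by (rule K_ay.hty_invs'[OF chain_grow])
  from K_ay.hty_mid[OF this, of "aY 0" "grow m @ ds" "es @ K_ay.invs (grow k)" "aY 0"]
  have "K_ay.hty (aY 0) ((grow m @ ds @ K_ay.invs (grow n)) @ (grow n @ es @ K_ay.invs (grow k)))
      (grow m @ (ds @ es) @ K_ay.invs (grow k))"
    using K_ay.chain_appendI[OF chain_loop[OF assms(1)] chain_loop[OF assms(2)]]
      K_ay.chain_appendI[OF chain_grow assms(1)] by simp
  then show ?thesis
    unfolding loop_def H_ay_eq
      K_ay.mult_diagram_group[OF chain_loop[OF assms(1)] chain_loop[OF assms(2)]]
      K_ay.hclass_chain_eq_iff[OF K_ay.chain_appendI[OF chain_loop[OF assms(1)] chain_loop[OF assms(2)]]]
    using K_ay.hclass_chain_eq_iff[OF K_ay.chain_appendI[OF chain_loop[OF assms(1)] chain_loop[OF assms(2)]]]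
    by metis
qed

lemma loop_Nil: "loop n [] n = \<one>\<^bsub>H_ay\<^esub>"
  using K_ay.hty_invs[OF chain_grow[of n]] K_ay.hclass_chain_eq_iff[OF chain_loop[of n "[]" n]]
  by (simp add: loop_def H_ay_eq K_ay.one_diagram_group)

lemma loop_zero: "chain K_ay (aY 0) ds (aY 0) \<Longrightarrow> loop 0 ds 0 = hclass K_ay (aY 0, ds)"
  by (simp add: loop_def grow_def)

lemma loop_invs:
  assumes "chain K_ay (aY m) ds (aY n)"
  shows "loop n (K_ay.invs ds) m = inv\<^bsub>H_ay\<^esub> loop m ds n"
proof -
  have c: "chain K_ay (aY n) (K_ay.invs ds) (aY m)" by (rule K_ay.chain_invs[OF assms])
  have "loop n (K_ay.invs ds) m \<otimes>\<^bsub>H_ay\<^esub> loop m ds n = \<one>\<^bsub>H_ay\<^esub>"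
    using loop_append[OF c assms] loop_cong[OF K_ay.hty_invs'[OF assms] K_ay.chain_appendI[OF c assms]]
    by (simp add: loop_Nil)
  then show ?thesis using assms c by (simp add: H.inv_equality)
qed

lemma chain_steps [simp]:
  "chain K_ay (aY n) [a_step False n] (aY (Suc n))"
  "chain K_ay (aY (Suc n)) [a_step True n] (aY n)"
  "chain K_ay (aY (i + 3 + j)) [y_step i True j] (aY (i + 2 + j))"
  "chain K_ay (aY (i + 2 + j)) [y_step i False j] (aY (i + 3 + j))"
  by (auto simp: cells_K_ay replicate_add numeral_eq_Suc replicate_app_Cons_same)

lemma loop_a_step: "loop n [a_step False n] (Suc n) = \<one>\<^bsub>H_ay\<^esub>" "loop (Suc n) [a_step True n] n = \<one>\<^bsub>H_ay\<^esub>"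
proof -
  have "grow (Suc n) = grow n @ [a_step False n]" by (simp add: grow_def)
  then have "loop n [a_step False n] (Suc n) = loop (Suc n) [] (Suc n)" by (simp add: loop_def)
  then show 1: "loop n [a_step False n] (Suc n) = \<one>\<^bsub>H_ay\<^esub>" by (simp add: loop_Nil)
  show "loop (Suc n) [a_step True n] n = \<one>\<^bsub>H_ay\<^esub>"
    using loop_invs[OF chain_steps(1)[of n]] 1 by (simp add: K_ay.invs_def)
qed

lemma chain_y_step:
  "m = i + 2 + j \<Longrightarrow> n = i + 3 + j \<Longrightarrow> chain K_ay (aY m) [y_step i False j] (aY n)"
  "m = i + 2 + j \<Longrightarrow> n = i + 3 + j \<Longrightarrow> chain K_ay (aY n) [y_step i True j] (aY m)"
  by (simp_all only: chain_steps)

text \<open>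
A cell \<open>ay = a\<close> at the left end commutes with every \<open>y\<close>-cell and moves it by one letter, so
the loop of a \<open>y\<close>-cell does not depend on the number of letters to its left.
\<close>

lemma loop_y_step_shift:
  "loop (Suc i + 3 + j) [y_step (Suc i) True j] (Suc i + 2 + j) = loop (i + 3 + j) [y_step i True j] (i + 2 + j)"
proof -
  define l m n where "l = Suc i + 3 + j" and "m = i + 3 + j" and "n = i + 2 + j"
  have lm: "l = Suc m" "m = Suc n" "Suc i + 2 + j = m" by (simp_all add: l_def m_def n_def)
  have h: "K_ay.hty (aY l) [a_step True m, y_step i True j] [y_step (Suc i) True j, a_step True n]"
    using K_ay.hty_indep[of "((), [])" "a_cell True" "((), Y i)" "y_cell True" "((), Y j)"]
    by (simp add: cells_K_ay l_def m_def n_def replicate_add numeral_eq_Suc replicate_app_Cons_same)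
  have c: "chain K_ay (aY l) [a_step True m] (aY m)" "chain K_ay (aY m) [y_step i True j] (aY n)"
     "chain K_ay (aY l) [y_step (Suc i) True j] (aY m)" "chain K_ay (aY m) [a_step True n] (aY n)"
  proof -
    show "chain K_ay (aY l) [a_step True m] (aY m)" unfolding lm(1) by (rule chain_steps(2))
    show "chain K_ay (aY m) [a_step True n] (aY n)" unfolding lm(2) by (rule chain_steps(2))
    show "chain K_ay (aY m) [y_step i True j] (aY n)" "chain K_ay (aY l) [y_step (Suc i) True j] (aY m)"
      by (rule chain_y_step(2); simp add: l_def m_def n_def)+
  qed
  have "loop l ([a_step True m] @ [y_step i True j]) n = loop l ([y_step (Suc i) True j] @ [a_step True n]) n"
    using loop_cong[OF h, of n] K_ay.chain_appendI[OF c(1,2)] by (simp del: chain.simps)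
  moreover have "loop l [a_step True m] m = \<one>\<^bsub>H_ay\<^esub>" "loop m [a_step True n] n = \<one>\<^bsub>H_ay\<^esub>"
    unfolding lm(1,2) by (rule loop_a_step)+
  ultimately have "loop l [y_step (Suc i) True j] m = loop m [y_step i True j] n"
    unfolding loop_append[OF c(1,2)] loop_append[OF c(3,4)] using c(2,3)[THEN loop_closed] by simp
  then show ?thesis unfolding l_def[symmetric] m_def[symmetric] n_def[symmetric] lm(3) .
qed

text \<open>
The lengthening orientation agrees with the sign in \<^const>\<open>letter\<close>.
\<close>

definition y_loop :: "nat \<Rightarrow> _" where
  "y_loop j = loop (2 + j) [y_step 0 False j] (3 + j)"

lemma y_loop_closed [simp]: "y_loop j \<in> carrier H_ay"
  using chain_steps(4)[of 0 j] by (simp add: y_loop_def)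

lemma loop_y_step:
  "loop (i + 2 + j) [y_step i False j] (i + 3 + j) = y_loop j"
  "loop (i + 3 + j) [y_step i True j] (i + 2 + j) = inv\<^bsub>H_ay\<^esub> y_loop j"
proof -
  have 1: "loop (k + 2 + j) [y_step k False j] (k + 3 + j) = inv\<^bsub>H_ay\<^esub> loop (k + 3 + j) [y_step k True j] (k + 2 + j)" for k
    using loop_invs[OF chain_steps(3)[of k j]] by (simp add: K_ay.invs_def)
  have "loop (i + 3 + j) [y_step i True j] (i + 2 + j) = loop (0 + 3 + j) [y_step 0 True j] (0 + 2 + j)"
  proof (induction i)
    case (Suc i)
    then show ?case using loop_y_step_shift[of i j] by simp
  qed simp
  moreover have "y_loop j = inv\<^bsub>H_ay\<^esub> loop (0 + 3 + j) [y_step 0 True j] (0 + 2 + j)"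
    using 1[of 0] by (simp add: y_loop_def)
  ultimately show "loop (i + 2 + j) [y_step i False j] (i + 3 + j) = y_loop j"
    "loop (i + 3 + j) [y_step i True j] (i + 2 + j) = inv\<^bsub>H_ay\<^esub> y_loop j"
    using 1[of i] chain_steps(3)[of 0 j] by simp_all
qed

lemma loop_y_step_at:
  "m = i + 2 + j \<Longrightarrow> n = i + 3 + j \<Longrightarrow> loop m [y_step i False j] n = y_loop j"
  "m = i + 2 + j \<Longrightarrow> n = i + 3 + j \<Longrightarrow> loop n [y_step i True j] m = inv\<^bsub>H_ay\<^esub> y_loop j"
  by (simp_all only: loop_y_step)

text \<open>
The interchange of two \<open>y\<close>-cells separated by \<open>k\<close> letters, with \<open>i\<close> letters to the right of
the second one, gives the relation for \<open>j = k + i + 2\<close>.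
\<close>

lemma y_loop_relation:
  assumes "Suc i < j"
  shows "inv\<^bsub>H_ay\<^esub> y_loop i \<otimes>\<^bsub>H_ay\<^esub> y_loop j \<otimes>\<^bsub>H_ay\<^esub> y_loop i = y_loop (Suc j)"
proof -
  from le_Suc_ex[of "i + 2" j] assms obtain k where "j = i + 2 + k" by auto
  then have j: "j = k + i + 2" by simp
  define m n l where "m = k + i + 4" and "n = k + i + 5" and "l = k + i + 6"
  have "K_ay.hty (aY m) [y_step 0 False j, y_step (k + 3) False i]
     [y_step (k + 2) False i, y_step 0 False (Suc j)]"
    using K_ay.hty_indep[of "((), [Edge_a])" "y_cell False" "((), Y k)" "y_cell False" "((), Y i)"]
    by (simp add: cells_K_ay m_def j replicate_add numeral_eq_Suc replicate_app_Cons_same)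
  moreover have c: "chain K_ay (aY m) [y_step 0 False j] (aY n)" "chain K_ay (aY n) [y_step (k + 3) False i] (aY l)"
     "chain K_ay (aY m) [y_step (k + 2) False i] (aY n)" "chain K_ay (aY n) [y_step 0 False (Suc j)] (aY l)"
    by (rule chain_y_step; simp add: j m_def n_def l_def)+
  ultimately have "loop m ([y_step 0 False j] @ [y_step (k + 3) False i]) l
      = loop m ([y_step (k + 2) False i] @ [y_step 0 False (Suc j)]) l"
    using loop_cong K_ay.chain_appendI[OF c(1,2)] by simp
  moreover have "loop m [y_step 0 False j] n = y_loop j" "loop n [y_step (k + 3) False i] l = y_loop i"
    "loop m [y_step (k + 2) False i] n = y_loop i" "loop n [y_step 0 False (Suc j)] l = y_loop (Suc j)"
    by (rule loop_y_step_at; simp add: j m_def n_def l_def)+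
  ultimately have "y_loop j \<otimes>\<^bsub>H_ay\<^esub> y_loop i = y_loop i \<otimes>\<^bsub>H_ay\<^esub> y_loop (Suc j)"
    unfolding loop_append[OF c(1,2)] loop_append[OF c(3,4)] by simp
  then show ?thesis by (simp add: H.m_assoc H.inv_solve_left')
qed

lemma append_eq_replicate:
  "us @ vs = replicate n x \<longleftrightarrow>
    us = replicate (length us) x \<and> vs = replicate (length vs) x \<and> n = length us + length vs"
proof (induction us arbitrary: n)
  case Nil
  show ?case by (auto simp: list_eq_iff_nth_eq)
next
  case (Cons u us)
  then show ?case by (cases n) auto
qed

text \<open>
Paths of the form \<open>a y\<^sup>m\<close> have no inner letter \<open>a\<close>; therefore the cells of \<open>ay = a\<close> apply only
at the left end and all the others inside the \<open>y\<close>-part.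
\<close>

lemma atomic_from_aY:
  assumes "d \<in> atomics K_ay" "atop K_ay d = aY m"
  obtains k where "d = a_step False k" "m = k"
  | k where "d = a_step True k" "m = Suc k"
  | i j where "d = y_step i True j" "m = i + 3 + j"
  | i j where "d = y_step i False j" "m = i + 2 + j"
proof -
  obtain p f q where d: "d = (((), p), f, ((), q))" by (cases d) auto
  consider (a) b where "f = a_cell b" | (y) b where "f = y_cell b"
    using assms(1) by (auto simp: d cells_K_ay)
  then show thesis
  proof cases
    case a
    obtain r where r: "p @ Edge_a # r = Edge_a # Y m"
      using assms(2) by (cases b) (auto simp: d a)
    have "p = []"
    proof (cases p)
      case (Cons e p')
      then have "p' @ Edge_a # r = Y m" using r by simp
      then have "Edge_a \<in> set (Y m)" by (metis in_set_conv_decomp)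
      then show ?thesis by simp
    qed simp
    then show thesis
      using assms(2) that(1)[of m] that(2)[of "m - 1"] by (cases b; cases m) (auto simp: d a)
  next
    case y
    obtain p' where p: "p = Edge_a # p'" using assms(2) by (cases p; cases b) (auto simp: d y)
    then have "p' @ (Y (if b then 3 else 2) @ q) = Y m"
      using assms(2) by (auto simp: d y numeral_eq_Suc split: if_splits)
    then have "p' = Y (length p')" "q = Y (length q)" "m = length p' + (if b then 3 else 2) + length q"
      unfolding append_eq_replicate by auto
    then show thesis
      using that(3)[of "length p'" "length q"] that(4)[of "length p'" "length q"]
      by (cases b) (auto simp: d p y)
  qed
qed

text \<open>
This is surjectivity: every 2-path at \<open>a\<close> is homotopic to a product of the chosen loops, spelled
by its value.
\<close>

lemma loop_eq_eval_word:
  "chain K_ay (aY m) ds (aY n) \<Longrightarrow> loop m ds n = H.eval_word y_loop (word_value ds)"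
proof (induction ds arbitrary: m)
  case Nil
  then show ?case using loop_Nil by (auto dest: arg_cong[where f = length])
next
  case (Cons d ds)
  then have d: "d \<in> atomics K_ay" "atop K_ay d = aY m" and c: "chain K_ay (abot K_ay d) ds (aY n)" by auto
  have step: ?case if "chain K_ay (aY m) [d] (aY m')" "loop m [d] m' = H.eval_word y_loop (letter d)" for m'
  proof -
    have c': "chain K_ay (aY m') ds (aY n)" using that c by auto
    have "loop m ([d] @ ds) n = loop m [d] m' \<otimes>\<^bsub>H_ay\<^esub> loop m' ds n"
      by (rule loop_append[OF that(1) c'])
    then show ?thesis
      using that(2) Cons.IH[OF c'] H.eval_word_append[of y_loop UNIV "letter d" "word_value ds"]
      by (simp add: image_subset_iff gwords_def)
  qed
  show ?case
    using d
  proof (cases rule: atomic_from_aY)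
    case (1 k)
    show ?thesis
    proof (rule step)
      show "chain K_ay (aY m) [d] (aY (Suc k))" unfolding 1 by (rule chain_steps)
      show "loop m [d] (Suc k) = H.eval_word y_loop (letter d)" unfolding 1 loop_a_step by simp
    qed
  next
    case (2 k)
    show ?thesis
    proof (rule step)
      show "chain K_ay (aY m) [d] (aY (k))" unfolding 2 by (rule chain_steps)
      show "loop m [d] (k) = H.eval_word y_loop (letter d)" unfolding 2 loop_a_step by simp
    qed
  next
    case (3 i j)
    show ?thesis
    proof (rule step)
      show "chain K_ay (aY m) [d] (aY (i + 2 + j))" unfolding 3 by (rule chain_steps)
      show "loop m [d] (i + 2 + j) = H.eval_word y_loop (letter d)" unfolding 3 loop_y_step by simp
    qed
  next
    case (4 i j)
    show ?thesis
    proof (rule step)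
      show "chain K_ay (aY m) [d] (aY (i + 3 + j))" unfolding 4 by (rule chain_steps)
      show "loop m [d] (i + 3 + j) = H.eval_word y_loop (letter d)" unfolding 4 loop_y_step by simp
    qed
  qed
qed

theorem H_ay_iso_shift: "H_ay \<cong> presented_group UNIV shift_relations"
proof -
  let ?P = "presented_group UNIV shift_relations"
  let ?V = "\<lambda>A. \<Union>\<Gamma>\<in>A. wclass UNIV shift_relations (word_value (snd \<Gamma>))"
  have U: "w \<in> gwords UNIV" for w :: "nat gword" by (simp add: gwords_def)
  have V: "?V (hclass K_ay (aY 0, ds)) = wclass UNIV shift_relations (word_value ds)"
    if "chain K_ay (aY 0) ds (aY 0)" for ds
  proof -
    have "wclass UNIV shift_relations (word_value (snd \<Gamma>)) = wclass UNIV shift_relations (word_value ds)"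
      if "\<Gamma> \<in> hclass K_ay (aY 0, ds)" for \<Gamma>
      using word_value_homotopic[of "(aY 0, ds)" \<Gamma>] that
      by (auto simp: hclass_def wclass_eq_iff U intro: word_eq.sym)
    moreover have "(aY 0, ds) \<in> hclass K_ay (aY 0, ds)"
      using that by (auto simp: hclass_def intro!: homotopic.refl K_ay.chain_in_two_paths)
    ultimately show ?thesis by fast
  qed
  have grow: "word_value (grow n) = []" "word_value (K_ay.invs (grow n)) = []" for n
    by (auto simp: word_value_def grow_def K_ay.invs_def)
  show ?thesis
  proof (rule H.iso_presented_group[where h = y_loop])
    show "y_loop ` UNIV \<subseteq> carrier H_ay" by auto
    show "H.eval_word y_loop u = H.eval_word y_loop v" if "(u, v) \<in> shift_relations" for u v
      using that y_loop_relation
      by (auto simp: shift_relations_def H.eval_word_wconj[of y_loop UNIV] image_subset_iff)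
    show "carrier H_ay \<subseteq> H.eval_word y_loop ` gwords UNIV"
    proof
      fix A assume "A \<in> carrier H_ay"
      then obtain ds where "A = hclass K_ay (aY 0, ds)" "chain K_ay (aY 0) ds (aY 0)"
        unfolding H_ay_eq K_ay.carrier_diagram_group by blast
      then show "A \<in> H.eval_word y_loop ` gwords UNIV"
        using loop_eq_eval_word[of 0 ds 0] loop_zero[of ds] U by (metis imageI)
    qed
    show "?V \<in> hom H_ay ?P"
    proof (rule homI)
      fix A assume "A \<in> carrier H_ay"
      then obtain ds where ds: "A = hclass K_ay (aY 0, ds)" "chain K_ay (aY 0) ds (aY 0)"
        unfolding H_ay_eq K_ay.carrier_diagram_group by blast
      show "?V A \<in> carrier ?P" unfolding ds(1) V[OF ds(2)] by (simp add: carrier_presented_group U)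
      fix B assume "B \<in> carrier H_ay"
      then obtain es where es: "B = hclass K_ay (aY 0, es)" "chain K_ay (aY 0) es (aY 0)"
        unfolding H_ay_eq K_ay.carrier_diagram_group by blast
      show "?V (A \<otimes>\<^bsub>H_ay\<^esub> B) = ?V A \<otimes>\<^bsub>?P\<^esub> ?V B"
        unfolding H_ay_eq ds(1) es(1) K_ay.mult_diagram_group[OF ds(2) es(2)]
          V[OF ds(2)] V[OF es(2)] V[OF K_ay.chain_appendI[OF ds(2) es(2)]]
        by (simp add: mult_presented_group U)
    qed
    show "?V (y_loop j) = wclass UNIV shift_relations (gen j)" for j
    proof -
      have c: "chain K_ay (aY (2 + j)) [y_step 0 False j] (aY (3 + j))"
        by (rule chain_y_step) simp_all
      show ?thesis unfolding y_loop_def loop_def V[OF chain_loop[OF c]] by (simp add: grow gen_def)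
    qed
  qed
qed

section \<open>Reduced 2-paths and the term algebra of a complex\<close>

context directed_2complex
begin

lemma path_split:
  assumes "(u, es @ fs) \<in> paths (skel K)"
  shows "(u, es) \<in> paths (skel K)" "(end_of (skel K) (u, es), fs) \<in> paths (skel K)"
  using assms wf_digraph.awalk_append_iff[OF wf_skel] unfolding paths_def end_of_def
  by auto

text \<open>
If two factorisations of one path have disjoint middle parts, the path that lies between the
middle parts appears as a factor of both.  This is the situation in which an interchange applies.
\<close>

lemma path_split_between:
  assumes p: "p \<in> paths (skel K)" and x: "x \<in> paths (skel K)"
    and p': "p' \<in> paths (skel K)" and y: "y \<in> paths (skel K)"
    and "end_of (skel K) p = start_of x" "end_of (skel K) x = start_of q" "end_of (skel K) p' = start_of y"
    and eq: "p \<Zcomp> x \<Zcomp> q = p' \<Zcomp> y \<Zcomp> q'" and len: "length (snd p) + length (snd x) \<le> length (snd p')"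
  obtains r where "r \<in> paths (skel K)" "end_of (skel K) x = start_of r" "end_of (skel K) r = start_of y"
    "p' = p \<Zcomp> x \<Zcomp> r" "q = r \<Zcomp> y \<Zcomp> q'"
proof -
  define r where "r = (end_of (skel K) x, drop (length (snd p) + length (snd x)) (snd p'))"
  have eqs: "fst p = fst p'" "snd p @ snd x @ snd q = snd p' @ snd y @ snd q'"
    using eq by (auto simp: path_comp_def)
  have "take (length (snd p) + length (snd x)) (snd p') = take (length (snd p) + length (snd x)) (snd p @ snd x @ snd q)"
    unfolding eqs(2) using len by simp
  then have t: "take (length (snd p) + length (snd x)) (snd p') = snd p @ snd x" by simp
  then have snd_p': "snd p' = snd p @ snd x @ snd r"
    by (metis append.assoc append_take_drop_id r_def snd_conv)
  have start_r: "start_of r = end_of (skel K) x" by (simp add: r_def start_of_def)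
  have p'_eq: "p' = p \<Zcomp> x \<Zcomp> r" using eqs(1) snd_p' by (simp add: path_comp_def prod_eq_iff)
  have px: "end_of (skel K) (p \<Zcomp> x) = end_of (skel K) x" using assms by (simp add: end_of_path_comp)
  have "(fst p, (snd p @ snd x) @ snd r) \<in> paths (skel K)"
    using p' p'_eq by (simp add: path_comp_def)
  from path_split(2)[OF this] have r: "r \<in> paths (skel K)"
    using px by (simp add: path_comp_def r_def)
  have "end_of (skel K) r = start_of y"
    using assms start_r p'_eq end_of_path_comp[of "p \<Zcomp> x" r] px by simp
  moreover have "q = r \<Zcomp> y \<Zcomp> q'"
    using eqs(2) snd_p' start_r assms by (simp add: path_comp_def prod_eq_iff start_of_def)
  ultimately show thesis using that[of r] r start_r p'_eq by simp
qed

end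

text \<open>
Imagine a 2-path as a circuit: the edges of its top are the inputs, and each cell takes the
values on the edges of its top and produces a value for each edge of its bottom.  In the term
algebra these values are free: the \<open>i\<close>-th output of a cell is the formal term made of the label
of the cell, of \<open>i\<close> and of the tuple of inputs.
\<close>

datatype wire = Gen nat | Op nat nat "wire list"

definition gens :: "nat \<Rightarrow> wire list" where
  "gens n = map Gen [0..<n]"

definition outs :: "nat \<Rightarrow> nat \<Rightarrow> wire list \<Rightarrow> wire list" where
  "outs l n ts = map (\<lambda>i. Op l i ts) [0..<n]"

lemma length_gens [simp]: "length (gens n) = n"
  and length_outs [simp]: "length (outs l n ts) = n"
  by (simp_all add: gens_def outs_def)

lemma nth_outs: "i < n \<Longrightarrow> outs l n ts ! i = Op l i ts"
  by (simp add: outs_def)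

text \<open>
Labels have to distinguish only the cells in \<open>C\<close>.  For a countable complex \<open>C\<close> is the set of
all cells; for a countable diagram group over an arbitrary complex \<open>C\<close> contains the cells of
representatives of the group elements.
\<close>

locale labelled_2complex = directed_2complex K for K :: "('v, 'e, 'f) d2complex" +
  fixes C :: "'f set" and lab :: "'f \<Rightarrow> nat"
  assumes C_cells: "C \<subseteq> cells K"
    and C_cinv: "f \<in> C \<Longrightarrow> cinv K f \<in> C"
    and inj_lab: "inj_on lab C"
begin

abbreviation "tlen f \<equiv> length (snd (ctop K f))"
abbreviation "blen f \<equiv> length (snd (cbot K f))"

text \<open>
The inputs of \<open>f\<close> are all the outputs of one application of the inverse cell.
\<close>

definition reducible :: "'f \<Rightarrow> wire list \<Rightarrow> bool" where
  "reducible f ts \<longleftrightarrow> (\<exists>zs. length zs = blen f \<and> ts = outs (lab (cinv K f)) (tlen f) zs)"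

text \<open>
No cell is applied to the outputs of its own inverse.  The last argument is the tuple of values
on the bottom of the 2-path.
\<close>

inductive reduced :: "('v, 'e) path \<Rightarrow> ('v, 'e, 'f) atomic list \<Rightarrow> wire list \<Rightarrow> bool" for P where
  Nil: "P \<in> paths (skel K) \<Longrightarrow> reduced P [] (gens (length (snd P)))"
| snoc: "reduced P ds (us @ ts @ vs) \<Longrightarrow> chain K P ds (p \<Zcomp> ctop K f \<Zcomp> q) \<Longrightarrow>
    (p, f, q) \<in> atomics K \<Longrightarrow> f \<in> C \<Longrightarrow> length us = length (snd p) \<Longrightarrow> length ts = tlen f \<Longrightarrow>
    \<not> reducible f ts \<Longrightarrow>
    reduced P (ds @ [(p, f, q)]) (us @ outs (lab f) (blen f) ts @ vs)"

lemma cell_lengths: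
  assumes "f \<in> C"
  shows "0 < tlen f" "0 < blen f" "tlen (cinv K f) = blen f" "blen (cinv K f) = tlen f"
  using assms C_cells ctop_nonempty cbot_nonempty ctop_cinv cbot_cinv
  by (auto simp: nonempty_def subset_iff)

lemma reduced_chain:
  "reduced P ds xs \<Longrightarrow> \<exists>Q. chain K P ds Q \<and> length xs = length (snd Q)"
proof (induction rule: reduced.induct)
  case Nil
  then show ?case by auto
next
  case (snoc ds us ts vs p f q)
  then obtain Q where "chain K P ds Q" "length (us @ ts @ vs) = length (snd Q)" by blast
  then have "length vs = length (snd q)" using snoc.hyps chain_unique by fastforce
  then show ?case
    using snoc.hyps abot_in_paths[OF snoc.hyps(3)]
    by (intro exI[of _ "p \<Zcomp> cbot K f \<Zcomp> q"]) (auto intro!: chain_appendI)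
qed

lemma reduced_chain_length: "reduced P ds xs \<Longrightarrow> chain K P ds Q \<Longrightarrow> length xs = length (snd Q)"
  using reduced_chain chain_unique by blast

text \<open>
Outputs record their cell, their position and their inputs.  Hence two blocks of outputs in one
tuple that overlap are equal and in the same place.
\<close>

lemma outs_position:
  assumes eq: "us @ outs l n ts @ vs = us' @ outs l' n' ts' @ vs'"
    and nonempty: "0 < n" "0 < n'"
  obtains (left) ws where "us' = us @ outs l n ts @ ws" "vs = ws @ outs l' n' ts' @ vs'"
  | (right) ws where "us = us' @ outs l' n' ts' @ ws" "vs' = ws @ outs l n ts @ vs"
  | (same) "l = l'" "ts = ts'" "length us = length us'"
proof -
  consider "length us + n \<le> length us'" | "length us' + n' \<le> length us"
    | "length us' < length us + n" "length us < length us' + n'"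
    by linarith
  then show thesis
  proof cases
    case 1
    have "take (length us + n) (us @ outs l n ts @ vs) = take (length us + n) (us' @ outs l' n' ts' @ vs')"
      using eq by simp
    then have "us @ outs l n ts = take (length us + n) us'" using 1 by simp
    then obtain ws where ws: "us' = us @ outs l n ts @ ws" by (metis append.assoc append_take_drop_id)
    with eq have "vs = ws @ outs l' n' ts' @ vs'" by simp
    with ws show ?thesis by (rule left)
  next
    case 2
    have "take (length us' + n') (us @ outs l n ts @ vs) = take (length us' + n') (us' @ outs l' n' ts' @ vs')"
      using eq by simp
    then have "us' @ outs l' n' ts' = take (length us' + n') us" using 2 by simp
    then obtain ws where ws: "us = us' @ outs l' n' ts' @ ws" by (metis append.assoc append_take_drop_id)
    with eq have "vs' = ws @ outs l n ts @ vs" by simp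
    with ws show ?thesis by (rule right)
  next
    case overlap: 3
    define i where "i = max (length us) (length us')"
    have 3: "length us \<le> i" "i < length us + n" "length us' \<le> i" "i < length us' + n'"
      using overlap nonempty by (auto simp: i_def)
    have "(us @ outs l n ts @ vs) ! i = Op l (i - length us) ts"
      using 3 by (simp add: nth_append nth_outs less_diff_conv2)
    moreover have "(us' @ outs l' n' ts' @ vs') ! i = Op l' (i - length us') ts'"
      using 3 by (simp add: nth_append nth_outs less_diff_conv2)
    ultimately have "l = l'" "ts = ts'" "i - length us = i - length us'" using eq by auto
    then show ?thesis using 3 same by (metis le_add_diff_inverse2 add_left_cancel)
  qed
qed

text \<open>
If the values on some consecutive edges are the outputs of one application of a cell, that
application can be made the last one.  It is either the last one already, or the last cell of the
2-path produces a disjoint block, in which case the two can be interchanged.  The freeness of the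
outputs enters here: terms alone identify the application that produced them.
\<close>

lemma undo_last_cell:
  assumes "reduced P ds xs" "xs = us @ outs (lab (cinv K f)) (tlen f) zs @ vs" "length zs = blen f"
    and "(p, f, q) \<in> atomics K" "f \<in> C" "chain K P ds (p \<Zcomp> ctop K f \<Zcomp> q)" "length us = length (snd p)"
  shows "\<exists>es. reduced P es (us @ zs @ vs) \<and> hty P ds (es @ [(p, cinv K f, q)])"
  using assms
proof (induction arbitrary: us vs p q rule: reduced.induct)
  case Nil
  have "Op (lab (cinv K f)) 0 zs \<in> set (gens (length (snd P)))"
    unfolding Nil.prems(1) using cell_lengths(1)[OF Nil.prems(4)] by (auto simp: outs_def)
  then show ?case by (auto simp: gens_def)
next
  case (snoc ds us' ts' vs' p' h q')
  let ?f = "cinv K f"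
  have f: "f \<in> cells K" "?f \<in> cells K" "ctop K ?f = cbot K f" "cbot K ?f = ctop K f"
    using snoc.prems C_cells by (auto simp: cinv_cell ctop_cinv cbot_cinv)
  have h: "h \<in> cells K" using snoc.hyps C_cells by auto
  note d = atomicsD[OF \<open>(p, f, q) \<in> atomics K\<close>] and d' = atomicsD[OF \<open>(p', h, q') \<in> atomics K\<close>]
  have lens: "0 < tlen f" "0 < blen h" using cell_lengths snoc.prems snoc.hyps by auto
  have paths: "ctop K f \<in> paths (skel K)" "cbot K f \<in> paths (skel K)"
    "ctop K h \<in> paths (skel K)" "cbot K h \<in> paths (skel K)"
    using f h by (auto simp: ctop_path cbot_path)
  have peq: "p \<Zcomp> ctop K f \<Zcomp> q = p' \<Zcomp> cbot K h \<Zcomp> q'"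
    using chain_unique[OF snoc.prems(5), of "p' \<Zcomp> cbot K h \<Zcomp> q'"] snoc.hyps
    by (auto simp: chain_append dest: abot_in_paths)
  have xeq: "us @ outs (lab ?f) (tlen f) zs @ vs = us' @ outs (lab h) (blen h) ts' @ vs'"
    using snoc.prems(1) by simp
  \<comment> \<open>Compare the block of \<open>f\<close> with the block produced by the last cell \<open>h\<close>.\<close>
  from this lens show ?case
  proof (cases rule: outs_position)
    case same
    then have hf: "h = ?f" using inj_lab snoc.hyps(4) C_cinv[OF snoc.prems(4)] by (auto dest: inj_onD)
    have len: "length us = length us'" by (rule same)
    have "length (outs (lab ?f) (tlen f) zs) = length (outs (lab h) (blen h) ts')"
      using f by (simp add: hf)
    with xeq len have us: "us' = us" "vs' = vs" by simp_all
    have "snd p @ snd (ctop K f) @ snd q = snd p' @ snd (cbot K h) @ snd q'"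
      using arg_cong[OF peq, of snd] by simp
    moreover have "length (snd p) = length (snd p')" using snoc.prems(6) snoc.hyps(5) us by simp
    ultimately have "snd p = snd p'" by simp
    then have "p' = p" "q' = q"
      using peq d d' hf f by (auto simp: path_comp_def prod_eq_iff start_of_def)
    moreover have "hty P (ds @ [(p', h, q')]) (ds @ [(p', h, q')])"
      using snoc.prems(5) by (rule hty_refl)
    ultimately show ?thesis using snoc.hyps(1) us hf same by (intro exI[of _ ds]) auto
  next
    case (left ws)
    have "length (snd p) + length (snd (ctop K f)) \<le> length (snd p')"
      using left snoc.prems(6) snoc.hyps(5) by simp
    then obtain r where r: "r \<in> paths (skel K)" "end_of (skel K) (ctop K f) = start_of r"
      "end_of (skel K) r = start_of (cbot K h)" "p' = p \<Zcomp> ctop K f \<Zcomp> r" "q = r \<Zcomp> cbot K h \<Zcomp> q'"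
      by (rule path_split_between[OF d(1) paths(1) d'(1) paths(4) d(4,5) d'(6) peq])
    let ?q = "r \<Zcomp> ctop K h \<Zcomp> q'"
    have r3: "end_of (skel K) r = start_of (ctop K h)" using r h init_eq by simp
    have at: "(p, f, ?q) \<in> atomics K" "(p, ?f, ?q) \<in> atomics K" "(p \<Zcomp> cbot K f \<Zcomp> r, h, q') \<in> atomics K"
      using d d' r r3 f h paths
      by (auto intro!: atomicsI path_comp_in_paths simp: end_of_path_comp)
    have "\<exists>es. reduced P es (us @ zs @ (ws @ ts' @ vs')) \<and> hty P ds (es @ [(p, ?f, ?q)])"
      by (rule snoc.IH[OF _ snoc.prems(2) at(1) snoc.prems(4) _ snoc.prems(6)])
        (use left snoc.hyps(2) r in auto)
    then obtain es where es: "reduced P es (us @ zs @ ws @ ts' @ vs')" "hty P ds (es @ [(p, ?f, ?q)])" by auto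
    have c0: "chain K P (es @ [(p, ?f, ?q)]) (p' \<Zcomp> ctop K h \<Zcomp> q')"
      using hty_chain[OF es(2)] snoc.hyps(2) by simp
    then have c1: "chain K P es (p \<Zcomp> cbot K f \<Zcomp> ?q)"
      using f by (auto simp: chain_append)
    show ?thesis
    proof (intro exI conjI)
      have "reduced P (es @ [(p \<Zcomp> cbot K f \<Zcomp> r, h, q')]) ((us @ zs @ ws) @ outs (lab h) (blen h) ts' @ vs')"
        by (rule reduced.snoc[OF _ _ at(3)])
          (use es snoc.hyps snoc.prems left c1 r in \<open>auto\<close>)
      then show "reduced P (es @ [(p \<Zcomp> cbot K f \<Zcomp> r, h, q')]) (us @ zs @ vs)" using left by simp
      have "hty P (ds @ [(p', h, q')]) (es @ [(p, ?f, ?q), (p', h, q')])"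
        using hty_left[OF es(2) snoc.prems(5)] by simp
      also have "hty P (es @ [(p, ?f, ?q), (p', h, q')]) (es @ [(p \<Zcomp> cbot K f \<Zcomp> r, h, q'), (p, ?f, q)])"
        using hty_right[OF hty_indep[of p ?f r h q'] c1[unfolded f(3)[symmetric]]] at r r3 f by simp
      finally show "hty P (ds @ [(p', h, q')]) ((es @ [(p \<Zcomp> cbot K f \<Zcomp> r, h, q')]) @ [(p, ?f, q)])"
        by simp
    qed
  next
    case (right ws)
    have "length (snd p') + length (snd (cbot K h)) \<le> length (snd p)"
      using right snoc.prems(6) snoc.hyps(5) by simp
    then obtain r where r: "r \<in> paths (skel K)" "end_of (skel K) (cbot K h) = start_of r"
      "end_of (skel K) r = start_of (ctop K f)" "p = p' \<Zcomp> cbot K h \<Zcomp> r" "q' = r \<Zcomp> ctop K f \<Zcomp> q"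
      by (rule path_split_between[OF d'(1) paths(4) d(1) paths(1) d'(6,7) d(4) peq[symmetric]])
    let ?p = "p' \<Zcomp> ctop K h \<Zcomp> r" and ?q = "r \<Zcomp> cbot K f \<Zcomp> q"
    have r2: "end_of (skel K) (ctop K h) = start_of r" "end_of (skel K) r = start_of (cbot K f)"
      using r h f term_eq init_eq by simp_all
    have at: "(?p, f, q) \<in> atomics K" "(?p, ?f, q) \<in> atomics K" "(p', h, ?q) \<in> atomics K"
      using d d' r r2 f h paths
      by (auto intro!: atomicsI path_comp_in_paths simp: end_of_path_comp)
    have "\<exists>es. reduced P es ((us' @ ts' @ ws) @ zs @ vs) \<and> hty P ds (es @ [(?p, ?f, q)])"
      by (rule snoc.IH[OF _ snoc.prems(2) at(1) snoc.prems(4)])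
        (use right snoc.hyps snoc.prems r in auto)
    then obtain es where es: "reduced P es (us' @ ts' @ ws @ zs @ vs)" "hty P ds (es @ [(?p, ?f, q)])" by auto
    have c0: "chain K P (es @ [(?p, ?f, q)]) (p' \<Zcomp> ctop K h \<Zcomp> q')"
      using hty_chain[OF es(2)] snoc.hyps(2) by simp
    then have c1: "chain K P es (?p \<Zcomp> cbot K f \<Zcomp> q)"
      using f by (auto simp: chain_append)
    show ?thesis
    proof (intro exI conjI)
      have "reduced P (es @ [(p', h, ?q)]) (us' @ outs (lab h) (blen h) ts' @ (ws @ zs @ vs))"
        by (rule reduced.snoc[OF _ _ at(3)])
          (use es snoc.hyps snoc.prems right c1 r in \<open>auto\<close>)
      then show "reduced P (es @ [(p', h, ?q)]) (us @ zs @ vs)" using right by simp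
      have "hty P (ds @ [(p', h, q')]) (es @ [(?p, ?f, q), (p', h, q')])"
        using hty_left[OF es(2) snoc.prems(5)] by simp
      also have "hty P (es @ [(?p, ?f, q), (p', h, q')]) (es @ [(p', h, ?q), (p, ?f, q)])"
        using hty_right[OF hty_sym[OF hty_indep[of p' h r ?f q]] _, of P es] c1 at r r2 f by simp
      finally show "hty P (ds @ [(p', h, q')]) ((es @ [(p', h, ?q)]) @ [(p, ?f, q)])"
        by simp
    qed
  qed
qed

text \<open>
Append the cells one by one; a cell that would violate reducedness cancels against the
application of its inverse, which can be moved to the end.
\<close>

lemma reduced_exists:
  assumes "chain K P ds Q" "\<forall>(p, f, q) \<in> set ds. f \<in> C"
  shows "\<exists>es xs. reduced P es xs \<and> hty P ds es"
  using assms
proof (induction ds arbitrary: Q rule: rev_induct)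
  case Nil
  then have "reduced P [] (gens (length (snd P)))" "hty P [] []"
    using reduced.Nil hty_refl[of P "[]" P] by auto
  then show ?case by blast
next
  case (snoc d ds)
  obtain p f q where d: "d = (p, f, q)" by (cases d) auto
  have at: "(p, f, q) \<in> atomics K" "f \<in> C" and c: "chain K P ds (p \<Zcomp> ctop K f \<Zcomp> q)"
    using snoc.prems by (auto simp: d chain_append)
  obtain es xs where es: "reduced P es xs" "hty P ds es" using snoc.IH[OF c] snoc.prems by auto
  have c': "chain K P es (p \<Zcomp> ctop K f \<Zcomp> q)" using hty_chain[OF es(2)] c by simp
  have len: "length xs = length (snd p) + tlen f + length (snd q)"
    using reduced_chain_length[OF es(1) c'] by simp
  define us ts vs where "us = take (length (snd p)) xs"
    and "ts = take (tlen f) (drop (length (snd p)) xs)" and "vs = drop (tlen f) (drop (length (snd p)) xs)"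
  have xs: "xs = us @ ts @ vs" "length us = length (snd p)" "length ts = tlen f"
    unfolding us_def ts_def vs_def append_take_drop_id using len by simp_all
  have h: "hty P (ds @ [d]) (es @ [d])" using hty_left[OF es(2)] snoc.prems(1) by simp
  show ?case
  proof (cases "reducible f ts")
    case False
    then have "reduced P (es @ [d]) (us @ outs (lab f) (blen f) ts @ vs)"
      unfolding d using es(1) at c' xs by (intro reduced.snoc) auto
    then show ?thesis using h by blast
  next
    case True
    then obtain zs where zs: "length zs = blen f" "ts = outs (lab (cinv K f)) (tlen f) zs"
      unfolding reducible_def by blast
    obtain es' where es': "reduced P es' (us @ zs @ vs)" "hty P es (es' @ [(p, cinv K f, q)])"
      using undo_last_cell[OF es(1) _ zs(1) at c' xs(2)] xs(1) zs(2) by blast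
    let ?d = "(p, cinv K f, q)"
    have a: "?d \<in> atomics K" "ainv K ?d = d" "atop K ?d = abot K d"
      using ainv_atomic[OF at(1)] ainv_ainv[OF at(1)] atop_ainv[OF at(1)] by (auto simp: d)
    have "hty P (es @ [d]) (es' @ [?d, ainv K ?d])"
      using hty_left[OF es'(2), of "[d]"] c' at a(2) by (auto simp: chain_append d abot_in_paths[OF at(1), simplified])
    moreover have "chain K P es' (atop K ?d)"
      using hty_chain[OF es'(2)] c' by (auto simp: chain_append)
    then have "hty P (es' @ [?d, ainv K ?d]) es'"
      using hty_right[OF hty_cancel[OF a(1)]] by fastforce
    ultimately show ?thesis using h es'(1) hty_trans by blast
  qed
qed

text \<open>
A cell has a nonempty bottom, so any cell leaves a compound term behind.  This detects nontrivial
elements: a reduced 2-path that returns its inputs is empty.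
\<close>

lemma reduced_gens: "reduced P ds xs \<Longrightarrow> xs = gens n \<Longrightarrow> ds = []"
proof (induction rule: reduced.induct)
  case (snoc ds us ts vs p f q)
  have "Op (lab f) 0 ts \<in> set (gens n)"
    unfolding snoc.prems[symmetric] using cell_lengths(2)[OF snoc.hyps(4)] by (auto simp: outs_def)
  then show ?case by (auto simp: gens_def)
qed simp

end

section \<open>Whiskering and functoriality\<close>

definition whiskers ::
    "('v, 'e) path \<Rightarrow> ('v, 'e, 'f) atomic list \<Rightarrow> ('v, 'e) path \<Rightarrow> ('v, 'e, 'f) atomic list" where
  "whiskers A ds B = map (\<lambda>(p, f, q). (A \<Zcomp> p, f, q \<Zcomp> B)) ds"

lemma whiskers_simps [simp]:
  "whiskers A [] B = []"
  "whiskers A ((p, f, q) # ds) B = (A \<Zcomp> p, f, q \<Zcomp> B) # whiskers A ds B"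
  "whiskers A (ds @ es) B = whiskers A ds B @ whiskers A es B"
  by (simp_all add: whiskers_def)

lemma snd_whisker [simp]: "snd (whisker A \<Gamma> B) = whiskers A (snd \<Gamma>) B"
  by (simp add: whisker_def whiskers_def)

context directed_2complex
begin

lemma atomic_ends:
  assumes "d \<in> atomics K"
  shows "start_of (abot K d) = start_of (atop K d)" "end_of (skel K) (abot K d) = end_of (skel K) (atop K d)"
proof -
  obtain p f q where d: "d = (p, f, q)" by (cases d)
  note a = atomicsD[OF assms[unfolded d]]
  show "start_of (abot K d) = start_of (atop K d)" "end_of (skel K) (abot K d) = end_of (skel K) (atop K d)"
    using a end_of_path_comp[of "ctop K f" q] end_of_path_comp[of "cbot K f" q]
    by (simp_all add: d end_of_path_comp)
qed

lemma chain_ends: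
  "chain K P ds Q \<Longrightarrow> start_of Q = start_of P \<and> end_of (skel K) Q = end_of (skel K) P"
proof (induction ds arbitrary: P)
  case (Cons d ds)
  then show ?case using atomic_ends[of d] Cons.IH[of "abot K d"] by simp
qed simp

lemma end_of_atop: "(p, f, q) \<in> atomics K \<Longrightarrow> end_of (skel K) (p \<Zcomp> ctop K f \<Zcomp> q) = end_of (skel K) q"
  "(p, f, q) \<in> atomics K \<Longrightarrow> end_of (skel K) (p \<Zcomp> cbot K f \<Zcomp> q) = end_of (skel K) q"
  using atomic_ends(2)[of "(p, f, q)"] by (simp_all add: end_of_path_comp atomicsD)

lemma whiskers_atomic:
  assumes "(p, f, q) \<in> atomics K" "A \<in> paths (skel K)" "B \<in> paths (skel K)"
    "end_of (skel K) A = start_of p" "end_of (skel K) q = start_of B"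
  shows "(A \<Zcomp> p, f, q \<Zcomp> B) \<in> atomics K"
  using assms atomicsD[OF assms(1)] by (intro atomicsI path_comp_in_paths) (auto simp: end_of_path_comp)

lemma whiskers_chain:
  assumes "chain K P ds Q" "A \<in> paths (skel K)" "B \<in> paths (skel K)"
    "end_of (skel K) A = start_of P" "end_of (skel K) P = start_of B"
  shows "chain K (A \<Zcomp> P \<Zcomp> B) (whiskers A ds B) (A \<Zcomp> Q \<Zcomp> B)"
  using assms
proof (induction ds arbitrary: P)
  case Nil
  then show ?case by (auto intro!: path_comp_in_paths)
next
  case (Cons d ds)
  obtain p f q where d: "d = (p, f, q)" by (cases d)
  have at: "(p, f, q) \<in> atomics K" "P = p \<Zcomp> ctop K f \<Zcomp> q" using Cons.prems by (auto simp: d)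
  have "chain K (A \<Zcomp> abot K d \<Zcomp> B) (whiskers A ds B) (A \<Zcomp> Q \<Zcomp> B)"
    using Cons.prems atomic_ends[of d] by (intro Cons.IH) auto
  moreover have "(A \<Zcomp> p, f, q \<Zcomp> B) \<in> atomics K"
    using Cons.prems at end_of_atop[OF at(1)] by (intro whiskers_atomic) auto
  ultimately show ?case by (simp add: d at(2))
qed

lemma whiskers_invs:
  "chain K P ds Q \<Longrightarrow> whiskers A (invs ds) B = invs (whiskers A ds B)"
  by (auto simp: whiskers_def invs_def rev_map[symmetric] dest!: atomics_chain)

text \<open>
Induction on the homotopy; the generating homotopies are stable under whiskering.
\<close>

lemma whiskers_homotopic:
  assumes "homotopic K \<Gamma> \<Delta>"
  shows "\<lbrakk>A \<in> paths (skel K); B \<in> paths (skel K); end_of (skel K) A = start_of (fst \<Gamma>);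
    end_of (skel K) (fst \<Gamma>) = start_of B\<rbrakk> \<Longrightarrow>
    hty (A \<Zcomp> fst \<Gamma> \<Zcomp> B) (whiskers A (snd \<Gamma>) B) (whiskers A (snd \<Delta>) B)"
  using assms
proof (induction rule: homotopic.induct)
  case (refl \<Gamma>)
  then obtain Q where "chain K (fst \<Gamma>) (snd \<Gamma>) Q" by (auto simp: two_path_iff)
  then show ?case using refl by (intro hty_refl[OF whiskers_chain]) auto
next
  case (sym \<Gamma> \<Delta>)
  then show ?case using homotopic_ends[OF sym.hyps] by (simp add: hty_sym)
next
  case (trans \<Gamma> \<Delta> \<Theta>)
  then show ?case using homotopic_ends[OF trans.hyps(1)] hty_trans by simp
next
  case (comp \<Gamma> \<Gamma>' \<Delta> \<Delta>')
  obtain Q where c: "chain K (fst \<Gamma>) (snd \<Gamma>) Q" using homotopic_ends[OF comp.hyps(1)] by auto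
  then have Q: "Q = fst \<Delta>" using bot_of_chain[OF c] comp.hyps by (simp add: top_of_def start_of_def)
  have "hty (A \<Zcomp> fst \<Gamma> \<Zcomp> B) (whiskers A (snd \<Gamma>) B) (whiskers A (snd \<Gamma>') B)"
    using comp by simp
  moreover have "hty (A \<Zcomp> Q \<Zcomp> B) (whiskers A (snd \<Delta>) B) (whiskers A (snd \<Delta>') B)"
    using comp Q chain_ends[OF c] by simp
  ultimately show ?case
    using hty_append whiskers_chain[OF c] comp.prems by simp
next
  case (cancel \<delta>)
  have "chain K (atop K \<delta>) [\<delta>] (abot K \<delta>)" using cancel chain_single by blast
  then have "chain K (A \<Zcomp> atop K \<delta> \<Zcomp> B) (whiskers A [\<delta>] B) (A \<Zcomp> abot K \<delta> \<Zcomp> B)"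
    using cancel by (intro whiskers_chain) auto
  from hty_invs[OF this] show ?case
    by (cases \<delta>) (auto simp: whiskers_def invs_def)
next
  case (indep p f q g r)
  have "(p, f, q \<Zcomp> ctop K g \<Zcomp> r) \<in> atomics K" "(p \<Zcomp> ctop K f \<Zcomp> q, g, r) \<in> atomics K"
    using indep by (auto intro!: atomicsI path_comp_in_paths simp: end_of_path_comp ctop_path)
  moreover have "end_of (skel K) r = start_of B"
    using indep by (simp add: end_of_path_comp)
  ultimately have "(A \<Zcomp> p, f, q \<Zcomp> ctop K g \<Zcomp> (r \<Zcomp> B)) \<in> atomics K"
    "((A \<Zcomp> p) \<Zcomp> ctop K f \<Zcomp> q, g, r \<Zcomp> B) \<in> atomics K"
    using indep.prems indep.hyps whiskers_atomic[of p f "q \<Zcomp> ctop K g \<Zcomp> r" A B]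
      whiskers_atomic[of "p \<Zcomp> ctop K f \<Zcomp> q" g r A B] by (auto simp: end_of_path_comp)
  from hty_indep[OF this] show ?case using indep by simp
qed

lemma whiskers_hty:
  assumes "hty P ds es" "A \<in> paths (skel K)" "B \<in> paths (skel K)"
    "end_of (skel K) A = start_of P" "end_of (skel K) P = start_of B"
  shows "hty (A \<Zcomp> P \<Zcomp> B) (whiskers A ds B) (whiskers A es B)"
  using whiskers_homotopic[OF assms(1)[unfolded hty_def]] assms by simp

text \<open>
Interchange of a single cell with a 2-path on its right, one step of the 2-path at a time.
\<close>

lemma atomic_interchange:
  assumes "chain K R es R'" "(p, f, q \<Zcomp> R \<Zcomp> B) \<in> atomics K" "q \<in> paths (skel K)" "R \<in> paths (skel K)"
    "B \<in> paths (skel K)" "end_of (skel K) q = start_of R" "end_of (skel K) R = start_of B"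
  shows "hty (p \<Zcomp> ctop K f \<Zcomp> q \<Zcomp> R \<Zcomp> B)
    ((p, f, q \<Zcomp> R \<Zcomp> B) # whiskers (p \<Zcomp> cbot K f \<Zcomp> q) es B)
    (whiskers (p \<Zcomp> ctop K f \<Zcomp> q) es B @ [(p, f, q \<Zcomp> R' \<Zcomp> B)])"
  using assms
proof (induction es arbitrary: R)
  case Nil
  then show ?case using hty_refl[OF chain_single[OF Nil.prems(2)]] by simp
next
  case (Cons d es)
  obtain u g v where d: "d = (u, g, v)" by (cases d)
  note at = Cons.prems(1)[unfolded d chain.simps, THEN conjunct1]
  have R: "R = u \<Zcomp> ctop K g \<Zcomp> v" and c: "chain K (u \<Zcomp> cbot K g \<Zcomp> v) es R'"
    using Cons.prems(1) by (auto simp: d)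
  let ?R = "u \<Zcomp> cbot K g \<Zcomp> v"
  note a = atomicsD[OF at] and b = atomicsD[OF Cons.prems(2)]
  have vB: "end_of (skel K) v = start_of B" using Cons.prems(7) R end_of_atop[OF at] by simp
  have qu: "end_of (skel K) q = start_of u" using Cons.prems(6) R by simp
  have R_paths: "?R \<in> paths (skel K)" using abot_in_paths[OF at] by simp
  have cells: "ctop K f \<in> paths (skel K)" "cbot K f \<in> paths (skel K)" "start_of q = end_of (skel K) (ctop K f)"
      "ctop K g \<in> paths (skel K)" "cbot K g \<in> paths (skel K)"
    using a b Cons.prems R by (auto simp: ctop_path cbot_path)
  have at': "(p, f, q \<Zcomp> ?R \<Zcomp> B) \<in> atomics K"
    using a b Cons.prems R_paths vB qu cells
    by (intro atomicsI path_comp_in_paths) (auto simp: end_of_path_comp)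
  have pq: "p \<Zcomp> ctop K f \<Zcomp> q \<in> paths (skel K)" "end_of (skel K) (p \<Zcomp> ctop K f \<Zcomp> q) = end_of (skel K) q"
    using b Cons.prems cells by (auto intro!: path_comp_in_paths simp: end_of_path_comp)
  have at2: "(p \<Zcomp> ctop K f \<Zcomp> q \<Zcomp> u, g, v \<Zcomp> B) \<in> atomics K"
    using whiskers_atomic[OF at pq(1) Cons.prems(5)] pq(2) qu vB by simp
  have ind: "hty (p \<Zcomp> ctop K f \<Zcomp> q \<Zcomp> R \<Zcomp> B)
      [(p, f, q \<Zcomp> R \<Zcomp> B), (p \<Zcomp> cbot K f \<Zcomp> q \<Zcomp> u, g, v \<Zcomp> B)]
      [(p \<Zcomp> ctop K f \<Zcomp> q \<Zcomp> u, g, v \<Zcomp> B), (p, f, q \<Zcomp> ?R \<Zcomp> B)]"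
    using hty_indep[of p f "q \<Zcomp> u" g "v \<Zcomp> B"] Cons.prems a at2 qu R
    by (simp add: end_of_path_comp path_comp_in_paths)
  have IH: "hty (p \<Zcomp> ctop K f \<Zcomp> q \<Zcomp> ?R \<Zcomp> B)
    ((p, f, q \<Zcomp> ?R \<Zcomp> B) # whiskers (p \<Zcomp> cbot K f \<Zcomp> q) es B)
    (whiskers (p \<Zcomp> ctop K f \<Zcomp> q) es B @ [(p, f, q \<Zcomp> R' \<Zcomp> B)])"
    using Cons.prems at' R_paths c atomic_ends[OF at] R by (intro Cons.IH) auto
  have cw: "chain K ((p \<Zcomp> cbot K f \<Zcomp> q) \<Zcomp> ?R \<Zcomp> B) (whiskers (p \<Zcomp> cbot K f \<Zcomp> q) es B)
      ((p \<Zcomp> cbot K f \<Zcomp> q) \<Zcomp> R' \<Zcomp> B)"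
  proof (rule whiskers_chain[OF c])
    show "p \<Zcomp> cbot K f \<Zcomp> q \<in> paths (skel K)" "end_of (skel K) (p \<Zcomp> cbot K f \<Zcomp> q) = start_of ?R"
      using b Cons.prems cells qu by (auto intro!: path_comp_in_paths simp: end_of_path_comp)
    show "end_of (skel K) ?R = start_of B" using end_of_atop(2)[OF at] vB by simp
  qed (rule Cons.prems(5))
  have "hty (p \<Zcomp> ctop K f \<Zcomp> q \<Zcomp> R \<Zcomp> B)
      ([(p, f, q \<Zcomp> R \<Zcomp> B), (p \<Zcomp> cbot K f \<Zcomp> q \<Zcomp> u, g, v \<Zcomp> B)] @ whiskers (p \<Zcomp> cbot K f \<Zcomp> q) es B)
      ([(p \<Zcomp> ctop K f \<Zcomp> q \<Zcomp> u, g, v \<Zcomp> B), (p, f, q \<Zcomp> ?R \<Zcomp> B)] @ whiskers (p \<Zcomp> cbot K f \<Zcomp> q) es B)"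
    by (rule hty_left[OF ind], rule chain_appendI[OF iffD2[OF hty_chain[OF ind]]])
      (use cw chain_paths[OF cw] at2 at' R in auto)
  also have "hty (p \<Zcomp> ctop K f \<Zcomp> q \<Zcomp> R \<Zcomp> B)
      ([(p \<Zcomp> ctop K f \<Zcomp> q \<Zcomp> u, g, v \<Zcomp> B), (p, f, q \<Zcomp> ?R \<Zcomp> B)] @ whiskers (p \<Zcomp> cbot K f \<Zcomp> q) es B)
      ([(p \<Zcomp> ctop K f \<Zcomp> q \<Zcomp> u, g, v \<Zcomp> B)] @ whiskers (p \<Zcomp> ctop K f \<Zcomp> q) es B @ [(p, f, q \<Zcomp> R' \<Zcomp> B)])"
  proof -
    have "chain K (p \<Zcomp> ctop K f \<Zcomp> q \<Zcomp> R \<Zcomp> B) [(p \<Zcomp> ctop K f \<Zcomp> q \<Zcomp> u, g, v \<Zcomp> B)]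
        (p \<Zcomp> ctop K f \<Zcomp> q \<Zcomp> ?R \<Zcomp> B)"
      using at2 R abot_in_paths[OF at2] by auto
    from hty_right[OF IH this] show ?thesis by simp
  qed
  finally show ?case by (simp add: d)
qed

lemma interchange:
  assumes "chain K P ds P'" "chain K R es R'" "A \<in> paths (skel K)" "q \<in> paths (skel K)"
    "B \<in> paths (skel K)" "end_of (skel K) A = start_of P" "end_of (skel K) P = start_of q"
    "end_of (skel K) q = start_of R" "end_of (skel K) R = start_of B"
  shows "hty (A \<Zcomp> P \<Zcomp> q \<Zcomp> R \<Zcomp> B)
    (whiskers A ds (q \<Zcomp> R \<Zcomp> B) @ whiskers (A \<Zcomp> P' \<Zcomp> q) es B)
    (whiskers (A \<Zcomp> P \<Zcomp> q) es B @ whiskers A ds (q \<Zcomp> R' \<Zcomp> B))"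
  using assms
proof (induction ds arbitrary: P)
  case Nil
  then have "chain K ((A \<Zcomp> P \<Zcomp> q) \<Zcomp> R \<Zcomp> B) (whiskers (A \<Zcomp> P \<Zcomp> q) es B) ((A \<Zcomp> P \<Zcomp> q) \<Zcomp> R' \<Zcomp> B)"
    by (intro whiskers_chain) (auto intro!: path_comp_in_paths simp: end_of_path_comp)
  then show ?case using Nil by (auto dest: hty_refl)
next
  case (Cons d ds)
  obtain u f v where d: "d = (u, f, v)" by (cases d)
  note at = Cons.prems(1)[unfolded d chain.simps, THEN conjunct1]
  have P: "P = u \<Zcomp> ctop K f \<Zcomp> v" and c: "chain K (u \<Zcomp> cbot K f \<Zcomp> v) ds P'"
    using Cons.prems(1) by (auto simp: d)
  let ?P = "u \<Zcomp> cbot K f \<Zcomp> v"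
  note a = atomicsD[OF at]
  have R: "R \<in> paths (skel K)" "R' \<in> paths (skel K)" and R'_ends: "start_of R' = start_of R" "end_of (skel K) R' = end_of (skel K) R"
    using Cons.prems(2) chain_paths chain_ends by blast+
  have vq: "end_of (skel K) v = start_of q" using Cons.prems(7) P end_of_atop[OF at] by simp
  have Au: "end_of (skel K) A = start_of u" using Cons.prems(6) P by simp
  have at': "(A \<Zcomp> u, f, v \<Zcomp> q \<Zcomp> S \<Zcomp> B) \<in> atomics K"
    if "S \<in> paths (skel K)" "start_of S = start_of R" "end_of (skel K) S = end_of (skel K) R" for S
    using whiskers_atomic[OF at Cons.prems(3), of "q \<Zcomp> S \<Zcomp> B"] Cons.prems vq Au that
    by (simp add: path_comp_in_paths end_of_path_comp)
  have IH: "hty (A \<Zcomp> ?P \<Zcomp> q \<Zcomp> R \<Zcomp> B)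
    (whiskers A ds (q \<Zcomp> R \<Zcomp> B) @ whiskers (A \<Zcomp> P' \<Zcomp> q) es B)
    (whiskers (A \<Zcomp> ?P \<Zcomp> q) es B @ whiskers A ds (q \<Zcomp> R' \<Zcomp> B))"
    using Cons.prems c atomic_ends[OF at] P by (intro Cons.IH) auto
  have one: "hty (A \<Zcomp> P \<Zcomp> q \<Zcomp> R \<Zcomp> B)
    ((A \<Zcomp> u, f, v \<Zcomp> q \<Zcomp> R \<Zcomp> B) # whiskers (A \<Zcomp> ?P \<Zcomp> q) es B)
    (whiskers (A \<Zcomp> P \<Zcomp> q) es B @ [(A \<Zcomp> u, f, v \<Zcomp> q \<Zcomp> R' \<Zcomp> B)])"
    using atomic_interchange[OF Cons.prems(2), of "A \<Zcomp> u" f "v \<Zcomp> q" B] at'[OF R(1)] R Cons.prems vq a P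
    by (simp add: path_comp_in_paths end_of_path_comp)
  have first: "chain K (A \<Zcomp> P \<Zcomp> q \<Zcomp> R \<Zcomp> B) [(A \<Zcomp> u, f, v \<Zcomp> q \<Zcomp> R \<Zcomp> B)] (A \<Zcomp> ?P \<Zcomp> q \<Zcomp> R \<Zcomp> B)"
    using chain_single[OF at'[OF R(1)]] P by simp
  have "chain K (A \<Zcomp> P' \<Zcomp> q \<Zcomp> R \<Zcomp> B) (whiskers (A \<Zcomp> P' \<Zcomp> q) es B) (A \<Zcomp> P' \<Zcomp> q \<Zcomp> R' \<Zcomp> B)"
    using whiskers_chain[OF Cons.prems(2), of "A \<Zcomp> P' \<Zcomp> q" B] Cons.prems chain_paths[OF c] chain_ends[OF c]
      atomic_ends[OF at] P by (simp add: path_comp_in_paths end_of_path_comp)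
  moreover have "chain K (A \<Zcomp> ?P \<Zcomp> q \<Zcomp> R \<Zcomp> B) (whiskers A ds (q \<Zcomp> R \<Zcomp> B)) (A \<Zcomp> P' \<Zcomp> q \<Zcomp> R \<Zcomp> B)"
    using whiskers_chain[OF c, of A "q \<Zcomp> R \<Zcomp> B"] Cons.prems R atomic_ends[OF at] P
    by (simp add: path_comp_in_paths end_of_path_comp)
  ultimately have rest: "chain K (A \<Zcomp> ?P \<Zcomp> q \<Zcomp> R \<Zcomp> B) (whiskers A ds (q \<Zcomp> R \<Zcomp> B) @ whiskers (A \<Zcomp> P' \<Zcomp> q) es B) (A \<Zcomp> P' \<Zcomp> q \<Zcomp> R' \<Zcomp> B)"
    by (auto simp: chain_append)
  have "hty (A \<Zcomp> P \<Zcomp> q \<Zcomp> R \<Zcomp> B)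
      ([(A \<Zcomp> u, f, v \<Zcomp> q \<Zcomp> R \<Zcomp> B)] @ whiskers A ds (q \<Zcomp> R \<Zcomp> B) @ whiskers (A \<Zcomp> P' \<Zcomp> q) es B)
      ([(A \<Zcomp> u, f, v \<Zcomp> q \<Zcomp> R \<Zcomp> B)] @ whiskers (A \<Zcomp> ?P \<Zcomp> q) es B @ whiskers A ds (q \<Zcomp> R' \<Zcomp> B))"
    by (rule hty_right[OF IH first])
  also have "hty (A \<Zcomp> P \<Zcomp> q \<Zcomp> R \<Zcomp> B)
      ([(A \<Zcomp> u, f, v \<Zcomp> q \<Zcomp> R \<Zcomp> B)] @ whiskers (A \<Zcomp> ?P \<Zcomp> q) es B @ whiskers A ds (q \<Zcomp> R' \<Zcomp> B))
      ((whiskers (A \<Zcomp> P \<Zcomp> q) es B @ [(A \<Zcomp> u, f, v \<Zcomp> q \<Zcomp> R' \<Zcomp> B)]) @ whiskers A ds (q \<Zcomp> R' \<Zcomp> B))"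
    using hty_left[OF one, of "whiskers A ds (q \<Zcomp> R' \<Zcomp> B)" "A \<Zcomp> P' \<Zcomp> q \<Zcomp> R' \<Zcomp> B"]
      chain_appendI[OF first iffD1[OF hty_chain[OF IH] rest]]
    by (simp del: chain.simps)
  finally show ?case by (simp add: d)
qed

end

context d2morphism
begin

lemma pmap_path_comp: "pmap \<phi> (p \<Zcomp> q) = pmap \<phi> p \<Zcomp> pmap \<phi> q"
  by (simp add: pmap_def path_comp_def)

lemma start_of_pmap [simp]: "start_of (pmap \<phi> p) = vmap \<phi> (start_of p)"
  by (simp add: pmap_def start_of_def)

lemma pmap_path:
  assumes "p \<in> paths (skel K)"
  shows "pmap \<phi> p \<in> paths (skel K') \<and> end_of (skel K') (pmap \<phi> p) = vmap \<phi> (end_of (skel K) p)"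
proof -
  have "pmap \<phi> (u, es) \<in> paths (skel K') \<and> end_of (skel K') (pmap \<phi> (u, es)) = vmap \<phi> (end_of (skel K) (u, es))"
    if "(u, es) \<in> paths (skel K)" for u es
    using that
  proof (induction es arbitrary: u)
    case Nil
    then have "u \<in> verts (skel K)" by (auto simp: paths_def pre_digraph.awalk_def)
    then have "vmap \<phi> u \<in> verts (skel K')" by (rule vmap_vert)
    then show ?case
      by (auto simp: pmap_def paths_def pre_digraph.awalk_def pre_digraph.cas.simps end_of_def
          pre_digraph.awalk_verts.simps)
  next
    case (Cons e es)
    have e: "e \<in> arcs (skel K)" "tail (skel K) e = u"
      using Cons.prems by (auto simp: paths_def pre_digraph.awalk_def pre_digraph.cas.simps)
    have "(u, [e] @ es) \<in> paths (skel K)" using Cons.prems by simp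
    from source.path_split[OF this] have "(head (skel K) e, es) \<in> paths (skel K)"
      by (simp add: end_of_def pre_digraph.awalk_verts.simps)
    note IH = Cons.IH[OF this]
    have "pmap \<phi> (u, e # es) = emap \<phi> e \<Zcomp> pmap \<phi> (head (skel K) e, es)"
      using init_emap[OF e(1)] e(2) by (simp add: pmap_def path_comp_def start_of_def)
    moreover have "end_of (skel K) (u, e # es) = end_of (skel K) (head (skel K) e, es)"
      by (simp add: end_of_def pre_digraph.awalk_verts.simps pre_digraph.awalk_verts_non_Nil)
    ultimately show ?case
      using IH emap_path[OF e(1)] term_emap[OF e(1)]
      by (simp add: target.path_comp_in_paths target.end_of_path_comp pmap_def start_of_def)
  qed
  then show ?thesis using assms by (cases p) auto
qed

definition atomics_map where
  "atomics_map ds = concat (map (\<lambda>(p, f, q). whiskers (pmap \<phi> p) (snd (cmap \<phi> f)) (pmap \<phi> q)) ds)"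

lemma two_map_eq: "two_map \<phi> (P, ds) = (pmap \<phi> P, atomics_map ds)"
  by (simp add: two_map_def atomics_map_def amap_def split_def)

lemma atomics_map_simps [simp]:
  "atomics_map [] = []"
  "atomics_map ((p, f, q) # ds) = whiskers (pmap \<phi> p) (snd (cmap \<phi> f)) (pmap \<phi> q) @ atomics_map ds"
  "atomics_map (ds @ es) = atomics_map ds @ atomics_map es"
  by (simp_all add: atomics_map_def)

lemma chain_cmap:
  assumes "f \<in> cells K"
  shows "chain K' (pmap \<phi> (ctop K f)) (snd (cmap \<phi> f)) (pmap \<phi> (cbot K f))"
  using cmap_two_path[OF assms] top_cmap[OF assms] bot_cmap[OF assms] target.two_pathE
  by (metis fst_conv snd_conv start_of_def top_of_def)

lemma snd_cmap_cinv:
  assumes "f \<in> cells K"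
  shows "snd (cmap \<phi> (cinv K f)) = target.invs (snd (cmap \<phi> f))"
  by (simp add: cmap_cinv[OF assms] two_inv_def target.invs_def)

lemma chain_whiskers_cmap:
  assumes "(p, f, q) \<in> atomics K"
  shows "chain K' (pmap \<phi> (p \<Zcomp> ctop K f \<Zcomp> q)) (whiskers (pmap \<phi> p) (snd (cmap \<phi> f)) (pmap \<phi> q))
    (pmap \<phi> (p \<Zcomp> cbot K f \<Zcomp> q))"
  unfolding pmap_path_comp
  using source.atomicsD[OF assms] pmap_path source.ctop_path
  by (intro target.whiskers_chain chain_cmap) auto

lemma chain_atomics_map:
  "chain K P ds Q \<Longrightarrow> chain K' (pmap \<phi> P) (atomics_map ds) (pmap \<phi> Q)"
proof (induction ds arbitrary: P)
  case Nil
  then show ?case using pmap_path by auto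
next
  case (Cons d ds)
  obtain p f q where d: "d = (p, f, q)" by (cases d)
  show ?case
    using Cons.prems Cons.IH[of "abot K d"] chain_whiskers_cmap[of p f q]
    by (auto simp: d intro!: target.chain_appendI)
qed

text \<open>
Morphisms send interchanges of cells to interchanges of 2-paths, hence act on homotopy classes.
\<close>

lemma atomics_map_homotopic:
  "homotopic K \<Gamma> \<Delta> \<Longrightarrow> target.hty (pmap \<phi> (fst \<Gamma>)) (atomics_map (snd \<Gamma>)) (atomics_map (snd \<Delta>))"
proof (induction rule: homotopic.induct)
  case (refl \<Gamma>)
  then obtain Q where "chain K (fst \<Gamma>) (snd \<Gamma>) Q" by (auto simp: source.two_path_iff)
  then show ?case by (rule target.hty_refl[OF chain_atomics_map])
next
  case (sym \<Gamma> \<Delta>)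
  then show ?case using source.homotopic_ends[OF sym.hyps] by (simp add: target.hty_sym)
next
  case (trans \<Gamma> \<Delta> \<Theta>)
  then show ?case using source.homotopic_ends[OF trans.hyps(1)] target.hty_trans by simp
next
  case (comp \<Gamma> \<Gamma>' \<Delta> \<Delta>')
  obtain Q where c: "chain K (fst \<Gamma>) (snd \<Gamma>) Q" using source.homotopic_ends[OF comp.hyps(1)] by auto
  then have Q: "Q = fst \<Delta>" using source.bot_of_chain[OF c] comp.hyps by (simp add: top_of_def start_of_def)
  show ?case using target.hty_append[OF comp.IH] chain_atomics_map[OF c] Q by simp
next
  case (cancel \<delta>)
  obtain p f q where d: "\<delta> = (p, f, q)" by (cases \<delta>)
  note at = cancel[unfolded d]
  note c = chain_whiskers_cmap[OF at]
  have f: "f \<in> cells K" using source.atomicsD[OF at] by simp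
  have "whiskers (pmap \<phi> p) (snd (cmap \<phi> (cinv K f))) (pmap \<phi> q)
      = target.invs (whiskers (pmap \<phi> p) (snd (cmap \<phi> f)) (pmap \<phi> q))"
    using snd_cmap_cinv[OF f] target.whiskers_invs[OF chain_cmap[OF f]] by simp
  then show ?case using target.hty_invs[OF c] by (simp add: d)
next
  case (indep p f q g r)
  have "target.hty (pmap \<phi> p \<Zcomp> pmap \<phi> (ctop K f) \<Zcomp> pmap \<phi> q \<Zcomp> pmap \<phi> (ctop K g) \<Zcomp> pmap \<phi> r)
    (whiskers (pmap \<phi> p) (snd (cmap \<phi> f)) (pmap \<phi> q \<Zcomp> pmap \<phi> (ctop K g) \<Zcomp> pmap \<phi> r) @
      whiskers (pmap \<phi> p \<Zcomp> pmap \<phi> (cbot K f) \<Zcomp> pmap \<phi> q) (snd (cmap \<phi> g)) (pmap \<phi> r))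
    (whiskers (pmap \<phi> p \<Zcomp> pmap \<phi> (ctop K f) \<Zcomp> pmap \<phi> q) (snd (cmap \<phi> g)) (pmap \<phi> r) @
      whiskers (pmap \<phi> p) (snd (cmap \<phi> f)) (pmap \<phi> q \<Zcomp> pmap \<phi> (cbot K g) \<Zcomp> pmap \<phi> r))"
    using indep pmap_path source.ctop_path
    by (intro target.interchange chain_cmap) auto
  then show ?case by (simp add: pmap_path_comp)
qed

lemma induced_hclass:
  assumes "chain K P ds Q"
  shows "induced K' \<phi> (hclass K (P, ds)) = hclass K' (pmap \<phi> P, atomics_map ds)"
proof -
  have "hclass K' (two_map \<phi> \<Gamma>) = hclass K' (pmap \<phi> P, atomics_map ds)" if "\<Gamma> \<in> hclass K (P, ds)" for \<Gamma>
  proof -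
    have h: "homotopic K (P, ds) \<Gamma>" using that by (simp add: hclass_def)
    then have "two_map \<phi> \<Gamma> = (pmap \<phi> P, atomics_map (snd \<Gamma>))"
      using two_map_eq[of "fst \<Gamma>" "snd \<Gamma>"] source.homotopic_ends[OF h] by simp
    moreover have "hclass K' (pmap \<phi> P, atomics_map ds) = hclass K' (pmap \<phi> P, atomics_map (snd \<Gamma>))"
      using atomics_map_homotopic[OF h] target.hclass_chain_eq_iff[OF chain_atomics_map[OF assms]] by simp
    ultimately show ?thesis by simp
  qed
  moreover have "(P, ds) \<in> hclass K (P, ds)"
    using assms by (auto simp: hclass_def intro!: homotopic.refl source.chain_in_two_paths)
  ultimately show ?thesis unfolding induced_def by fast
qed

end

section \<open>Tuples acted on by 2-paths\<close>

text \<open>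
Homotopy of 2-paths over the complex imposes no relation between cells besides inverses and
interchange.  Therefore any two bijections of the shapes of the relations \<open>y\<^sup>3 = y\<^sup>2\<close> and
\<open>ay = a\<close> make homotopy classes of 2-paths act on tuples: a cell rewrites a segment of the tuple.
This freedom is the reason for universality.
\<close>

locale ay_action =
  fixes F :: "'x \<times> 'x \<times> 'x \<Rightarrow> 'x \<times> 'x" and G :: "'x \<times> 'x \<Rightarrow> 'x"
  assumes bij_F: "bij F" and bij_G: "bij G"
begin

fun cell_act :: "(edge list \<times> edge list) \<times> bool \<Rightarrow> 'x list \<Rightarrow> 'x list" where
  "cell_act (r, True) [x, y, z] = [fst (F (x, y, z)), snd (F (x, y, z))]"
| "cell_act (r, True) [x, y] = [G (x, y)]"
| "cell_act (r, False) [x, y] = (case inv_into UNIV F (x, y) of (u, v, w) \<Rightarrow> [u, v, w])"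
| "cell_act (r, False) [x] = (case inv_into UNIV G x of (u, v) \<Rightarrow> [u, v])"
| "cell_act f xs = []"

lemma cell_act:
  assumes "f \<in> cells K_ay" "length xs = length (snd (ctop K_ay f))"
  shows "length (cell_act f xs) = length (snd (cbot K_ay f))"
    "cell_act (cinv K_ay f) (cell_act f xs) = xs"
  using assms bij_F bij_G
  by (auto simp: cells_K_ay length_Suc_conv bij_is_inj bij_is_surj surj_f_inv_f split: prod.split)
    (metis bij_is_surj surj_f_inv_f prod.collapse fst_conv snd_conv)+

definition act :: "(unit, edge, (edge list \<times> edge list) \<times> bool) atomic \<Rightarrow> 'x list \<Rightarrow> 'x list" where
  "act = (\<lambda>(p, f, q) xs. take (length (snd p)) xs
     @ cell_act f (take (length (snd (ctop K_ay f))) (drop (length (snd p)) xs))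
     @ drop (length (snd p) + length (snd (ctop K_ay f))) xs)"

primrec acts :: "(unit, edge, (edge list \<times> edge list) \<times> bool) atomic list \<Rightarrow> 'x list \<Rightarrow> 'x list" where
  "acts [] xs = xs"
| "acts (d # ds) xs = acts ds (act d xs)"

lemma acts_append [simp]: "acts (ds @ es) xs = acts es (acts ds xs)"
  by (induction ds arbitrary: xs) auto

lemma act_simp:
  "length us = length (snd p) \<Longrightarrow> length ts = length (snd (ctop K_ay f)) \<Longrightarrow>
    act (p, f, q) (us @ ts @ vs) = us @ cell_act f ts @ vs"
  by (simp add: act_def)

lemma split3:
  assumes "length xs = i + j + k"
  obtains us ts vs where "xs = us @ ts @ vs" "length us = i" "length ts = j" "length vs = k"
proof
  show "xs = take i xs @ take j (drop i xs) @ drop j (drop i xs)"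
    unfolding append_take_drop_id ..
qed (use assms in auto)

lemma act_atomic:
  assumes "d \<in> atomics K_ay" "length xs = length (snd (atop K_ay d))"
  shows "length (act d xs) = length (snd (abot K_ay d))" "act (ainv K_ay d) (act d xs) = xs"
proof -
  obtain p f q where d: "d = (p, f, q)" by (cases d)
  have f: "f \<in> cells K_ay" using assms by (simp add: d)
  obtain us ts vs where xs: "xs = us @ ts @ vs" "length us = length (snd p)"
    "length ts = length (snd (ctop K_ay f))" "length vs = length (snd q)"
    using split3[of xs "length (snd p)" "length (snd (ctop K_ay f))" "length (snd q)"] assms
    by (auto simp: d)
  show "length (act d xs) = length (snd (abot K_ay d))" "act (ainv K_ay d) (act d xs) = xs"
    using xs cell_act[OF f xs(3)] by (simp_all add: d act_simp K_ay.ctop_cinv[OF f])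
qed

lemma length_acts:
  "chain K_ay P ds Q \<Longrightarrow> length xs = length (snd P) \<Longrightarrow> length (acts ds xs) = length (snd Q)"
proof (induction ds arbitrary: P xs)
  case (Cons d ds)
  then show ?case using act_atomic(1)[of d xs] Cons.IH[of "abot K_ay d" "act d xs"] by simp
qed simp

text \<open>
Inverse cells act by inverse bijections, and interchanged cells act on disjoint segments.
\<close>

lemma acts_homotopic:
  "homotopic K_ay \<Gamma> \<Delta> \<Longrightarrow> length xs = length (snd (fst \<Gamma>)) \<Longrightarrow> acts (snd \<Gamma>) xs = acts (snd \<Delta>) xs"
proof (induction arbitrary: xs rule: homotopic.induct)
  case (sym \<Gamma> \<Delta>)
  then show ?case using K_ay.homotopic_ends[OF sym.hyps] by simp
next
  case (trans \<Gamma> \<Delta> \<Theta>)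
  then show ?case using K_ay.homotopic_ends[OF trans.hyps(1)] by simp
next
  case (comp \<Gamma> \<Gamma>' \<Delta> \<Delta>')
  obtain Q where c: "chain K_ay (fst \<Gamma>) (snd \<Gamma>) Q" using K_ay.homotopic_ends[OF comp.hyps(1)] by auto
  then have "Q = fst \<Delta>" using K_ay.bot_of_chain[OF c] comp.hyps by (simp add: top_of_def start_of_def)
  then show ?case using comp length_acts[OF c, of xs] by simp
next
  case (cancel \<delta>)
  then show ?case using act_atomic(2)[OF cancel(1)] by simp
next
  case (indep p f q g r)
  have f: "f \<in> cells K_ay" and g: "g \<in> cells K_ay" using indep by auto
  let ?nf = "length (snd (ctop K_ay f))" and ?ng = "length (snd (ctop K_ay g))"
  obtain us ts rest where 1: "xs = us @ ts @ rest" "length us = length (snd p)" "length ts = ?nf"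
    "length rest = length (snd q) + ?ng + length (snd r)"
    using split3[of xs "length (snd p)" ?nf "length (snd q) + ?ng + length (snd r)"] indep
    by auto
  obtain vs ss ws where 2: "rest = vs @ ss @ ws" "length vs = length (snd q)" "length ss = ?ng"
    "length ws = length (snd r)"
    using split3[OF 1(4)] by blast
  have "act (p \<Zcomp> cbot K_ay f \<Zcomp> q, g, r) ((us @ cell_act f ts @ vs) @ ss @ ws)
      = (us @ cell_act f ts @ vs) @ cell_act g ss @ ws"
    using 1 2 cell_act(1)[OF f] by (intro act_simp) auto
  moreover have "act (p \<Zcomp> ctop K_ay f \<Zcomp> q, g, r) ((us @ ts @ vs) @ ss @ ws)
      = (us @ ts @ vs) @ cell_act g ss @ ws"
    using 1 2 by (intro act_simp) auto
  ultimately show ?case using 1 2 by (simp add: act_simp)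
qed simp

lemma acts_hty: "K_ay.hty P ds es \<Longrightarrow> length xs = length (snd P) \<Longrightarrow> acts ds xs = acts es xs"
  unfolding K_ay.hty_def using acts_homotopic by fastforce

lemma acts_invs:
  assumes "chain K_ay P ds Q" "length xs = length (snd P)" "acts ds xs = ys"
  shows "acts (K_ay.invs ds) ys = xs"
  using acts_hty[OF K_ay.hty_invs[OF assms(1)] assms(2)] assms(3) by simp

lemma acts_whiskers:
  assumes "chain K_ay P ds Q" "length xs = length (snd P)" "length us = length (snd A)"
  shows "acts (whiskers A ds B) (us @ xs @ vs) = us @ acts ds xs @ vs"
  using assms
proof (induction ds arbitrary: P xs)
  case (Cons d ds)
  obtain p f q where d: "d = (p, f, q)" by (cases d)
  have P: "P = p \<Zcomp> ctop K_ay f \<Zcomp> q" and at: "d \<in> atomics K_ay" using Cons.prems by (auto simp: d)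
  obtain us' ts vs' where xs: "xs = us' @ ts @ vs'" "length us' = length (snd p)"
    "length ts = length (snd (ctop K_ay f))" "length vs' = length (snd q)"
    using split3[of xs "length (snd p)" "length (snd (ctop K_ay f))" "length (snd q)"] Cons.prems
    by (auto simp: P)
  have "act (A \<Zcomp> p, f, q \<Zcomp> B) ((us @ us') @ ts @ vs' @ vs) = (us @ us') @ cell_act f ts @ vs' @ vs"
    using xs Cons.prems by (intro act_simp) auto
  moreover have a: "act d xs = us' @ cell_act f ts @ vs'" using xs by (simp add: d act_simp)
  moreover have "acts (whiskers A ds B) (us @ act d xs @ vs) = us @ acts ds (act d xs) @ vs"
    using Cons.prems act_atomic(1)[OF at, of xs] by (intro Cons.IH[of "abot K_ay d"]) auto
  ultimately show ?case using xs by (simp add: d)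
qed simp

end

section \<open>A bijection that simulates all cells\<close>

text \<open>
The bijection that interprets \<open>y\<^sup>3 = y\<^sup>2\<close> runs a small machine on these symbols.
\<^item> \<open>Pack ts i\<close> holds a tuple of terms of the term algebra together with a counter.
\<^item> A term \<open>t\<close> that sits on an edge of the simulated complex is written as the two symbols
  \<open>Pack [t] 0\<close> and \<open>Dot\<close>.
\<^item> \<open>Circ\<close> and \<open>One\<close> are markers for the intermediate stages.
\<close>

datatype token = Pack "wire list" nat | Dot | Circ | One

instance wire :: countable by countable_datatype
instance token :: countable by countable_datatype

lemma infinite_UNIV_token: "infinite (UNIV :: token set)"
proof -
  have "inj (Pack [])" by (auto intro: injI)
  then have "infinite (range (Pack []))" by (simp add: finite_image_iff)
  then show ?thesis by (rule infinite_super[OF subset_UNIV])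
qed

text \<open>
The effect of a pair of mutually inverse cells on tuples of terms, as long as it does not violate
reducedness: \<open>l\<close> and \<open>l'\<close> are the labels of the two cells, \<open>m\<close> and \<open>n\<close> the lengths of the top and
the bottom of the first one, all encoded in \<open>k\<close>.  The side conditions make the two clauses
exclusive in both directions, which is what makes the relation a partial bijection.
\<close>

inductive cell_rule :: "nat \<Rightarrow> wire list \<Rightarrow> wire list \<Rightarrow> bool" where
  forward: "from_nat k = (l, l', m, n) \<Longrightarrow> length ts = m \<Longrightarrow> 0 < m \<Longrightarrow> 0 < n \<Longrightarrow>
    \<nexists>zs. length zs = n \<and> ts = outs l' m zs \<Longrightarrow> cell_rule k ts (outs l n ts)"
| backward: "from_nat k = (l, l', m, n) \<Longrightarrow> length zs = n \<Longrightarrow> 0 < m \<Longrightarrow> 0 < n \<Longrightarrow>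
    \<nexists>ts. length ts = m \<and> zs = outs l n ts \<Longrightarrow> cell_rule k (outs l' m zs) zs"

lemma outs_inject: "0 < n \<Longrightarrow> outs l n ts = outs l n ts' \<longleftrightarrow> ts = ts'"
  by (auto simp: outs_def)

lemma cell_rule_iff:
  assumes "from_nat k = (l, l', m, n)"
  shows "cell_rule k ts us \<longleftrightarrow> 0 < m \<and> 0 < n \<and> length ts = m \<and> length us = n \<and>
    ((us = outs l n ts \<and> (\<nexists>zs. length zs = n \<and> ts = outs l' m zs)) \<or>
     (ts = outs l' m us \<and> (\<nexists>zs. length zs = m \<and> us = outs l n zs)))"
  using assms by (subst cell_rule.simps) auto

lemma cell_rule_functional:
  assumes "cell_rule k ts us" "cell_rule k ts vs"
  shows "us = vs"
proof -
  obtain l l' m n :: nat where k: "from_nat k = (l, l', m, n)" by (metis prod_cases4)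
  have len: "0 < m" "length us = n" "length vs = n" using assms by (simp_all add: cell_rule_iff[OF k])
  show ?thesis
  proof (cases "\<exists>zs. length zs = n \<and> ts = outs l' m zs")
    case True
    then have "ts = outs l' m us" "ts = outs l' m vs" using assms unfolding cell_rule_iff[OF k] by blast+
    then show ?thesis using outs_inject[OF len(1)] by simp
  next
    case False
    then have "us = outs l n ts" "vs = outs l n ts" using assms len unfolding cell_rule_iff[OF k] by blast+
    then show ?thesis by simp
  qed
qed

lemma cell_rule_injective:
  assumes "cell_rule k ts vs" "cell_rule k us vs"
  shows "ts = us"
proof -
  obtain l l' m n :: nat where k: "from_nat k = (l, l', m, n)" by (metis prod_cases4)
  have len: "0 < n" "length ts = m" "length us = m" using assms by (simp_all add: cell_rule_iff[OF k])
  show ?thesis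
  proof (cases "\<exists>zs. length zs = m \<and> vs = outs l n zs")
    case True
    then have "vs = outs l n ts" "vs = outs l n us" using assms unfolding cell_rule_iff[OF k] by blast+
    then show ?thesis using outs_inject[OF len(1)] by simp
  next
    case False
    then have "ts = outs l' m vs" "us = outs l' m vs" using assms len unfolding cell_rule_iff[OF k] by blast+
    then show ?thesis by simp
  qed
qed

text \<open>
Three symbols to the left, two to the right.
\<^item> \<open>pack\<close> and \<open>mark\<close> together move the next edge into the package.
\<^item> \<open>tick\<close>, used backwards, writes a new \<open>One\<close> in front of \<open>Circ Dot\<close>.
\<^item> \<open>count\<close> moves a \<open>One\<close> into the counter, so that a 2-path can prepare any value of it.
\<^item> \<open>cell\<close> applies the cells with code \<open>k\<close> at counter \<open>k + 1\<close>.  The counter stays, because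
  otherwise different codes with equal results would collide.  Counter 0 is reserved for \<open>pack\<close>,
  whose results have the same shape.
\<close>

inductive token_rule :: "token \<times> token \<times> token \<Rightarrow> token \<times> token \<Rightarrow> bool" where
  pack: "ts \<noteq> [] \<Longrightarrow> token_rule (Pack ts 0, Dot, Pack [t] 0) (Pack (ts @ [t]) 0, Circ)"
| mark: "token_rule (Pack ts 0, Circ, Dot) (Pack ts 0, Dot)"
| tick: "token_rule (One, Circ, Dot) (Circ, Dot)"
| count: "token_rule (Pack ts i, One, One) (Pack ts (Suc i), One)"
| cell: "cell_rule k ts us \<Longrightarrow> token_rule (Pack ts (Suc k), One, Circ) (Pack us (Suc k), Circ)"

lemma token_rule_functional: "token_rule x y \<Longrightarrow> token_rule x z \<Longrightarrow> y = z"
  by (auto elim!: token_rule.cases dest: cell_rule_functional)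

lemma token_rule_injective: "token_rule x z \<Longrightarrow> token_rule y z \<Longrightarrow> x = y"
  by (auto elim!: token_rule.cases dest: cell_rule_injective)

lemma bij_betw_countable_infinite:
  assumes "countable A" "infinite A" "countable B" "infinite B"
  obtains f where "bij_betw f A B"
  using bij_betw_trans[OF to_nat_on_infinite[OF assms(1,2)] bij_betw_from_nat_into[OF assms(3,4)]]
  by blast

text \<open>
The rules define a bijection between a set of triples and a set of pairs.  No triple or pair that
starts with \<open>Dot\<close> is involved, so both complements are countably infinite and can be matched.
\<close>

lemma token_rule_extends: "\<exists>F. bij F \<and> (\<forall>x y. token_rule x y \<longrightarrow> F x = y)"
proof -
  define D where "D = {x. \<exists>y. token_rule x y}"
  define E where "E = {y. \<exists>x. token_rule x y}"
  define f where "f x = (THE y. token_rule x y)" for x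
  have f: "f x = y" if "token_rule x y" for x y
    unfolding f_def using that token_rule_functional by blast
  have "bij_betw f D E"
    unfolding bij_betw_def inj_on_def D_def E_def
    using f token_rule_injective by (auto simp: image_iff) metis+
  moreover have "infinite (- D)"
  proof
    assume "finite (- D)"
    moreover have "(\<lambda>t. (Dot, t, t)) ` UNIV \<subseteq> - D"
      by (auto simp: D_def elim: token_rule.cases)
    ultimately have "finite ((\<lambda>t :: token. (Dot, t, t)) ` UNIV)" by (rule finite_subset[rotated])
    then show False using infinite_UNIV_token by (simp add: finite_image_iff inj_on_def)
  qed
  moreover have "infinite (- E)"
  proof
    assume "finite (- E)"
    moreover have "(\<lambda>t. (Dot, t)) ` UNIV \<subseteq> - E"
      by (auto simp: E_def elim: token_rule.cases)
    ultimately have "finite ((\<lambda>t :: token. (Dot, t)) ` UNIV)" by (rule finite_subset[rotated])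
    then show False using infinite_UNIV_token by (simp add: finite_image_iff inj_on_def)
  qed
  ultimately obtain g where "bij_betw g (- D) (- E)"
    using bij_betw_countable_infinite[of "- D" "- E"] by (auto simp: uncountable_def)
  then have "bij_betw (\<lambda>x. if x \<in> D then f x else g x) (D \<union> - D) (E \<union> - E)"
    using \<open>bij_betw f D E\<close> by (intro bij_betw_disjoint_Un) auto
  moreover have "(if x \<in> D then f x else g x) = y" if "token_rule x y" for x y
    using that f by (auto simp: D_def)
  ultimately show ?thesis by (intro exI[of _ "\<lambda>x. if x \<in> D then f x else g x"]) simp
qed

definition token_bij :: "token \<times> token \<times> token \<Rightarrow> token \<times> token" where
  "token_bij = (SOME F. bij F \<and> (\<forall>x y. token_rule x y \<longrightarrow> F x = y))"

definition token_pairing :: "token \<times> token \<Rightarrow> token" where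
  "token_pairing = (SOME G. bij G)"

text \<open>
Only the values prescribed by the rules matter; all the others are arbitrary.
\<close>

lemma token_bij: "bij token_bij" "token_rule x y \<Longrightarrow> token_bij x = y"
  using someI_ex[OF token_rule_extends] unfolding token_bij_def by auto

lemma token_pairing: "bij token_pairing"
proof -
  have "infinite (UNIV :: (token \<times> token) set)"
    using infinite_UNIV_token by (simp add: finite_prod)
  then have "\<exists>G :: token \<times> token \<Rightarrow> token. bij G"
    using bij_betw_countable_infinite[of "UNIV :: (token \<times> token) set" "UNIV :: token set"]
      infinite_UNIV_token by auto
  then show ?thesis unfolding token_pairing_def by (rule someI_ex)
qed

interpretation tok: ay_action token_bij token_pairing
  by unfold_locales (rule token_bij token_pairing)+

section \<open>2-paths that simulate a cell\<close>

abbreviation y_at :: "nat \<Rightarrow> bool \<Rightarrow> nat \<Rightarrow> (unit, edge, (edge list \<times> edge list) \<times> bool) atomic" where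
  "y_at i b j \<equiv> (((), Y i), y_cell b, ((), Y j))"

lemma act_y_at:
  assumes "token_rule (x, y, z) (u, v)" "length us = length es"
  shows "tok.act (((), es), y_cell True, q) (us @ x # y # z # vs) = us @ u # v # vs"
    "tok.act (((), es), y_cell False, q) (us @ u # v # vs) = us @ x # y # z # vs"
proof -
  have F: "token_bij (x, y, z) = (u, v)" using token_bij(2)[OF assms(1)] .
  then have i: "inv_into UNIV token_bij (u, v) = (x, y, z)"
    using token_bij(1) by (metis bij_is_inj inv_f_eq)
  show "tok.act (((), es), y_cell True, q) (us @ x # y # z # vs) = us @ u # v # vs"
    using tok.act_simp[of us "((), es)" "[x, y, z]" "y_cell True" q vs] assms(2) F by simp
  show "tok.act (((), es), y_cell False, q) (us @ u # v # vs) = us @ x # y # z # vs"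
    using tok.act_simp[of us "((), es)" "[u, v]" "y_cell False" q vs] assms(2) i by simp
qed

lemma act_y_at_0:
  assumes "token_rule (x, y, z) (u, v)"
  shows "tok.act (((), []), y_cell True, q) (x # y # z # vs) = u # v # vs"
    "tok.act (((), []), y_cell False, q) (u # v # vs) = x # y # z # vs"
  using act_y_at[OF assms, of "[]" "[]" q vs] by simp_all

lemma chain_y_at:
  "m = i + 2 + j \<Longrightarrow> n = i + 3 + j \<Longrightarrow> chain K_ay ((), Y m) [y_at i False j] ((), Y n)"
  "m = i + 2 + j \<Longrightarrow> n = i + 3 + j \<Longrightarrow> chain K_ay ((), Y n) [y_at i True j] ((), Y m)"
  by (auto simp: cells_K_ay replicate_add numeral_eq_Suc replicate_app_Cons_same)

text \<open>
Contract \<open>r\<close> times the two symbols of the next edge into the package at the left end.  The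
argument of \<open>y_at 0 True\<close> is the number of letters to the right, which decreases by one each time.
\<close>

definition packing where
  "packing r = map (y_at 0 True) (rev [0..<2 * r])"

lemma chain_packing: "chain K_ay ((), Y (2 * r + 2)) (packing r) ((), Y 2)"
proof -
  have "chain K_ay ((), Y (n + 2)) (map (y_at 0 True) (rev [0..<n])) ((), Y 2)" for n
  proof (induction n)
    case (Suc n)
    have "chain K_ay ((), Y (Suc n + 2)) [y_at 0 True n] ((), Y (n + 2))"
      by (rule chain_y_at) simp_all
    from K_ay.chain_appendI[OF this Suc] show ?case by (simp del: chain.simps)
  qed (simp add: numeral_2_eq_2)
  then show ?thesis by (simp add: packing_def)
qed

definition encode :: "wire list \<Rightarrow> token list" where
  "encode ts = concat (map (\<lambda>t. [Pack [t] 0, Dot]) ts)"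

lemma encode_simps [simp]:
  "encode [] = []" "encode (t # ts) = Pack [t] 0 # Dot # encode ts"
  "encode (ts @ us) = encode ts @ encode us"
  by (simp_all add: encode_def)

lemma length_encode [simp]: "length (encode ts) = 2 * length ts"
  by (induction ts) auto

lemma encode_inject: "encode ts = encode us \<longleftrightarrow> ts = us"
proof (induction ts arbitrary: us)
  case Nil
  then show ?case by (cases us) auto
next
  case (Cons t ts)
  then show ?case by (cases us) auto
qed

lemma acts_packing:
  assumes "length ts = Suc r"
  shows "tok.acts (packing r) (encode ts) = [Pack ts 0, Dot]"
proof -
  have "tok.acts (packing r) (Pack us 0 # Dot # encode ts) = [Pack (us @ ts) 0, Dot]"
    if "length ts = r" "us \<noteq> []" for us ts
    using that
  proof (induction r arbitrary: us ts)
    case 0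
    then show ?case by (simp add: packing_def)
  next
    case (Suc r)
    then obtain t ts' where ts: "ts = t # ts'" "length ts' = r" by (cases ts) auto
    have "packing (Suc r) = y_at 0 True (2 * r + 1) # y_at 0 True (2 * r) # packing r"
      by (simp add: packing_def)
    then show ?case
      using Suc.IH[OF ts(2), of "us @ [t]"] Suc.prems
      by (simp add: ts act_y_at_0[OF token_rule.pack] act_y_at_0[OF token_rule.mark])
  qed
  from this[of "tl ts" "[hd ts]"] show ?thesis using assms by (cases ts) auto
qed

text \<open>
Unfold \<open>Dot\<close> into \<open>Circ Dot\<close>, write \<open>k + 2\<close> symbols \<open>One\<close>, and count \<open>k + 1\<close> of them.
The last \<open>One\<close> is the marker in the rules \<open>count\<close> and \<open>cell\<close>.
\<close>

definition counting where
  "counting k = y_at 0 False 0 # map (\<lambda>i. y_at (Suc i) False 0) [0..<k + 2]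
     @ map (y_at 0 True) (rev [2..<k + 3])"

lemma chain_counting: "chain K_ay ((), Y 2) (counting k) ((), Y 4)"
proof -
  have 1: "chain K_ay ((), Y 2) [y_at 0 False 0] ((), Y 3)" by (rule chain_y_at) simp_all
  have 2: "chain K_ay ((), Y 3) (map (\<lambda>i. y_at (Suc i) False 0) [0..<n]) ((), Y (n + 3))" for n
  proof (induction n)
    case (Suc n)
    have "chain K_ay ((), Y (n + 3)) [y_at (Suc n) False 0] ((), Y (Suc n + 3))"
      by (rule chain_y_at) simp_all
    from K_ay.chain_appendI[OF Suc this] show ?case by (simp del: chain.simps replicate_Suc)
  qed simp
  have 3: "chain K_ay ((), Y (n + 4)) (map (y_at 0 True) (rev [2..<n + 2])) ((), Y 4)" for n
  proof (induction n)
    case (Suc n)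
    have "chain K_ay ((), Y (Suc n + 4)) [y_at 0 True (n + 2)] ((), Y (n + 4))"
      by (rule chain_y_at) simp_all
    from K_ay.chain_appendI[OF this Suc] show ?case by (simp del: chain.simps replicate_Suc)
  qed simp
  have "k + 2 + 3 = (k + 1) + 4" "k + 3 = (k + 1) + 2" by simp_all
  then show ?thesis
    using K_ay.chain_appendI[OF 1 K_ay.chain_appendI[OF 2[of "k + 2"] 3[of "k + 1", folded \<open>k + 2 + 3 = (k + 1) + 4\<close>]]]
    unfolding counting_def by (simp add: numeral_3_eq_3 del: chain.simps replicate_Suc upt_Suc)
qed

lemma acts_counting: "tok.acts (counting k) [Pack ts 0, Dot] = [Pack ts (Suc k), One, Circ, Dot]"
proof -
  have 1: "tok.acts (map (\<lambda>i. y_at (Suc i) False 0) [0..<n]) [Pack ts 0, Circ, Dot]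
      = Pack ts 0 # replicate n One @ [Circ, Dot]" for n
  proof (induction n)
    case (Suc n)
    have "tok.act (y_at (Suc n) False 0) ((Pack ts 0 # replicate n One) @ [Circ, Dot])
        = (Pack ts 0 # replicate n One) @ [One, Circ, Dot]"
      by (rule act_y_at(2)[OF token_rule.tick]) simp
    then show ?case using Suc by (simp add: replicate_app_Cons_same)
  qed simp
  have 2: "tok.acts (map (y_at 0 True) (rev [2..<n + 2])) (Pack ts i # replicate (Suc n) One @ [Circ, Dot])
      = [Pack ts (i + n), One, Circ, Dot]" for n i
  proof (induction n arbitrary: i)
    case (Suc n)
    have "rev [2..<Suc n + 2] = (n + 2) # rev [2..<n + 2]" by simp
    then show ?case using Suc[of "Suc i"] by (simp add: act_y_at_0[OF token_rule.count] del: upt_Suc)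
  qed simp
  show ?thesis
    using 1[of "k + 2"] 2[of "k + 1" 0]
    by (simp add: counting_def act_y_at_0[OF token_rule.mark] numeral_3_eq_3 del: upt_Suc)
qed

text \<open>
A loop at \<open>y\<^sup>2\<close> that acts on a package by the cells with code \<open>k\<close>: after the counter is set, the
rule \<open>cell\<close> consumes \<open>One Circ\<close> to the left of \<open>Dot\<close> and leaves \<open>Circ\<close>, and \<open>tick\<close> backwards
restores \<open>One\<close> without touching the package.  Conjugation then resets the counter.
\<close>

definition toggle where
  "toggle k = counting k @ [y_at 0 True 1, y_at 1 False 0] @ K_ay.invs (counting k)"

lemma chain_toggle: "chain K_ay ((), Y 2) (toggle k) ((), Y 2)"
proof -
  have 1: "chain K_ay ((), Y 4) [y_at 0 True 1] ((), Y 3)" "chain K_ay ((), Y 3) [y_at 1 False 0] ((), Y 4)"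
    by (rule chain_y_at; simp)+
  show ?thesis
    using K_ay.chain_appendI[OF chain_counting[of k] K_ay.chain_appendI[OF 1(1)
        K_ay.chain_appendI[OF 1(2) K_ay.chain_invs[OF chain_counting[of k]]]]]
    unfolding toggle_def by (simp del: chain.simps)
qed

lemma acts_toggle:
  assumes "cell_rule k ts us"
  shows "tok.acts (toggle k) [Pack ts 0, Dot] = [Pack us 0, Dot]"
proof -
  have "tok.act (((), [Edge_y]), y_cell False, ((), [])) ([Pack us (Suc k)] @ [Circ, Dot])
      = [Pack us (Suc k)] @ [One, Circ, Dot]"
    by (rule act_y_at(2)[OF token_rule.tick]) simp
  moreover have "tok.acts (K_ay.invs (counting k)) [Pack us (Suc k), One, Circ, Dot] = [Pack us 0, Dot]"
    by (rule tok.acts_invs[OF chain_counting _ acts_counting]) simp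
  ultimately show ?thesis
    using assms by (simp add: toggle_def acts_counting act_y_at_0[OF token_rule.cell])
qed

text \<open>
One symbol pair per edge: the pairs of the top are packed, which takes one contraction less than
there are edges, and the pairs of the bottom are unpacked.
\<close>

definition simulation where
  "simulation k m n = packing (m - 1) @ toggle k @ K_ay.invs (packing (n - 1))"

lemma chain_simulation:
  assumes "0 < m" "0 < n"
  shows "chain K_ay ((), Y (2 * m)) (simulation k m n) ((), Y (2 * n))"
proof -
  have "2 * (m - 1) + 2 = 2 * m" "2 * (n - 1) + 2 = 2 * n" using assms by simp_all
  then show ?thesis
    using K_ay.chain_appendI[OF chain_packing[of "m - 1"] K_ay.chain_appendI[OF chain_toggle[of k]
        K_ay.chain_invs[OF chain_packing[of "n - 1"]]]]
    unfolding simulation_def by simp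
qed

lemma acts_simulation:
  assumes "cell_rule k ts us" "length ts = m" "length us = n" "0 < m" "0 < n"
  shows "tok.acts (simulation k m n) (encode ts) = encode us"
proof -
  have "tok.acts (K_ay.invs (packing (n - 1))) [Pack us 0, Dot] = encode us"
    using assms by (intro tok.acts_invs[OF chain_packing _ acts_packing]) auto
  then show ?thesis
    using assms by (simp add: simulation_def acts_packing acts_toggle)
qed

section \<open>The universal morphism\<close>

context labelled_2complex
begin

text \<open>
An orientation: the choice depends only on the set of a cell and its inverse, so exactly one of
the two is chosen.
\<close>

definition positive :: "'f \<Rightarrow> bool" where
  "positive f \<longleftrightarrow> (SOME g. g \<in> {f, cinv K f}) = f"

lemma positive_cinv: "f \<in> cells K \<Longrightarrow> positive (cinv K f) \<longleftrightarrow> \<not> positive f"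
proof -
  assume f: "f \<in> cells K"
  have "(SOME g. g \<in> {f, cinv K f}) \<in> {f, cinv K f}" by (rule someI) blast
  moreover have "{cinv K f, cinv K (cinv K f)} = {f, cinv K f}" using cinv_cinv[OF f] by auto
  ultimately show ?thesis using cinv_neq[OF f] unfolding positive_def by auto
qed

definition code :: "'f \<Rightarrow> nat" where
  "code f = to_nat (lab f, lab (cinv K f), tlen f, blen f)"

definition program :: "'f \<Rightarrow> (unit, edge, (edge list \<times> edge list) \<times> bool) atomic list" where
  "program f = simulation (code f) (tlen f) (blen f)"

text \<open>
Every edge is sent to \<open>y\<^sup>2\<close> and every positive cell to the 2-path that simulates it.  All cells
are covered, also those outside \<open>C\<close>, whose labels may coincide.
\<close>

definition universal_map :: "('v, 'e, 'f, unit, edge, (edge list \<times> edge list) \<times> bool) d2map" where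
  "universal_map = \<lparr> vmap = (\<lambda>_. ()), emap = (\<lambda>_. ((), Y 2)),
     cmap = (\<lambda>f. (((), Y (2 * tlen f)), if positive f then program f else K_ay.invs (program (cinv K f)))) \<rparr>"

lemma pmap_universal_map: "pmap universal_map p = ((), Y (2 * length (snd p)))"
proof -
  have "concat (map (\<lambda>e. Y 2) es) = Y (2 * length es)" for es :: "'e list"
    by (induction es) (simp_all add: replicate_add numeral_2_eq_2)
  then show ?thesis by (simp add: pmap_def universal_map_def)
qed

lemma cell_length_pos: "f \<in> cells K \<Longrightarrow> 0 < tlen f \<and> 0 < blen f"
  using ctop_nonempty cbot_nonempty by (auto simp: nonempty_def)

lemma chain_cmap:
  assumes f: "f \<in> cells K"
  shows "chain K_ay ((), Y (2 * tlen f)) (snd (cmap universal_map f)) ((), Y (2 * blen f))"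
proof -
  have f': "cinv K f \<in> cells K" using f by (rule cinv_cell)
  have "chain K_ay ((), Y (2 * tlen g)) (program g) ((), Y (2 * blen g))" if "g \<in> cells K" for g
    unfolding program_def using cell_length_pos[OF that] by (intro chain_simulation) auto
  from this[OF f] K_ay.chain_invs[OF this[OF f']] show ?thesis
    using f by (simp add: universal_map_def ctop_cinv cbot_cinv)
qed

lemma d2morphism_universal_map: "d2morphism K K_ay universal_map"
proof unfold_locales
  show "vmap universal_map v \<in> verts (skel K_ay)" for v
    by (simp add: K_ay_def rel_complex_def)
  fix f assume f: "f \<in> cells K"
  have e: "cmap universal_map f = (((), Y (2 * tlen f)), snd (cmap universal_map f))"
    by (simp add: universal_map_def)
  show "cmap universal_map f \<in> two_paths K_ay"
    by (subst e) (rule K_ay.chain_in_two_paths[OF chain_cmap[OF f]])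
  show "top_of (cmap universal_map f) = pmap universal_map (ctop K f)"
    by (subst e) (simp add: pmap_universal_map top_of_def start_of_def)
  show bot: "bot_of K_ay (cmap universal_map f) = pmap universal_map (cbot K f)"
    by (subst e) (simp add: pmap_universal_map K_ay.bot_of_chain[OF chain_cmap[OF f]])
  have "snd (cmap universal_map (cinv K f)) = K_ay.invs (snd (cmap universal_map f))"
  proof (cases "positive f")
    case True
    then show ?thesis using f by (simp add: universal_map_def positive_cinv cinv_cinv)
  next
    case False
    have "cinv K f \<in> cells K" using f by (rule cinv_cell)
    from chain_cmap[OF this] have "K_ay.invs (K_ay.invs (program (cinv K f))) = program (cinv K f)"
      using K_ay.invs_invs f False by (auto simp: universal_map_def positive_cinv)
    then show ?thesis using f False by (simp add: universal_map_def positive_cinv)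
  qed
  then show "cmap universal_map (cinv K f) = two_inv K_ay (cmap universal_map f)"
    unfolding two_inv_def bot K_ay.invs_def[symmetric]
    using f by (simp add: pmap_universal_map) (simp add: universal_map_def ctop_cinv)
qed (simp_all add: universal_map_def nonempty_def start_of_def)

interpretation \<phi>: d2morphism K K_ay universal_map
  by (rule d2morphism_universal_map)

text \<open>
For a negative cell this uses the backward clause for the inverse cell, whose side condition is
exactly that the inputs are not reducible.
\<close>

lemma acts_cmap:
  assumes f: "f \<in> C" and ts: "length ts = tlen f" "\<not> reducible f ts"
  shows "tok.acts (snd (cmap universal_map f)) (encode ts) = encode (outs (lab f) (blen f) ts)"
proof -
  have fc: "f \<in> cells K" using f C_cells by auto
  note pos = cell_length_pos[OF fc] and red = ts(2)[unfolded reducible_def]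
  show ?thesis
  proof (cases "positive f")
    case True
    have "cell_rule (code f) ts (outs (lab f) (blen f) ts)"
      by (rule cell_rule.forward[of _ _ "lab (cinv K f)" "tlen f"])
        (use ts pos red in \<open>auto simp: code_def\<close>)
    then have "tok.acts (program f) (encode ts) = encode (outs (lab f) (blen f) ts)"
      unfolding program_def using ts pos by (intro acts_simulation) auto
    then show ?thesis using True by (simp add: universal_map_def)
  next
    case False
    let ?g = "cinv K f" and ?us = "outs (lab f) (blen f) ts"
    have g: "?g \<in> cells K" "ctop K ?g = cbot K f" "cbot K ?g = ctop K f" "cinv K ?g = f"
      using fc by (auto simp: cinv_cell ctop_cinv cbot_cinv cinv_cinv)
    have "cell_rule (code ?g) ?us ts"
      by (rule cell_rule.backward[of _ "lab ?g" _ _ "tlen f"])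
        (use ts pos red g in \<open>auto simp: code_def\<close>)
    then have "tok.acts (program ?g) (encode ?us) = encode ts"
      unfolding program_def using ts pos g by (intro acts_simulation) auto
    moreover have "chain K_ay ((), Y (2 * blen f)) (program ?g) ((), Y (2 * tlen f))"
      using chain_cmap[OF g(1)] False fc g by (simp add: universal_map_def positive_cinv)
    ultimately have "tok.acts (K_ay.invs (program ?g)) (encode ts) = encode ?us"
      by (intro tok.acts_invs) auto
    then show ?thesis using False by (simp add: universal_map_def)
  qed
qed

text \<open>
On the encoded tuple of generators the image of a reduced 2-path computes its values in the term
algebra.
\<close>

lemma acts_reduced:
  "reduced P ds xs \<Longrightarrow> tok.acts (\<phi>.atomics_map ds) (encode (gens (length (snd P)))) = encode xs"
proof (induction rule: reduced.induct)
  case (snoc ds us ts vs p f q)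
  have "tok.acts (whiskers (pmap universal_map p) (snd (cmap universal_map f)) (pmap universal_map q))
      (encode us @ encode ts @ encode vs)
    = encode us @ tok.acts (snd (cmap universal_map f)) (encode ts) @ encode vs"
    using snoc.hyps C_cells
    by (intro tok.acts_whiskers[OF chain_cmap]) (auto simp: pmap_universal_map)
  then show ?case using snoc.IH acts_cmap snoc.hyps by simp
qed simp

text \<open>
If both 2-paths act in the same way, then their quotient fixes the encoded tuple of generators.
So does the image of a reduced 2-path homotopic to the quotient, and this reduced 2-path is empty.
\<close>

theorem universal_map_faithful:
  assumes "chain K P ds Q" "chain K P es Q"
    and C: "\<forall>(p, f, q) \<in> set ds \<union> set es. f \<in> C"
    and eq: "\<And>xs. length xs = 2 * length (snd P) \<Longrightarrow>
      tok.acts (\<phi>.atomics_map ds) xs = tok.acts (\<phi>.atomics_map es) xs"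
  shows "hty P ds es"
proof -
  let ?g = "gens (length (snd P))"
  have es: "chain K Q (invs es) P" by (rule chain_invs[OF assms(2)])
  have de: "chain K P (ds @ invs es) P" using assms(1) es by (rule chain_appendI)
  have "\<forall>(p, f, q) \<in> set (ds @ invs es). f \<in> C"
    using C C_cinv by (fastforce simp: invs_def)
  then obtain fs xs where fs: "reduced P fs xs" "hty P (ds @ invs es) fs"
    using reduced_exists[OF de] by blast
  have invariant: "tok.acts (\<phi>.atomics_map as) (encode ?g) = tok.acts (\<phi>.atomics_map bs) (encode ?g)"
    if "hty P as bs" for as bs
    using tok.acts_hty[OF \<phi>.atomics_map_homotopic[OF that[unfolded hty_def]], of "encode ?g"]
    by (simp add: pmap_universal_map)
  have "encode xs = tok.acts (\<phi>.atomics_map fs) (encode ?g)" using acts_reduced[OF fs(1)] by simp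
  also have "\<dots> = tok.acts (\<phi>.atomics_map (ds @ invs es)) (encode ?g)" using invariant[OF fs(2)] by simp
  also have "\<dots> = tok.acts (\<phi>.atomics_map (es @ invs es)) (encode ?g)" using eq[of "encode ?g"] by simp
  also have "\<dots> = encode ?g" using invariant[OF hty_invs[OF assms(2)]] by simp
  finally have "xs = ?g" by (simp add: encode_inject)
  then have "fs = []" by (rule reduced_gens[OF fs(1)])
  then have h: "hty P (ds @ invs es) []" using fs by simp
  have "hty P (ds @ invs es) (es @ invs es)"
    using hty_trans[OF h hty_sym[OF hty_invs[OF assms(2)]]] .
  then show ?thesis by (rule hty_cancel_right[OF _ assms(1,2) es])
qed

lemma nonsingular_universal_map:
  assumes "C = cells K"
  shows "nonsingular K K_ay universal_map"
  unfolding nonsingular_def p_nonsingular_def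
proof (intro ballI impI inj_onI)
  fix p A B
  assume "A \<in> carrier (diagram_group K p)" "B \<in> carrier (diagram_group K p)"
    and eq: "induced K_ay universal_map A = induced K_ay universal_map B"
  then obtain ds es where ds: "A = hclass K (p, ds)" "chain K p ds p"
    and es: "B = hclass K (p, es)" "chain K p es p"
    by (auto simp: carrier_diagram_group)
  have "K_ay.hty (pmap universal_map p) (\<phi>.atomics_map ds) (\<phi>.atomics_map es)"
    using eq K_ay.hclass_chain_eq_iff[OF \<phi>.chain_atomics_map[OF ds(2)]]
    unfolding ds es \<phi>.induced_hclass[OF ds(2)] \<phi>.induced_hclass[OF es(2)] by blast
  then have "hty p ds es"
    using tok.acts_hty atomics_chain[OF ds(2)] atomics_chain[OF es(2)] assms
    by (intro universal_map_faithful[OF ds(2) es(2)]) (auto simp: pmap_universal_map dest: atomicsD(2))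
  then show "A = B" using hclass_chain_eq_iff[OF ds(2)] ds es by simp
qed

text \<open>
Adding \<open>a\<close> on the left turns 2-paths between powers of \<open>y\<close> into 2-paths between the paths
\<open>a y\<^sup>n\<close>, which are all connected to \<open>a\<close>.
\<close>

definition a_whiskers where
  "a_whiskers ds = whiskers ((), [Edge_a]) (\<phi>.atomics_map ds) ((), [])"

lemma chain_a_whiskers:
  assumes "chain K P ds Q"
  shows "chain K_ay (aY (2 * length (snd P))) (a_whiskers ds) (aY (2 * length (snd Q)))"
  using K_ay.whiskers_chain[OF \<phi>.chain_atomics_map[OF assms], of "((), [Edge_a])" "((), [])"]
  by (simp add: a_whiskers_def pmap_universal_map)

lemma a_whiskers_hty:
  assumes "hty P ds es"
  shows "K_ay.hty (aY (2 * length (snd P))) (a_whiskers ds) (a_whiskers es)"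
  using K_ay.whiskers_hty[OF \<phi>.atomics_map_homotopic[OF assms[unfolded hty_def]], of "((), [Edge_a])" "((), [])"]
  by (simp add: a_whiskers_def pmap_universal_map)

text \<open>
The action detects a 2-path also in the presence of the additional edge, whose symbol may be any
fixed one.
\<close>

lemma a_whiskers_faithful:
  assumes "chain K P ds Q" "chain K P es Q" "\<forall>(p, f, q) \<in> set ds \<union> set es. f \<in> C"
    and h: "K_ay.hty (aY (2 * length (snd P))) (a_whiskers ds) (a_whiskers es)"
  shows "hty P ds es"
proof (rule universal_map_faithful[OF assms(1-3)])
  fix xs :: "token list"
  assume len: "length xs = 2 * length (snd P)"
  have "tok.acts (a_whiskers cs) ([Dot] @ xs @ []) = [Dot] @ tok.acts (\<phi>.atomics_map cs) xs @ []"
    if "chain K P cs Q" for cs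
    unfolding a_whiskers_def
    using len by (intro tok.acts_whiskers[OF \<phi>.chain_atomics_map[OF that]]) (auto simp: pmap_universal_map)
  moreover have "tok.acts (a_whiskers ds) (Dot # xs) = tok.acts (a_whiskers es) (Dot # xs)"
    by (rule tok.acts_hty[OF h]) (simp add: len)
  ultimately show "tok.acts (\<phi>.atomics_map ds) xs = tok.acts (\<phi>.atomics_map es) xs"
    using assms(1,2) by simp
qed

lemma loop_a_whiskers_eq_iff:
  assumes "chain K P ds P" "chain K P es P" "\<forall>(p, f, q) \<in> set ds \<union> set es. f \<in> C"
  defines "n \<equiv> 2 * length (snd P)"
  shows "loop n (a_whiskers ds) n = loop n (a_whiskers es) n \<longleftrightarrow> hty P ds es"
proof
  note c = chain_a_whiskers[OF assms(1), folded n_def] chain_a_whiskers[OF assms(2), folded n_def]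
  note i = K_ay.chain_invs[OF chain_grow[of n]]
  assume "loop n (a_whiskers ds) n = loop n (a_whiskers es) n"
  then have "K_ay.hty (aY 0) (grow n @ a_whiskers ds @ K_ay.invs (grow n))
      (grow n @ a_whiskers es @ K_ay.invs (grow n))"
    unfolding loop_def K_ay.hclass_chain_eq_iff[OF chain_loop[OF c(1)]] .
  then have "K_ay.hty (aY n) (a_whiskers ds @ K_ay.invs (grow n)) (a_whiskers es @ K_ay.invs (grow n))"
    by (rule K_ay.hty_cancel_left[OF _ chain_grow K_ay.chain_appendI[OF c(1) i] K_ay.chain_appendI[OF c(2) i]])
  then have "K_ay.hty (aY n) (a_whiskers ds) (a_whiskers es)"
    by (rule K_ay.hty_cancel_right[OF _ c i])
  then show "hty P ds es"
    unfolding n_def by (rule a_whiskers_faithful[OF assms(1-3)])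
next
  assume "hty P ds es"
  then show "loop n (a_whiskers ds) n = loop n (a_whiskers es) n"
    using loop_cong[OF a_whiskers_hty chain_a_whiskers[OF assms(1)]] by (simp add: n_def)
qed

text \<open>
Representatives over \<open>C\<close> suffice: the homomorphism to the group at \<open>a\<close> is defined by the
morphism on the whole complex, and its injectivity is tested on representatives only.
\<close>

lemma diagram_group_embeds:
  assumes P: "P \<in> paths (skel K)"
    and rep: "\<And>A. A \<in> carrier (diagram_group K P) \<Longrightarrow>
      \<exists>ds. A = hclass K (P, ds) \<and> chain K P ds P \<and> (\<forall>(p, f, q) \<in> set ds. f \<in> C)"
  shows "\<exists>S. subgroup S H_ay \<and> diagram_group K P \<cong> H_ay\<lparr>carrier := S\<rparr>"
proof -
  let ?D = "diagram_group K P" and ?n = "2 * length (snd P)"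
  interpret D: group ?D by (rule group_diagram_group[OF P])
  interpret H: group H_ay unfolding H_ay_eq by (rule K_ay.group_diagram_group) simp
  have "\<exists>r. \<forall>A\<in>carrier ?D. A = hclass K (P, r A) \<and> chain K P (r A) P \<and> (\<forall>(p, f, q) \<in> set (r A). f \<in> C)"
    by (rule bchoice) (use rep in blast)
  then obtain r where "\<forall>A\<in>carrier ?D. A = hclass K (P, r A) \<and> chain K P (r A) P \<and> (\<forall>(p, f, q) \<in> set (r A). f \<in> C)" ..
  note r = this[THEN bspec, THEN conjunct1] this[THEN bspec, THEN conjunct2, THEN conjunct1]
    this[THEN bspec, THEN conjunct2, THEN conjunct2]
  define \<psi> where "\<psi> A = loop ?n (a_whiskers (r A)) ?n" for A
  have "\<psi> \<in> hom ?D H_ay"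
  proof (rule homI)
    fix A B assume A: "A \<in> carrier ?D" and B: "B \<in> carrier ?D"
    show "\<psi> A \<in> carrier H_ay"
      unfolding \<psi>_def by (rule loop_closed[OF chain_a_whiskers[OF r(2)[OF A]]])
    have AB: "A \<otimes>\<^bsub>?D\<^esub> B \<in> carrier ?D" using A B by simp
    have c: "chain K P (r A @ r B) P" using r(2)[OF A] r(2)[OF B] by (rule chain_appendI)
    have "hclass K (P, r A @ r B) = hclass K (P, r (A \<otimes>\<^bsub>?D\<^esub> B))"
      using mult_diagram_group[OF r(2)[OF A] r(2)[OF B]] r(1)[OF A] r(1)[OF B] r(1)[OF AB] by simp
    then have "hty P (r A @ r B) (r (A \<otimes>\<^bsub>?D\<^esub> B))" using hclass_chain_eq_iff[OF c] by simp
    then have "\<psi> (A \<otimes>\<^bsub>?D\<^esub> B) = loop ?n (a_whiskers (r A @ r B)) ?n"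
      using loop_cong[OF a_whiskers_hty chain_a_whiskers[OF c]] by (simp add: \<psi>_def)
    also have "\<dots> = \<psi> A \<otimes>\<^bsub>H_ay\<^esub> \<psi> B"
      using loop_append[OF chain_a_whiskers[OF r(2)[OF A]] chain_a_whiskers[OF r(2)[OF B]]]
      by (simp add: \<psi>_def a_whiskers_def)
    finally show "\<psi> (A \<otimes>\<^bsub>?D\<^esub> B) = \<psi> A \<otimes>\<^bsub>H_ay\<^esub> \<psi> B" .
  qed
  then interpret h: group_hom ?D H_ay \<psi> by unfold_locales
  have "inj_on \<psi> (carrier ?D)"
  proof (rule inj_onI)
    fix A B assume A: "A \<in> carrier ?D" and B: "B \<in> carrier ?D" and "\<psi> A = \<psi> B"
    then have "hty P (r A) (r B)"
      using loop_a_whiskers_eq_iff[OF r(2)[OF A] r(2)[OF B]] r(3)[OF A] r(3)[OF B]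
      unfolding \<psi>_def by blast
    then have "hclass K (P, r A) = hclass K (P, r B)" using hclass_chain_eq_iff[OF r(2)[OF A]] by blast
    then show "A = B" using r(1)[OF A] r(1)[OF B] by metis
  qed
  then have "\<psi> \<in> iso ?D (H_ay\<lparr>carrier := \<psi> ` carrier ?D\<rparr>)"
    using \<open>\<psi> \<in> hom ?D H_ay\<close> by (auto simp: iso_def hom_def bij_betw_def)
  then show ?thesis using h.img_is_subgroup is_isoI by blast
qed

end

theorem K_ay_universal: "universal_d2complex TYPE('v \<times> 'e \<times> 'f) K_ay"
  unfolding universal_d2complex_def
proof (intro conjI allI impI)
  show "directed_2complex K_ay" by (rule K_ay.directed_2complex_axioms)
  fix L :: "('v, 'e, 'f) d2complex"
  assume L: "directed_2complex L \<and> countable_d2complex L"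
  then interpret L: directed_2complex L by simp
  interpret L: labelled_2complex L "cells L" "to_nat_on (cells L)"
    using L by unfold_locales (auto simp: L.cinv_cell countable_d2complex_def)
  show "\<exists>\<phi>. d2morphism L K_ay \<phi> \<and> nonsingular L K_ay \<phi>"
    using L.d2morphism_universal_map L.nonsingular_universal_map by blast
qed

text \<open>
The complex need not be countable, but countably many cells occur in representatives of the
elements of a countable diagram group.  The labels are injective on these cells and their inverses.
\<close>

theorem H_ay_universal: "universal_diagram_group TYPE('v \<times> 'e \<times> 'f) H_ay"
  unfolding universal_diagram_group_def
proof (intro allI impI)
  fix L :: "('v, 'e, 'f) d2complex" and p
  assume L: "directed_2complex L \<and> p \<in> paths (skel L) \<and> countable (carrier (diagram_group L p))"
  then interpret L: directed_2complex L by simp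
  have "\<exists>r. \<forall>A\<in>carrier (diagram_group L p). A = hclass L (p, r A) \<and> chain L p (r A) p"
    by (rule bchoice) (use L.carrier_diagram_group in blast)
  then obtain r where "\<forall>A\<in>carrier (diagram_group L p). A = hclass L (p, r A) \<and> chain L p (r A) p" ..
  note r = this[THEN bspec, THEN conjunct1] this[THEN bspec, THEN conjunct2]
  define C0 where "C0 = (\<Union>A\<in>carrier (diagram_group L p). (\<lambda>(p, f, q). f) ` set (r A))"
  \<comment> \<open>Quotients of representatives also use the inverse cells.\<close>
  define C where "C = C0 \<union> cinv L ` C0"
  have C0: "C0 \<subseteq> cells L"
    using L.atomics_chain[OF r(2)] by (fastforce simp: C0_def dest: L.atomicsD(2))
  have "countable C0" unfolding C0_def using L by (intro countable_UN) (auto intro: countable_finite)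
  then have "countable C" by (simp add: C_def)
  then interpret L: labelled_2complex L C "to_nat_on C"
    using C0 by unfold_locales (auto simp: C_def L.cinv_cell L.cinv_cinv subset_iff)
  have "\<exists>ds. A = hclass L (p, ds) \<and> chain L p ds p \<and> (\<forall>(p, f, q) \<in> set ds. f \<in> C)"
    if "A \<in> carrier (diagram_group L p)" for A
    using r[OF that] that by (intro exI[of _ "r A"]) (force simp: C_def C0_def)
  then show "\<exists>S. subgroup S H_ay \<and> diagram_group L p \<cong> H_ay\<lparr>carrier := S\<rparr>"
    using L by (intro L.diagram_group_embeds) auto
qed

theorem theorem6p9:
  shows "universal_d2complex TYPE('v \<times> 'e \<times> 'f) K_ay
    \<and> universal_diagram_group TYPE('v1 \<times> 'e1 \<times> 'f1) H_ay
    \<and> H_ay \<cong> presented_group (UNIV :: nat set)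
        {(wconj (gen j) (gen i), gen (j + 1)) |i j. i + 1 < j}
    \<and> H_ay \<cong> presented_group {0, 1, 2 :: nat}
        ({(wconj (gen 2) (wpow (gen 0) i), wconj (gen 2) (wpow (gen 0) (i - 1) @ gen 1)) |i. i \<in> {2, 3, 4}}
         \<union> {(wconj (gen 2) (wpow (gen 0) j), wconj (gen 2) (wpow (gen 0) (j - 1) @ gen 2)) |j. j \<in> {3, 4, 5}})"
  using K_ay_universal H_ay_universal H_ay_iso_shift
    iso_trans[OF H_ay_iso_shift presented_group_shift_iso_six]
  unfolding shift_relations_def six_relations_def by blast

end
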